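(* Let $1\le p<\infty$ and let $f\in L^p$ be regular. The following are equivalent. (i) There exist functions $g_S\in L^p$, $S\subset\{1,\dots,d\}$, with $g_S\in\bigcap_{q\in S}\big(L^p(\mathcal F_0^{(q)})\ominus L^p(\mathcal F_{-1}^{(q)})\big)$, such that $$f=\sum_{S\subset\{1,\dots,d\}}\ \prod_{q\in S^c}(I-U_{\epsilon_q})\,g_S .$$ (ii) For all $S\subset\{1,\dots,d\}$ and all $S'\subset S^c$, the series $$\sum_{i_r\in\mathbb Z,\,r\in S}\ \sum_{i_u\ge0,\,u\in S'}\ \sum_{i_v\ge1,\,v\in S^c\setminus S'}\Big(\prod_{r\in S}P_0^{(r)}\Big)\Big(\prod_{u\in S'}Q_{-1}^{(u)}\Big)\Big(\prod_{v\in S^c\setminus S'}(I-Q_{-1}^{(v)})\Big)\Big(\prod_{r\in S}U_{\epsilon_r}^{i_r}\Big)\Big(\prod_{u\in S'}U_{\epsilon_u}^{i_u}\Big)\Big(\prod_{v\in S^c\setminus S'}U_{\epsilon_v}^{-i_v}\Big)f$$ converges in $L^p$. Moreover, if $f$ is adapted, then (i) holds if and only if the series $$\sum_{i_1=0}^\infty\cdots\sum_{i_d=0}^\infty E\big(U_{i_1,\dots,i_d}f\,|\,\mathcal F_{\underline 0}\big)$$ converges in $L^p$.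
   Context: Let $d\ge1$, let $(\Omega,\mathcal A,\mu)$ be a probability space and $(T_{\underline i})_{\underline i\in\mathbb Z^d}$ a $\mathbb Z^d$-action on it generated by commuting invertible measure-preserving transformations $T_{\epsilon_1},\dots,T_{\epsilon_d}$, where $\epsilon_q\in\mathbb Z^d$ has $1$ at the $q$-th place and $0$ elsewhere. $U_{\underline i}f=f\circ T_{\underline i}$. $I$ is the identity operator, an empty product of operators is $I$, $S^c=\{1,\dots,d\}\setminus S$, $\underline 0=(0,\dots,0)$, and $\underline i\le\underline j$ means $i_q\le j_q$ for all $q$. Functions are real-valued. There is a completely commuting filtration $(\mathcal F_{\underline j})_{\underline j\in\mathbb Z^d}$: there is a sub-$\sigma$-algebra $\mathcal F\subset\mathcal A$ with $\mathcal F_{\underline i}=T_{-\underline i}\mathcal F$ for all $\underline i$; $\mathcal F_{\underline i}\subset\mathcal F_{\underline j}$ if $\underline i\le\underline j$; and for every integrable $f$, $E\big(E(f|\mathcal F_{i_1,\dots,i_d})\,|\,\mathcal F_{j_1,\dots,j_d}\big)=E(f|\mathcal F_{i_1\wedge j_1,\dots,i_d\wedge j_d})$. $\mathcal F_l^{(q)}$ is the $\sigma$-algebra generated by all $\mathcal F_{\underline i}$ with $i_q\le l$; $\mathcal F_{-\infty}^{(q)}=\bigcap_{k}\mathcal F_{-k}^{(q)}$; $\mathcal F_{\underline\infty}$ is the $\sigma$-algebra generated by all $\mathcal F_{\underline i}$. For $\sigma$-algebras $\mathcal G\subset\mathcal H$, $L^p(\mathcal H)\ominus L^p(\mathcal G)=\{h\in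 L^p(\mathcal H):E(h|\mathcal G)=0\}$. $Q_l^{(q)}f=E(f|\mathcal F_l^{(q)})$ and $P_l^{(q)}f=E(f|\mathcal F_l^{(q)})-E(f|\mathcal F_{l-1}^{(q)})$; all these operators commute. An integrable function $f$ is regular if it is $\mathcal F_{\underline\infty}$-measurable and $E(f|\mathcal F_{-\infty}^{(q)})=0$ for every $1\le q\le d$. It is adapted if it is $\mathcal F_{\underline 0}$-measurable. Multiple series are read as iterated series (one index after another), converging in $L^p$; in two-sided series both ends tend to infinity independently. *)

theory Defs
  imports "HOL-Probability.Probability"
begin

text \<open>
  The lattice \<open>\<int>\<^sup>d\<close> is the type \<^typ>\<open>'n \<Rightarrow> int\<close> with \<^typ>\<open>'n\<close> finite (and, as every type,
  nonempty), so that coordinate sets \<open>S\<close> are terms of type \<^typ>\<open>'n set\<close>, the complement of \<open>S\<close> is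
  \<^term>\<open>- S\<close>, and the order and the infimum on \<^typ>\<open>'n \<Rightarrow> int\<close> are the coordinatewise ones.
  An enumeration of the coordinates by a distinct list \<open>qs\<close> plays the role of \<open>1, \<dots>, d\<close>.
  Elements of \<open>L\<^sup>p\<close> are represented by functions; equations and measurability with respect to
  sub-\<open>\<sigma>\<close>-algebras are understood almost everywhere.
\<close>

subsection \<open>The spaces \<open>L\<^sup>p\<close>\<close>

definition Lp :: "'a measure \<Rightarrow> real \<Rightarrow> ('a \<Rightarrow> real) set" where
  "Lp M p = {f \<in> borel_measurable M. integrable M (\<lambda>x. \<bar>f x\<bar> powr p)}"

definition Lp_norm :: "'a measure \<Rightarrow> real \<Rightarrow> ('a \<Rightarrow> real) \<Rightarrow> real" where
  "Lp_norm M p f = (\<integral>x. \<bar>f x\<bar> powr p \<partial>M) powr (1 / p)"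

definition Lp_tendsto ::
    "'a measure \<Rightarrow> real \<Rightarrow> ('i \<Rightarrow> 'a \<Rightarrow> real) \<Rightarrow> ('a \<Rightarrow> real) \<Rightarrow> 'i filter \<Rightarrow> bool" where
  "Lp_tendsto M p X g A \<longleftrightarrow>
     g \<in> Lp M p \<and> (\<forall>\<^sub>F n in A. X n \<in> Lp M p) \<and>
     ((\<lambda>n. Lp_norm M p (\<lambda>x. X n x - g x)) \<longlongrightarrow> 0) A"

definition ae_measurable :: "'a measure \<Rightarrow> 'a measure \<Rightarrow> ('a \<Rightarrow> real) \<Rightarrow> bool" where
  "ae_measurable M H f \<longleftrightarrow> (\<exists>h \<in> borel_measurable H. AE x in M. f x = h x)"

text \<open>\<open>L\<^sup>p(H) \<ominus> L\<^sup>p(G)\<close> for sub-\<open>\<sigma>\<close>-algebras \<open>G \<subseteq> H\<close> of \<open>M\<close>.\<close>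

definition Lp_diff :: "'a measure \<Rightarrow> real \<Rightarrow> 'a measure \<Rightarrow> 'a measure \<Rightarrow> ('a \<Rightarrow> real) set" where
  "Lp_diff M p H G =
     {h \<in> Lp M p. ae_measurable M H h \<and> (AE x in M. real_cond_exp M G h x = 0)}"

subsection \<open>The action and the filtration\<close>

definition unit_idx :: "'n \<Rightarrow> 'n \<Rightarrow> int" where
  "unit_idx q = (\<lambda>r. if r = q then 1 else 0)"

definition measure_preserving_action ::
    "'a measure \<Rightarrow> (('n \<Rightarrow> int) \<Rightarrow> 'a \<Rightarrow> 'a) \<Rightarrow> bool" where
  "measure_preserving_action M T \<longleftrightarrow>
     (\<forall>i. T i \<in> measurable M M \<and> distr M M (T i) = M) \<and>
     (\<forall>x \<in> space M. T (\<lambda>_. 0) x = x) \<and>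
     (\<forall>i j. \<forall>x \<in> space M. T (\<lambda>q. i q + j q) x = T i (T j x))"

definition koop ::
    "(('n \<Rightarrow> int) \<Rightarrow> 'a \<Rightarrow> 'a) \<Rightarrow> ('n \<Rightarrow> int) \<Rightarrow> ('a \<Rightarrow> real) \<Rightarrow> 'a \<Rightarrow> real" where
  "koop T i f = f \<circ> T i"

text \<open>The power \<open>U\<^bsub>\<epsilon>\<^sub>q\<^esub>\<^sup>k\<close> for an integer \<open>k\<close>, which by the action property is \<open>U\<^bsub>k \<epsilon>\<^sub>q\<^esub>\<close>.\<close>

definition koop_pow ::
    "(('n \<Rightarrow> int) \<Rightarrow> 'a \<Rightarrow> 'a) \<Rightarrow> 'n \<Rightarrow> int \<Rightarrow> ('a \<Rightarrow> real) \<Rightarrow> 'a \<Rightarrow> real" where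
  "koop_pow T q k = koop T (\<lambda>r. k * unit_idx q r)"

definition completely_commuting_filtration ::
    "'a measure \<Rightarrow> (('n \<Rightarrow> int) \<Rightarrow> 'a \<Rightarrow> 'a) \<Rightarrow> (('n \<Rightarrow> int) \<Rightarrow> 'a measure) \<Rightarrow> bool" where
  "completely_commuting_filtration M T F \<longleftrightarrow>
     (\<forall>i. subalgebra M (F i)) \<and>
     (\<exists>G. subalgebra M G \<and> (\<forall>i. sets (F i) = (\<lambda>A. T (- i) ` A) ` sets G)) \<and>
     (\<forall>i j. i \<le> j \<longrightarrow> sets (F i) \<subseteq> sets (F j)) \<and>
     (\<forall>f i j. integrable M f \<longrightarrow>
        (AE x in M. real_cond_exp M (F j) (real_cond_exp M (F i) f) x
                  = real_cond_exp M (F (inf i j)) f x))"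

definition marginal ::
    "'a measure \<Rightarrow> (('n \<Rightarrow> int) \<Rightarrow> 'a measure) \<Rightarrow> 'n \<Rightarrow> int \<Rightarrow> 'a measure" where
  "marginal M F q l = sigma (space M) (\<Union>i \<in> {i. i q \<le> l}. sets (F i))"

definition marginal_tail ::
    "'a measure \<Rightarrow> (('n \<Rightarrow> int) \<Rightarrow> 'a measure) \<Rightarrow> 'n \<Rightarrow> 'a measure" where
  "marginal_tail M F q = sigma (space M) (\<Inter>k::nat. sets (marginal M F q (- int k)))"

definition filtration_sup ::
    "'a measure \<Rightarrow> (('n \<Rightarrow> int) \<Rightarrow> 'a measure) \<Rightarrow> 'a measure" where
  "filtration_sup M F = sigma (space M) (\<Union>i. sets (F i))"

definition Q_op ::
    "'a measure \<Rightarrow> (('n \<Rightarrow> int) \<Rightarrow> 'a measure) \<Rightarrow> int \<Rightarrow> 'n \<Rightarrow> ('a \<Rightarrow> real) \<Rightarrow> 'a \<Rightarrow> real" where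
  "Q_op M F l q f = real_cond_exp M (marginal M F q l) f"

definition P_op ::
    "'a measure \<Rightarrow> (('n \<Rightarrow> int) \<Rightarrow> 'a measure) \<Rightarrow> int \<Rightarrow> 'n \<Rightarrow> ('a \<Rightarrow> real) \<Rightarrow> 'a \<Rightarrow> real" where
  "P_op M F l q f = (\<lambda>x. Q_op M F l q f x - Q_op M F (l - 1) q f x)"

definition regular ::
    "'a measure \<Rightarrow> (('n \<Rightarrow> int) \<Rightarrow> 'a measure) \<Rightarrow> ('a \<Rightarrow> real) \<Rightarrow> bool" where
  "regular M F f \<longleftrightarrow>
     integrable M f \<and> ae_measurable M (filtration_sup M F) f \<and>
     (\<forall>q. AE x in M. real_cond_exp M (marginal_tail M F q) f x = 0)"

definition adapted ::
    "'a measure \<Rightarrow> (('n \<Rightarrow> int) \<Rightarrow> 'a measure) \<Rightarrow> ('a \<Rightarrow> real) \<Rightarrow> bool" where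
  "adapted M F f \<longleftrightarrow> ae_measurable M (F (\<lambda>_. 0)) f"

subsection \<open>Iterated series in \<open>L\<^sup>p\<close>\<close>

datatype idx_range = All_ints | From int

primrec idx_set :: "idx_range \<Rightarrow> int set" where
  "idx_set All_ints = UNIV"
| "idx_set (From k) = {k..}"

primrec Lp_sums ::
    "'a measure \<Rightarrow> real \<Rightarrow> idx_range \<Rightarrow> (int \<Rightarrow> 'a \<Rightarrow> real) \<Rightarrow> ('a \<Rightarrow> real) \<Rightarrow> bool" where
  "Lp_sums M p All_ints b s \<longleftrightarrow>
     Lp_tendsto M p (\<lambda>(m, n) x. \<Sum>k = - int m..int n. b k x) s (sequentially \<times>\<^sub>F sequentially)"
| "Lp_sums M p (From a) b s \<longleftrightarrow>
     Lp_tendsto M p (\<lambda>n x. \<Sum>k = a..<a + int n. b k x) s sequentially"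

text \<open>
  The iterated series over the coordinates in the given list, the head of the list being the
  outermost summation index; \<open>i\<close> holds the current values of the indices that are not summed.
\<close>

primrec iterated_Lp_sums ::
    "'a measure \<Rightarrow> real \<Rightarrow> ('n \<Rightarrow> idx_range) \<Rightarrow> 'n list \<Rightarrow> (('n \<Rightarrow> int) \<Rightarrow> 'a \<Rightarrow> real) \<Rightarrow>
      ('n \<Rightarrow> int) \<Rightarrow> ('a \<Rightarrow> real) \<Rightarrow> bool" where
  "iterated_Lp_sums M p R [] a i s \<longleftrightarrow> s = a i"
| "iterated_Lp_sums M p R (q # qs) a i s \<longleftrightarrow>
     (\<exists>b. (\<forall>k \<in> idx_set (R q). iterated_Lp_sums M p R qs a (i(q := k)) (b k)) \<and>
          Lp_sums M p (R q) b s)"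

text \<open>
  When \<open>qs\<close> lists all coordinates, every index is summed and the initial value \<open>0\<close> is irrelevant.
\<close>

definition iterated_Lp_summable ::
    "'a measure \<Rightarrow> real \<Rightarrow> ('n \<Rightarrow> idx_range) \<Rightarrow> 'n list \<Rightarrow> (('n \<Rightarrow> int) \<Rightarrow> 'a \<Rightarrow> real) \<Rightarrow> bool" where
  "iterated_Lp_summable M p R qs a \<longleftrightarrow> (\<exists>s. iterated_Lp_sums M p R qs a (\<lambda>_. 0) s)"

subsection \<open>The conditions\<close>

text \<open>
  A product of commuting operators \<open>A q\<close> over a set \<open>S\<close> of coordinates is the composition
  \<^term>\<open>foldr A (filter (\<lambda>q. q \<in> S) qs)\<close>, which is the identity if \<open>S\<close> is empty.
\<close>

definition mart_cobound_decomp ::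
    "'a measure \<Rightarrow> (('n::finite \<Rightarrow> int) \<Rightarrow> 'a \<Rightarrow> 'a) \<Rightarrow> (('n \<Rightarrow> int) \<Rightarrow> 'a measure) \<Rightarrow>
      'n list \<Rightarrow> real \<Rightarrow> ('a \<Rightarrow> real) \<Rightarrow> bool" where
  "mart_cobound_decomp M T F qs p f \<longleftrightarrow>
     (\<exists>g. (\<forall>S. g S \<in> Lp M p \<and>
               (\<forall>q \<in> S. g S \<in> Lp_diff M p (marginal M F q 0) (marginal M F q (- 1)))) \<and>
          (AE x in M. f x =
             (\<Sum>S \<in> UNIV. foldr (\<lambda>q h y. h y - koop T (unit_idx q) h y)
                              (filter (\<lambda>q. q \<in> - S) qs) (g S) x)))"

definition series_term ::
    "'a measure \<Rightarrow> (('n \<Rightarrow> int) \<Rightarrow> 'a \<Rightarrow> 'a) \<Rightarrow> (('n \<Rightarrow> int) \<Rightarrow> 'a measure) \<Rightarrow> 'n list \<Rightarrow>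
      'n set \<Rightarrow> 'n set \<Rightarrow> ('a \<Rightarrow> real) \<Rightarrow> ('n \<Rightarrow> int) \<Rightarrow> 'a \<Rightarrow> real" where
  "series_term M T F qs S S' f i =
     (let rs = filter (\<lambda>q. q \<in> S) qs;
          us = filter (\<lambda>q. q \<in> S') qs;
          vs = filter (\<lambda>q. q \<in> - S - S') qs
      in foldr (P_op M F 0) rs
          (foldr (Q_op M F (- 1)) us
            (foldr (\<lambda>v h x. h x - Q_op M F (- 1) v h x) vs
              (foldr (\<lambda>r. koop_pow T r (i r)) rs
                (foldr (\<lambda>u. koop_pow T u (i u)) us
                  (foldr (\<lambda>v. koop_pow T v (- i v)) vs f))))))"

definition series_range :: "'n set \<Rightarrow> 'n set \<Rightarrow> 'n \<Rightarrow> idx_range" where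
  "series_range S S' q = (if q \<in> S then All_ints else if q \<in> S' then From 0 else From 1)"

text \<open>
  The series is summed in the order in which it is displayed: the indices in \<open>S\<close> are outermost,
  followed by those in \<open>S'\<close> and by the remaining ones, each group in the order of \<open>qs\<close>.
\<close>

definition series_converges ::
    "'a measure \<Rightarrow> (('n \<Rightarrow> int) \<Rightarrow> 'a \<Rightarrow> 'a) \<Rightarrow> (('n \<Rightarrow> int) \<Rightarrow> 'a measure) \<Rightarrow> 'n list \<Rightarrow>
      real \<Rightarrow> 'n set \<Rightarrow> 'n set \<Rightarrow> ('a \<Rightarrow> real) \<Rightarrow> bool" where
  "series_converges M T F qs p S S' f \<longleftrightarrow>
     iterated_Lp_summable M p (series_range S S')
       (filter (\<lambda>q. q \<in> S) qs @ filter (\<lambda>q. q \<in> S') qs @ filter (\<lambda>q. q \<in> - S - S') qs)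
       (series_term M T F qs S S' f)"

end

theory Submission
  imports Defs "HOL-Library.Function_Algebras"
begin

text \<open>
  All operators are coordinatewise, so the proof reduces to one coordinate at a time. There the
  partial sums of each series telescope. For the series of the terms \<open>Q\<^bsub>-1\<^esub> U\<^sup>k x\<close>, for instance,
  \<open>Q\<^bsub>-1\<^esub> (I - U) Q\<^bsub>-1\<^esub>\<close> maps the partial sums to \<open>Q\<^bsub>-1\<^esub> x - Q\<^bsub>-1\<^esub> U\<^sup>n x\<close>, where the last term
  is \<open>U\<^sup>n Q\<^bsub>-1-n\<^esub> x\<close> and tends to \<open>0\<close> for regular \<open>x\<close>. Hence a sum \<open>s\<close> of the series satisfies
  \<open>Q\<^bsub>-1\<^esub> x = Q\<^bsub>-1\<^esub> (I - U) Q\<^bsub>-1\<^esub> s = m + (I - U) g\<close> with a martingale difference \<open>m\<close>. This relation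
  is algebraic, so the order of summation does not matter. The series with \<open>P\<^bsub>0\<^esub>\<close> enter only
  through their terms with index \<open>0\<close>. As \<open>I = P\<^bsub>0\<^esub> + Q\<^bsub>-1\<^esub> + (I - Q\<^bsub>0\<^esub>)\<close> in every coordinate,
  summing the relations over all types of series gives (i). Conversely, given (i), the \<open>g\<^bsub>S\<^esub>\<close> may
  be replaced by their regular parts, and then all series telescope and converge by martingale
  convergence in both directions of each coordinate.
\<close>

subsection \<open>Bounded operators on a quasi-normed group\<close>

text \<open>The obstacle is that the series are iterated limits: two summations cannot simply be
  exchanged, and an inner sum is known only as an element that exists. What survives a limit is an
  additive identity between bounded operators. Each coordinate supplies one such identity, and its
  operators commute with everything that belongs to other coordinates. This calls for a setting in
  which almost everywhere identities are equations, hence an abstract group. The constant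
  \<open>K\<close> is there because the size of a function is measured by its p-th moment, which
  obeys the triangle inequality only up to a factor. The two-sided index behaves differently: its
  series telescopes to \<open>0\<close> on coboundaries of regular functions and so says nothing
  about them, but a single term already exhibits a martingale difference. On the measure side,
  complete commutation speaks of the algebras \<open>F i\<close> of single indices, whereas the
  operators condition on one-coordinate algebras. The commutation of the latter is derived by
  treating all these algebras as generated by boxes of indices.\<close>

locale quasi_normed_group =
  fixes V :: "'v::ab_group_add set" and N :: "'v \<Rightarrow> real" and K :: real
  assumes zero_closed [simp]: "0 \<in> V"
    and add_closed [simp]: "v \<in> V \<Longrightarrow> w \<in> V \<Longrightarrow> v + w \<in> V"
    and uminus_closed [simp]: "v \<in> V \<Longrightarrow> - v \<in> V"
    and K_nonneg: "0 \<le> K"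
    and N_zero [simp]: "N 0 = 0"
    and N_nonneg: "v \<in> V \<Longrightarrow> 0 \<le> N v"
    and N_eq_0: "v \<in> V \<Longrightarrow> N v = 0 \<Longrightarrow> v = 0"
    and N_uminus: "v \<in> V \<Longrightarrow> N (- v) = N v"
    and N_add: "v \<in> V \<Longrightarrow> w \<in> V \<Longrightarrow> N (v + w) \<le> K * (N v + N w)"
begin

lemma diff_closed [simp]: "v \<in> V \<Longrightarrow> w \<in> V \<Longrightarrow> v - w \<in> V"
  using add_closed[of v "- w"] uminus_closed[of w] by simp

lemma sum_closed: "(\<And>k. k \<in> I \<Longrightarrow> b k \<in> V) \<Longrightarrow> sum b I \<in> V"
  by (induction I rule: infinite_finite_induct) auto

text \<open>Mirrors \<open>Lp_tendsto\<close>, with the moment in place of the norm; membership in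
  \<open>V\<close> is demanded only eventually.\<close>

definition conv :: "('i \<Rightarrow> 'v) \<Rightarrow> 'v \<Rightarrow> 'i filter \<Rightarrow> bool" where
  "conv X s A \<longleftrightarrow> s \<in> V \<and> (\<forall>\<^sub>F n in A. X n \<in> V) \<and> ((\<lambda>n. N (X n - s)) \<longlongrightarrow> 0) A"

lemma conv_const [simp]: "c \<in> V \<Longrightarrow> conv (\<lambda>_. c) c A"
  by (simp add: conv_def)

lemma conv_cong:
  assumes X: "conv X s A" and eq: "\<forall>\<^sub>F n in A. X n = Y n" shows "conv Y s A"
proof -
  have "\<forall>\<^sub>F n in A. X n \<in> V" using X by (simp add: conv_def)
  with eq have "\<forall>\<^sub>F n in A. Y n \<in> V" by eventually_elim simp
  moreover have "\<forall>\<^sub>F n in A. N (X n - s) = N (Y n - s)" using eq by eventually_elim simp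
  then have "((\<lambda>n. N (Y n - s)) \<longlongrightarrow> 0) A"
    using X Lim_transform_eventually[of "\<lambda>n. N (X n - s)" 0 A] by (simp add: conv_def)
  ultimately show ?thesis using X by (simp add: conv_def)
qed

lemma conv_compose:
  assumes X: "conv X s A" and h: "filterlim h A B" shows "conv (\<lambda>n. X (h n)) s B"
proof -
  have "((\<lambda>n. N (X (h n) - s)) \<longlongrightarrow> 0) B"
    using X filterlim_compose[OF _ h, of "\<lambda>n. N (X n - s)" "nhds 0"] by (simp add: conv_def)
  moreover have "\<forall>\<^sub>F n in B. X (h n) \<in> V"
    using X h eventually_compose_filterlim[of "\<lambda>n. X n \<in> V" A h B] by (simp add: conv_def)
  ultimately show ?thesis using X by (simp add: conv_def)
qed

lemma conv_add:
  assumes "conv X s A" "conv Y t A" shows "conv (\<lambda>n. X n + Y n) (s + t) A"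
proof -
  have ev: "\<forall>\<^sub>F n in A. X n \<in> V \<and> Y n \<in> V"
    using assms by (auto simp: conv_def eventually_conj_iff)
  have "((\<lambda>n. K * (N (X n - s) + N (Y n - t))) \<longlongrightarrow> K * (0 + 0)) A"
    using assms unfolding conv_def by (intro tendsto_intros) auto
  then have lim: "((\<lambda>n. K * (N (X n - s) + N (Y n - t))) \<longlongrightarrow> 0) A" by simp
  have "((\<lambda>n. N (X n + Y n - (s + t))) \<longlongrightarrow> 0) A"
  proof (rule tendsto_sandwich[OF _ _ tendsto_const lim])
    show "\<forall>\<^sub>F n in A. 0 \<le> N (X n + Y n - (s + t))"
      using ev assms by (auto simp: conv_def intro!: N_nonneg elim: eventually_mono)
    show "\<forall>\<^sub>F n in A. N (X n + Y n - (s + t)) \<le> K * (N (X n - s) + N (Y n - t))"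
      using ev
    proof eventually_elim
      case (elim n)
      then show ?case
        using N_add[of "X n - s" "Y n - t"] assms by (simp add: conv_def algebra_simps)
    qed
  qed
  then show ?thesis
    using assms ev by (auto simp: conv_def elim: eventually_mono)
qed

lemma conv_uminus: "conv X s A \<Longrightarrow> conv (\<lambda>n. - X n) (- s) A"
proof -
  assume a: "conv X s A"
  have "((\<lambda>n. N (- X n - - s)) \<longlongrightarrow> 0) A"
  proof (rule Lim_transform_eventually)
    show "((\<lambda>n. N (X n - s)) \<longlongrightarrow> 0) A" using a by (simp add: conv_def)
    show "\<forall>\<^sub>F n in A. N (X n - s) = N (- X n - - s)"
      using a by (auto simp: conv_def elim!: eventually_mono) (metis N_uminus diff_closed minus_diff_eq)
  qed
  then show ?thesis using a by (auto simp: conv_def elim: eventually_mono)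
qed

lemma conv_diff: "conv X s A \<Longrightarrow> conv Y t A \<Longrightarrow> conv (\<lambda>n. X n - Y n) (s - t) A"
  using conv_add[of X s A "\<lambda>n. - Y n" "- t"] conv_uminus[of Y t A] by simp

lemma conv_unique:
  assumes "conv X s A" "conv X t A" "A \<noteq> bot" shows "s = t"
proof -
  have "conv (\<lambda>n. X n - X n) (s - t) A" using assms by (intro conv_diff)
  then have "((\<lambda>n. N (- (s - t))) \<longlongrightarrow> 0) A" "s - t \<in> V" by (simp_all add: conv_def)
  then have "N (- (s - t)) = 0"
    using assms(3) tendsto_const_iff by blast
  then show ?thesis using N_eq_0[of "- (s - t)"] \<open>s - t \<in> V\<close> uminus_closed by fastforce
qed

definition bop :: "('v \<Rightarrow> 'v) \<Rightarrow> bool" where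
  "bop A \<longleftrightarrow> (\<forall>v \<in> V. A v \<in> V) \<and> (\<forall>v \<in> V. \<forall>w \<in> V. A (v + w) = A v + A w) \<and>
     (\<exists>C \<ge> 0. \<forall>v \<in> V. N (A v) \<le> C * N v)"

lemma bop_closed: "bop A \<Longrightarrow> v \<in> V \<Longrightarrow> A v \<in> V"
  by (simp add: bop_def)

lemma bop_plus: "bop A \<Longrightarrow> v \<in> V \<Longrightarrow> w \<in> V \<Longrightarrow> A (v + w) = A v + A w"
  by (simp add: bop_def)

lemma bop_zero: "bop A \<Longrightarrow> A 0 = 0"
  using bop_plus[of A 0 0] by simp

lemma bop_minus: "bop A \<Longrightarrow> v \<in> V \<Longrightarrow> A (- v) = - A v"
  using bop_plus[of A v "- v"] bop_zero[of A] by (simp add: minus_unique)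

lemma bop_minus2: "bop A \<Longrightarrow> v \<in> V \<Longrightarrow> w \<in> V \<Longrightarrow> A (v - w) = A v - A w"
  using bop_plus[of A v "- w"] bop_minus[of A w] by simp

lemma bop_sum:
  assumes "bop A" shows "(\<And>k. k \<in> I \<Longrightarrow> b k \<in> V) \<Longrightarrow> A (sum b I) = (\<Sum>k \<in> I. A (b k))"
  by (induction I rule: infinite_finite_induct) (auto simp: assms bop_zero bop_plus sum_closed)

lemma bop_ident: "bop (\<lambda>v. v)"
  unfolding bop_def by (auto intro!: exI[of _ 1])

lemma bop_null: "bop (\<lambda>v. 0)"
  unfolding bop_def by auto

lemma bop_comp: assumes "bop A" "bop B" shows "bop (\<lambda>v. A (B v))"
proof -
  obtain C where C: "C \<ge> 0" "\<And>v. v \<in> V \<Longrightarrow> N (A v) \<le> C * N v" using assms by (auto simp: bop_def)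
  obtain D where D: "D \<ge> 0" "\<And>v. v \<in> V \<Longrightarrow> N (B v) \<le> D * N v" using assms by (auto simp: bop_def)
  have "N (A (B v)) \<le> (C * D) * N v" if "v \<in> V" for v
    using C(2)[of "B v"] mult_left_mono[OF D(2)[OF that] C(1)] bop_closed[OF assms(2) that]
    by (simp add: mult.assoc)
  then show ?thesis
    using assms C D unfolding bop_def by (intro conjI exI[of _ "C * D"]) auto
qed

lemma bop_add: assumes "bop A" "bop B" shows "bop (\<lambda>v. A v + B v)"
proof -
  obtain C where C: "C \<ge> 0" "\<And>v. v \<in> V \<Longrightarrow> N (A v) \<le> C * N v" using assms by (auto simp: bop_def)
  obtain D where D: "D \<ge> 0" "\<And>v. v \<in> V \<Longrightarrow> N (B v) \<le> D * N v" using assms by (auto simp: bop_def)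
  have "N (A v + B v) \<le> (K * (C + D)) * N v" if "v \<in> V" for v
  proof -
    have "N (A v + B v) \<le> K * (N (A v) + N (B v))"
      using that assms by (intro N_add) (auto simp: bop_closed)
    also have "\<dots> \<le> K * (C * N v + D * N v)"
      using C(2)[OF that] D(2)[OF that] K_nonneg by (intro mult_left_mono add_mono) auto
    finally show ?thesis by (simp add: algebra_simps)
  qed
  then show ?thesis
    using assms C D K_nonneg unfolding bop_def
    by (intro conjI exI[of _ "K * (C + D)"]) (auto simp: algebra_simps)
qed

lemma bop_uminus: "bop A \<Longrightarrow> bop (\<lambda>v. - A v)"
  unfolding bop_def by (auto simp: N_uminus)

lemma bop_diff: "bop A \<Longrightarrow> bop B \<Longrightarrow> bop (\<lambda>v. A v - B v)"
  using bop_add[of A "\<lambda>v. - B v"] bop_uminus[of B] by simp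

lemma conv_bop:
  assumes "bop A" "conv X s F" shows "conv (\<lambda>n. A (X n)) (A s) F"
proof -
  obtain C where C: "C \<ge> 0" "\<And>v. v \<in> V \<Longrightarrow> N (A v) \<le> C * N v" using assms by (auto simp: bop_def)
  have ev: "\<forall>\<^sub>F n in F. X n \<in> V" and s: "s \<in> V" using assms by (auto simp: conv_def)
  have "((\<lambda>n. C * N (X n - s)) \<longlongrightarrow> C * 0) F"
    using assms unfolding conv_def by (intro tendsto_intros) auto
  then have lim: "((\<lambda>n. C * N (X n - s)) \<longlongrightarrow> 0) F" by simp
  have "((\<lambda>n. N (A (X n) - A s)) \<longlongrightarrow> 0) F"
  proof (rule tendsto_sandwich[OF _ _ tendsto_const lim])
    show "\<forall>\<^sub>F n in F. 0 \<le> N (A (X n) - A s)"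
      using ev by eventually_elim (auto intro!: N_nonneg simp: bop_closed assms s)
    show "\<forall>\<^sub>F n in F. N (A (X n) - A s) \<le> C * N (X n - s)"
      using ev
    proof eventually_elim
      case (elim n)
      then show ?case using C(2)[of "X n - s"] bop_minus2[OF assms(1) elim s] s by simp
    qed
  qed
  then show ?thesis
    using ev s assms(1) unfolding conv_def by (auto simp: bop_closed elim: eventually_mono)
qed

section \<open>Series and iterated series in the group\<close>

primrec gsums :: "idx_range \<Rightarrow> (int \<Rightarrow> 'v) \<Rightarrow> 'v \<Rightarrow> bool" where
  "gsums All_ints b s \<longleftrightarrow> conv (\<lambda>(m, n). \<Sum>k = - int m..int n. b k) s (sequentially \<times>\<^sub>F sequentially)"
| "gsums (From a) b s \<longleftrightarrow> conv (\<lambda>n. \<Sum>k = a..<a + int n. b k) s sequentially"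

primrec iterated_gsums ::
    "('n \<Rightarrow> idx_range) \<Rightarrow> 'n list \<Rightarrow> (('n \<Rightarrow> int) \<Rightarrow> 'v) \<Rightarrow> ('n \<Rightarrow> int) \<Rightarrow> 'v \<Rightarrow> bool" where
  "iterated_gsums R [] a i s \<longleftrightarrow> s = a i"
| "iterated_gsums R (q # qs) a i s \<longleftrightarrow>
     (\<exists>b. (\<forall>k \<in> idx_set (R q). iterated_gsums R qs a (i(q := k)) (b k)) \<and> gsums (R q) b s)"

lemma gsums_All_ints:
  "gsums All_ints b s \<longleftrightarrow>
     conv (\<lambda>z. \<Sum>k = - int (fst z)..int (snd z). b k) s (sequentially \<times>\<^sub>F sequentially)"
  by (simp add: case_prod_unfold)

declare gsums.simps(1) [simp del]

lemma gsums_closed: "gsums R b s \<Longrightarrow> s \<in> V"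
  by (cases R) (auto simp: conv_def gsums_All_ints)

lemma gsums_zero: "gsums R (\<lambda>k. 0) 0"
  by (cases R) (auto simp: gsums_All_ints)

lemma gsums_add: "gsums R b s \<Longrightarrow> gsums R c t \<Longrightarrow> gsums R (\<lambda>k. b k + c k) (s + t)"
  by (cases R) (auto simp: gsums_All_ints sum.distrib intro: conv_add)

lemma gsums_cong: "gsums R b s \<Longrightarrow> (\<And>k. k \<in> idx_set R \<Longrightarrow> b k = c k) \<Longrightarrow> gsums R c s"
proof (cases R)
  case (From a)
  assume "gsums R b s" and eq: "\<And>k. k \<in> idx_set R \<Longrightarrow> b k = c k"
  moreover have "(\<Sum>k = a..<a + int n. b k) = (\<Sum>k = a..<a + int n. c k)" for n
    using eq From by (intro sum.cong) auto
  ultimately show ?thesis using From by simp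
next
  case All_ints
  assume "gsums R b s" and eq: "\<And>k. k \<in> idx_set R \<Longrightarrow> b k = c k"
  then have "b = c" using All_ints by auto
  with \<open>gsums R b s\<close> show ?thesis by simp
qed

text \<open>The substitute for an exchange of summations: a bounded operator may be moved inside a
  series.\<close>

lemma gsums_bop:
  assumes A: "bop A" and s: "gsums R b s" and b: "\<And>k. k \<in> idx_set R \<Longrightarrow> b k \<in> V"
  shows "gsums R (\<lambda>k. A (b k)) (A s)"
proof (cases R)
  case (From a)
  have "A (\<Sum>k = a..<a + int n. b k) = (\<Sum>k = a..<a + int n. A (b k))" for n
    using b From by (intro bop_sum[OF A]) auto
  with conv_bop[OF A, of "\<lambda>n. \<Sum>k = a..<a + int n. b k" s sequentially] s From show ?thesis by simp
next
  case All_ints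
  have "A (\<Sum>k = m..n. b k) = (\<Sum>k = m..n. A (b k))" for m n
    using b All_ints by (intro bop_sum[OF A]) auto
  with conv_bop[OF A, of "\<lambda>z. \<Sum>k = - int (fst z)..int (snd z). b k" s "sequentially \<times>\<^sub>F sequentially"]
    s All_ints
  show ?thesis by (simp add: gsums_All_ints)
qed

lemma iterated_gsums_add:
  "iterated_gsums R L a i s \<Longrightarrow> iterated_gsums R L a' i s' \<Longrightarrow>
     iterated_gsums R L (\<lambda>j. a j + a' j) i (s + s')"
proof (induction L arbitrary: i s s')
  case (Cons q L)
  from Cons.prems obtain b b' where
    "\<forall>k \<in> idx_set (R q). iterated_gsums R L a (i(q := k)) (b k)" "gsums (R q) b s"
    "\<forall>k \<in> idx_set (R q). iterated_gsums R L a' (i(q := k)) (b' k)" "gsums (R q) b' s'"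
    by auto
  then have "gsums (R q) (\<lambda>k. b k + b' k) (s + s')"
    "\<forall>k \<in> idx_set (R q). iterated_gsums R L (\<lambda>j. a j + a' j) (i(q := k)) (b k + b' k)"
    by (auto intro: gsums_add Cons.IH)
  then show ?case by auto
qed simp

lemma iterated_gsums_zero: "iterated_gsums R L (\<lambda>j. 0) i 0"
  by (induction L arbitrary: i) (auto intro!: exI[of _ "\<lambda>k. 0"] gsums_zero)

lemma iterated_gsums_sum:
  "finite I \<Longrightarrow> (\<And>x. x \<in> I \<Longrightarrow> iterated_gsums R L (a x) i (s x)) \<Longrightarrow>
     iterated_gsums R L (\<lambda>j. \<Sum>x \<in> I. a x j) i (\<Sum>x \<in> I. s x)"
  by (induction I rule: finite_induct) (auto intro: iterated_gsums_add iterated_gsums_zero)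

end

subsection \<open>Commuting coordinates\<close>

text \<open>One stationary filtration per coordinate, all of them commuting. \<open>Ep q\<close> and
  \<open>Em q\<close> stand for the conditional expectations at plus and minus infinity in
  coordinate \<open>q\<close>. They are pinned down as limits of \<open>Q q\<close>, and their
  commutation and idempotence are derived from that.\<close>

locale commuting_filtrations = quasi_normed_group V N K
  for V :: "'v::ab_group_add set" and N K +
  fixes U Q :: "'n::finite \<Rightarrow> int \<Rightarrow> 'v \<Rightarrow> 'v" and Ep Em :: "'n \<Rightarrow> 'v \<Rightarrow> 'v"
  assumes bop_U: "bop (U q k)" and bop_Q: "bop (Q q k)" and bop_Ep: "bop (Ep q)" and bop_Em: "bop (Em q)"
    and N_U: "v \<in> V \<Longrightarrow> N (U q k v) = N v"
    and UU: "v \<in> V \<Longrightarrow> U q k (U q l v) = U q (k + l) v"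
    and U0: "v \<in> V \<Longrightarrow> U q 0 v = v"
    and QQ: "v \<in> V \<Longrightarrow> Q q k (Q q l v) = Q q (min k l) v"
    and UQ: "v \<in> V \<Longrightarrow> U q k (Q q l v) = Q q (l + k) (U q k v)"
    and UU_commute: "q \<noteq> r \<Longrightarrow> v \<in> V \<Longrightarrow> U q k (U r l v) = U r l (U q k v)"
    and UQ_commute: "q \<noteq> r \<Longrightarrow> v \<in> V \<Longrightarrow> U q k (Q r l v) = Q r l (U q k v)"
    and QQ_commute: "q \<noteq> r \<Longrightarrow> v \<in> V \<Longrightarrow> Q q k (Q r l v) = Q r l (Q q k v)"
    and conv_Ep: "v \<in> V \<Longrightarrow> conv (\<lambda>n. Q q (int n) v) (Ep q v) sequentially"
    and conv_Em: "v \<in> V \<Longrightarrow> conv (\<lambda>n. Q q (- int n) v) (Em q v) sequentially"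
begin

text \<open>The algebra generated by the operators of one coordinate, closed under pointwise limits;
  the rule \<open>op_limit\<close> is what brings in \<open>Ep\<close> and
  \<open>Em\<close>.\<close>

inductive coord_op :: "'n \<Rightarrow> ('v \<Rightarrow> 'v) \<Rightarrow> bool" for q where
  op_U: "coord_op q (U q k)"
| op_Q: "coord_op q (Q q k)"
| op_ident: "coord_op q (\<lambda>v. v)"
| op_null: "coord_op q (\<lambda>v. 0)"
| op_comp: "coord_op q A \<Longrightarrow> coord_op q B \<Longrightarrow> coord_op q (\<lambda>v. A (B v))"
| op_add: "coord_op q A \<Longrightarrow> coord_op q B \<Longrightarrow> coord_op q (\<lambda>v. A v + B v)"
| op_diff: "coord_op q A \<Longrightarrow> coord_op q B \<Longrightarrow> coord_op q (\<lambda>v. A v - B v)"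
| op_uminus: "coord_op q A \<Longrightarrow> coord_op q (\<lambda>v. - A v)"
| op_limit: "(\<And>n::nat. coord_op q (A n)) \<Longrightarrow> bop B \<Longrightarrow>
    (\<And>v. v \<in> V \<Longrightarrow> conv (\<lambda>n. A n v) (B v) sequentially) \<Longrightarrow> coord_op q B"

lemma op_Ep: "coord_op q (Ep q)"
  by (rule op_limit[of _ "\<lambda>n. Q q (int n)"]) (auto intro: op_Q bop_Ep conv_Ep)

lemma op_Em: "coord_op q (Em q)"
  by (rule op_limit[of _ "\<lambda>n. Q q (- int n)"]) (auto intro: op_Q bop_Em conv_Em)

lemma bop_coord_op: "coord_op q A \<Longrightarrow> bop A"
proof (induction rule: coord_op.induct)
  case (op_comp A B)
  show ?case by (rule bop_comp[OF op_comp.IH])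
next
  case (op_add A B)
  show ?case by (rule bop_add[OF op_add.IH])
next
  case (op_diff A B)
  show ?case by (rule bop_diff[OF op_diff.IH])
next
  case (op_uminus A)
  show ?case by (rule bop_uminus[OF op_uminus.IH])
qed (rule bop_U bop_Q bop_ident bop_null | assumption)+

lemmas coord_op_closed = bop_closed[OF bop_coord_op]

text \<open>The operators that commute with a fixed bounded \<open>B\<close> are stable under every
  formation rule, limits included, so it suffices to check the generators.\<close>

lemma bop_commute_if_coord_op:
  assumes "coord_op q A" and B: "bop B"
    and U: "\<And>k v. v \<in> V \<Longrightarrow> B (U q k v) = U q k (B v)"
    and Q: "\<And>k v. v \<in> V \<Longrightarrow> B (Q q k v) = Q q k (B v)"
  shows "v \<in> V \<Longrightarrow> B (A v) = A (B v)"
  using assms(1)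
proof (induction arbitrary: v rule: coord_op.induct)
  case (op_limit A C)
  have "conv (\<lambda>n. A n (B v)) (B (C v)) sequentially"
    using conv_bop[OF B op_limit.hyps(3)[OF op_limit.prems]] unfolding op_limit.IH[OF op_limit.prems] .
  moreover have "conv (\<lambda>n. A n (B v)) (C (B v)) sequentially"
    using op_limit.hyps(3) bop_closed[OF B op_limit.prems] by simp
  ultimately show ?case by (rule conv_unique) simp
next
  case (op_comp A C)
  then show ?case by (simp add: coord_op_closed[OF op_comp.hyps(2)] bop_closed[OF B])
next
  case (op_add A C)
  then show ?case
    by (simp add: coord_op_closed[OF op_add.hyps(1)] coord_op_closed[OF op_add.hyps(2)] bop_plus[OF B])
next
  case (op_diff A C)
  then show ?case
    by (simp add: coord_op_closed[OF op_diff.hyps(1)] coord_op_closed[OF op_diff.hyps(2)] bop_minus2[OF B])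
next
  case (op_uminus A)
  then show ?case by (simp add: coord_op_closed[OF op_uminus.hyps(1)] bop_minus[OF B])
qed (simp_all add: U Q bop_zero[OF B])

text \<open>The generator criterion is used twice: first to commute \<open>A\<close> with the
  generators of coordinate \<open>r\<close>, then with everything built from them.\<close>

lemma coord_op_commute:
  assumes A: "coord_op q A" and B: "coord_op r B" and qr: "q \<noteq> r" and v: "v \<in> V"
  shows "A (B v) = B (A v)"
proof (rule bop_commute_if_coord_op[OF B bop_coord_op[OF A] _ _ v])
  fix k w assume w: "w \<in> V"
  have "U r k (A w) = A (U r k w)"
    using qr by (intro bop_commute_if_coord_op[OF A bop_U _ _ w]) (simp_all add: UU_commute[of r q] UQ_commute[of r q])
  then show "A (U r k w) = U r k (A w)" ..
  have "Q r k (A w) = A (Q r k w)"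
    using qr by (intro bop_commute_if_coord_op[OF A bop_Q _ _ w]) (simp_all add: UQ_commute[of q r] QQ_commute[of r q])
  then show "A (Q r k w) = Q r k (A w)" ..
qed

definition coord_ops :: "('n \<Rightarrow> 'v \<Rightarrow> 'v) \<Rightarrow> bool" where
  "coord_ops A \<longleftrightarrow> (\<forall>q. coord_op q (A q))"

lemma bop_foldr: "coord_ops A \<Longrightarrow> bop (foldr A L)"
proof (induction L)
  case (Cons q L)
  then show ?case
    using bop_comp[of "A q" "foldr A L"] bop_coord_op by (auto simp: coord_ops_def comp_def)
qed (simp add: id_def bop_ident)

lemmas foldr_closed = bop_closed[OF bop_foldr]

lemma coord_op_foldr_commute:
  "coord_op q B \<Longrightarrow> coord_ops A \<Longrightarrow> q \<notin> set L \<Longrightarrow> v \<in> V \<Longrightarrow> B (foldr A L v) = foldr A L (B v)"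
proof (induction L)
  case (Cons r L)
  then have "B (A r (foldr A L v)) = A r (B (foldr A L v))"
    by (intro coord_op_commute[of q _ r]) (auto simp: coord_ops_def foldr_closed)
  with Cons show ?case by simp
qed simp

text \<open>Each \<open>B q\<close> slides past the factors of \<open>A\<close> at later
  coordinates, so two products over the same list merge into one.\<close>

lemma foldr_foldr:
  assumes "coord_ops A" "coord_ops B"
  shows "distinct L \<Longrightarrow> v \<in> V \<Longrightarrow> foldr A L (foldr B L v) = foldr (\<lambda>q w. A q (B q w)) L v"
proof (induction L)
  case (Cons q L)
  then have "foldr A L (B q (foldr B L v)) = B q (foldr A L (foldr B L v))"
    using assms coord_op_foldr_commute[of q "B q" A L "foldr B L v"] by (simp add: coord_ops_def foldr_closed)
  with Cons show ?case by simp
qed simp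

lemma foldr_cong_on:
  assumes "coord_ops B"
  shows "(\<And>q v. q \<in> set L \<Longrightarrow> v \<in> V \<Longrightarrow> A q v = B q v) \<Longrightarrow> v \<in> V \<Longrightarrow> foldr A L v = foldr B L v"
  by (induction L) (auto simp: foldr_closed assms)

lemma foldr_foldr_commute:
  assumes "coord_ops A" "coord_ops B" "distinct L" "v \<in> V"
    and "\<And>q v. q \<in> set L \<Longrightarrow> v \<in> V \<Longrightarrow> A q (B q v) = B q (A q v)"
  shows "foldr A L (foldr B L v) = foldr B L (foldr A L v)"
proof -
  have "coord_ops (\<lambda>q w. B q (A q w))"
    using assms(1,2) unfolding coord_ops_def by (intro allI op_comp[of _ "B _" "A _"]) auto
  then have "foldr (\<lambda>q w. A q (B q w)) L v = foldr (\<lambda>q w. B q (A q w)) L v"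
    using assms by (intro foldr_cong_on)
  then show ?thesis using assms by (simp add: foldr_foldr)
qed

text \<open>Needed because the series group the coordinates by type, while the decomposition uses
  the order of \<open>qs\<close>.\<close>

lemma foldr_perm:
  assumes "coord_ops A" "v \<in> V"
  shows "distinct L \<Longrightarrow> distinct L' \<Longrightarrow> set L = set L' \<Longrightarrow> foldr A L v = foldr A L' v"
proof (induction L arbitrary: L')
  case (Cons q L)
  then obtain L1 L2 where L': "L' = L1 @ q # L2" by (metis list.set_intros(1) split_list)
  with Cons.prems have "set L = set (L1 @ L2)" "distinct (L1 @ L2)" "q \<notin> set L1"
    by (simp_all, metis insert_eq_iff insert_is_Un sup_left_commute Un_iff)
  then have "foldr A L v = foldr A (L1 @ L2) v" using Cons.IH[of "L1 @ L2"] Cons.prems(1) by simp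
  then show ?case
    using coord_op_foldr_commute[of q "A q" A L1 "foldr A L2 v"] assms \<open>q \<notin> set L1\<close>
    by (simp add: L' coord_ops_def foldr_closed)
qed simp

subsection \<open>One coordinate\<close>

definition diff_proj :: "'n \<Rightarrow> 'v \<Rightarrow> 'v" where
  "diff_proj q v = Q q 0 v - Q q (- 1) v"

text \<open>Regularity in a single coordinate; \<open>Ep q v = v\<close> encodes measurability for
  the algebra generated by the whole filtration.\<close>

definition reg :: "'n \<Rightarrow> 'v \<Rightarrow> bool" where
  "reg q v \<longleftrightarrow> v \<in> V \<and> Ep q v = v \<and> Em q v = 0"

definition mart :: "'n \<Rightarrow> 'v \<Rightarrow> bool" where
  "mart q v \<longleftrightarrow> v \<in> V \<and> Q q 0 v = v \<and> Q q (- 1) v = 0"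

lemmas U_closed [simp] = bop_closed[OF bop_U]
lemmas Q_closed [simp] = bop_closed[OF bop_Q]
lemmas Ep_closed [simp] = bop_closed[OF bop_Ep]
lemmas Em_closed [simp] = bop_closed[OF bop_Em]
lemmas lin_simps = bop_plus[OF bop_U] bop_plus[OF bop_Q] bop_minus2[OF bop_U] bop_minus2[OF bop_Q]
  bop_minus[OF bop_U] bop_minus[OF bop_Q] bop_zero[OF bop_U] bop_zero[OF bop_Q]
text \<open>Oriented towards one normal form: a single conditional expectation outside a single
  power of \<open>U\<close>.\<close>

lemmas UQ_simps = UU U0 QQ UQ lin_simps

lemma reg_coord_op:
  assumes "coord_op r A" "q \<noteq> r" "reg q v" shows "reg q (A v)"
proof -
  have "Ep q (A v) = A (Ep q v)" "Em q (A v) = A (Em q v)"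
    using assms coord_op_commute[OF op_Ep assms(1)] coord_op_commute[OF op_Em assms(1)] by (auto simp: reg_def)
  then show ?thesis
    using assms coord_op_closed[OF assms(1)] bop_zero[OF bop_coord_op[OF assms(1)]] by (simp add: reg_def)
qed

lemma mart_coord_op:
  assumes "coord_op r A" "q \<noteq> r" "mart q v" shows "mart q (A v)"
proof -
  have "Q q k (A v) = A (Q q k v)" for k
    using assms coord_op_commute[OF op_Q assms(1)] by (auto simp: mart_def)
  then show ?thesis
    using assms coord_op_closed[OF assms(1)] bop_zero[OF bop_coord_op[OF assms(1)]] by (simp add: mart_def)
qed

lemma reg_foldr: "coord_ops A \<Longrightarrow> q \<notin> set L \<Longrightarrow> reg q v \<Longrightarrow> reg q (foldr A L v)"
  by (induction L) (auto simp: coord_ops_def intro: reg_coord_op)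

lemma conv_Q_at_top: "v \<in> V \<Longrightarrow> conv (\<lambda>n. Q q (int n + l) v) (Ep q v) sequentially"
proof (rule conv_cong[OF conv_compose[OF conv_Ep, where h = "\<lambda>n. nat (int n + l)"]])
  \<comment> \<open>The truncation by \<open>nat\<close> affects only finitely many
    \<open>n\<close>.\<close>
  show "LIM n sequentially. nat (int n + l) :> sequentially"
  proof (unfold filterlim_at_top eventually_sequentially, intro allI)
    show "\<exists>M. \<forall>n\<ge>M. Z \<le> nat (int n + l)" for Z
      by (rule exI[of _ "Z + nat (- l)"]) auto
  qed
  show "\<forall>\<^sub>F n in sequentially. Q q (int (nat (int n + l))) v = Q q (int n + l) v"
    using eventually_ge_at_top[of "nat (- l)"] by eventually_elim (simp add: nat_le_iff)
qed

lemma conv_Q_at_bot: "v \<in> V \<Longrightarrow> conv (\<lambda>n. Q q (l - int n) v) (Em q v) sequentially"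
proof (rule conv_cong[OF conv_compose[OF conv_Em, where h = "\<lambda>n. nat (int n - l)"]])
  show "LIM n sequentially. nat (int n - l) :> sequentially"
  proof (unfold filterlim_at_top eventually_sequentially, intro allI)
    show "\<exists>M. \<forall>n\<ge>M. Z \<le> nat (int n - l)" for Z
      by (rule exI[of _ "Z + nat (l)"]) auto
  qed
  show "\<forall>\<^sub>F n in sequentially. Q q (- int (nat (int n - l))) v = Q q (l - int n) v"
    using eventually_ge_at_top[of "nat l"] by eventually_elim (simp add: nat_le_iff)
qed

lemma conv_U_zero: "conv X 0 A \<Longrightarrow> conv (\<lambda>n. U q (k n) (X n)) 0 A"
proof -
  assume X: "conv X 0 A"
  then have V: "\<forall>\<^sub>F n in A. X n \<in> V" by (simp add: conv_def)
  then have "\<forall>\<^sub>F n in A. N (X n) = N (U q (k n) (X n))" by eventually_elim (simp add: N_U)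
  then have "((\<lambda>n. N (U q (k n) (X n))) \<longlongrightarrow> 0) A"
    using X Lim_transform_eventually[of "\<lambda>n. N (X n)" 0 A] by (simp add: conv_def)
  moreover have "\<forall>\<^sub>F n in A. U q (k n) (X n) \<in> V" using V by eventually_elim simp
  ultimately show ?thesis by (simp add: conv_def)
qed

text \<open>Moving \<open>U\<close> outside turns the fixed level into one that tends to minus
  infinity, where a regular element vanishes; \<open>U\<close> preserves \<open>N\<close>.\<close>

lemma conv_QU_past:
  assumes "reg q v" shows "conv (\<lambda>n. Q q l (U q (int n + k) v)) 0 sequentially"
proof -
  have v: "v \<in> V" "Em q v = 0" using assms by (auto simp: reg_def)
  have "conv (\<lambda>n. U q (int n + k) (Q q ((l - k) - int n) v)) 0 sequentially"
    using conv_Q_at_bot[of v q] v by (intro conv_U_zero) simp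
  then show ?thesis using v by (simp add: UQ)
qed

text \<open>Mirror image of the previous fact: the level tends to plus infinity, where
  \<open>Ep q v = v\<close> takes over.\<close>

lemma conv_QU_future:
  assumes "reg q v"
  shows "conv (\<lambda>n. U q (- int n) v - Q q l (U q (- int n) v)) 0 sequentially"
proof -
  have v: "v \<in> V" "Ep q v = v" using assms by (auto simp: reg_def)
  have "conv (\<lambda>n. U q (- int n) (v - Q q (int n + l) v)) 0 sequentially"
    using conv_diff[OF conv_const conv_Q_at_top, of v v q l] v by (intro conv_U_zero) simp
  then show ?thesis using v by (simp add: UQ_simps)
qed

end

section \<open>The four types of series in one coordinate\<close>

datatype summand = Mart | Past | Future | Adapt

primrec summand_range :: "summand \<Rightarrow> idx_range" where
  "summand_range Mart = All_ints"
| "summand_range Past = From 0"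
| "summand_range Future = From 1"
| "summand_range Adapt = From 0"

context commuting_filtrations
begin

text \<open>\<open>Mart\<close>, \<open>Past\<close> and \<open>Future\<close> are the types of
  coordinates in \<open>S\<close>, in \<open>S'\<close> and in neither; \<open>Adapt\<close> is the
  type of every coordinate in the adapted series. The index of \<open>Future\<close> enters with a
  minus sign.\<close>

primrec summand_op :: "'n \<Rightarrow> summand \<Rightarrow> int \<Rightarrow> 'v \<Rightarrow> 'v" where
  "summand_op q Mart k = (\<lambda>v. diff_proj q (U q k v))"
| "summand_op q Past k = (\<lambda>v. Q q (- 1) (U q k v))"
| "summand_op q Future k = (\<lambda>v. U q (- k) v - Q q (- 1) (U q (- k) v))"
| "summand_op q Adapt k = (\<lambda>v. Q q 0 (U q k v))"

text \<open>What a series of each type determines of its function. The first three parts add up to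
  the identity; for this the part of \<open>Future\<close> has level \<open>0\<close>, although its
  summands have level \<open>- 1\<close>.\<close>

primrec part :: "'n \<Rightarrow> summand \<Rightarrow> 'v \<Rightarrow> 'v" where
  "part q Mart = diff_proj q"
| "part q Past = Q q (- 1)"
| "part q Future = (\<lambda>v. v - Q q 0 v)"
| "part q Adapt = Q q 0"

text \<open>Found by rewriting the operator that makes the series telescope. For
  \<open>Past\<close>: \<open>Q_{-1} (I - U) Q_{-1} = (I - U) Q_{-1} + P_0 U Q_{-1}\<close>, since
  \<open>U Q_{-1}\<close> takes values at level 0, where \<open>Q_{-1}\<close> equals
  \<open>I - P_0\<close>.\<close>

primrec mpart :: "'n \<Rightarrow> summand \<Rightarrow> 'v \<Rightarrow> 'v" where
  "mpart q Mart = diff_proj q"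
| "mpart q Past = (\<lambda>v. diff_proj q (U q 1 (Q q (- 1) v)))"
| "mpart q Future = diff_proj q"
| "mpart q Adapt = diff_proj q"

text \<open>The transfer functions of the coboundaries. For \<open>Adapt\<close> they come from
  \<open>Q_0 (I - U) Q_0 = P_0 + (I - U) Q_{-1}\<close>, for \<open>Future\<close> from
  \<open>(I - Q_0) (U - I) (I - Q_{-1}) = P_0 - (I - U) (I - Q_{-1})\<close>.\<close>

primrec gpart :: "'n \<Rightarrow> summand \<Rightarrow> 'v \<Rightarrow> 'v" where
  "gpart q Mart = (\<lambda>v. 0)"
| "gpart q Past = Q q (- 1)"
| "gpart q Future = (\<lambda>v. - (v - Q q (- 1) v))"
| "gpart q Adapt = Q q (- 1)"

definition recover :: "'n \<Rightarrow> summand \<Rightarrow> 'v \<Rightarrow> 'v" where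
  "recover q t v = mpart q t v + (gpart q t v - U q 1 (gpart q t v))"

text \<open>The identity for coordinates in \<open>S\<close>, so that all products can run over the
  same list.\<close>

definition cob :: "'n set \<Rightarrow> 'n \<Rightarrow> 'v \<Rightarrow> 'v" where
  "cob S q v = (if q \<in> S then v else v - U q 1 v)"

text \<open>The sums of the one-coordinate series for a martingale difference \<open>v\<close> (if
  \<open>q \<in> S\<close>) and for the coboundary \<open>v - U q 1 v\<close> of a regular
  \<open>v\<close> (otherwise).\<close>

primrec limit_op :: "'n set \<Rightarrow> 'n \<Rightarrow> summand \<Rightarrow> 'v \<Rightarrow> 'v" where
  "limit_op S q Mart = (\<lambda>v. if q \<in> S then v else 0)"
| "limit_op S q Past = (\<lambda>v. if q \<in> S then 0 else Q q (- 1) v)"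
| "limit_op S q Future = (\<lambda>v. if q \<in> S then 0 else - (v - Q q (- 1) v))"
| "limit_op S q Adapt = (\<lambda>v. if q \<in> S then v else Q q 0 v)"

lemma op_diff_proj: "coord_op q (diff_proj q)"
  unfolding diff_proj_def[abs_def] by (intro op_diff op_Q)

lemma op_comp_U: "coord_op q A \<Longrightarrow> coord_op q (\<lambda>v. A (U q k v))"
  by (rule op_comp[OF _ op_U])

lemma op_summand_op: "coord_op q (summand_op q t k)"
  by (cases t) (simp_all add: op_comp_U op_diff_proj op_Q op_diff op_U)

lemma op_part: "coord_op q (part q t)"
  by (cases t) (simp_all add: op_diff_proj op_Q op_diff op_ident)

lemma op_mpart: "coord_op q (mpart q t)"
  by (cases t) (simp_all add: op_diff_proj op_comp[OF op_diff_proj op_comp[OF op_U op_Q]])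

lemma op_gpart: "coord_op q (gpart q t)"
  by (cases t) (simp_all only: gpart.simps op_null op_Q op_diff[OF op_Q op_ident] op_uminus[OF op_diff[OF op_ident op_Q]])

lemma op_recover: "coord_op q (recover q t)"
  unfolding recover_def[abs_def]
  by (intro op_add op_mpart op_diff op_gpart op_comp[OF op_U op_gpart])

lemma op_cob: "coord_op q (cob S q)"
  unfolding cob_def[abs_def] by (cases "q \<in> S") (simp_all add: op_ident op_diff op_U)

lemma op_limit_op: "coord_op q (limit_op S q t)"
  by (cases t; cases "q \<in> S")
    (simp_all only: limit_op.simps if_True if_False op_ident op_null op_Q op_uminus[OF op_diff[OF op_ident op_Q]])

lemmas summand_op_closed [simp] = coord_op_closed[OF op_summand_op]
lemmas part_closed [simp] = coord_op_closed[OF op_part]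
lemmas mpart_closed [simp] = coord_op_closed[OF op_mpart]
lemmas gpart_closed [simp] = coord_op_closed[OF op_gpart]
lemmas recover_closed [simp] = coord_op_closed[OF op_recover]
lemmas cob_closed [simp] = coord_op_closed[OF op_cob]
lemmas limit_op_closed [simp] = coord_op_closed[OF op_limit_op]
lemmas diff_proj_closed [simp] = coord_op_closed[OF op_diff_proj]

lemma mart_Q: assumes "mart q v" shows "Q q k v = (if 0 \<le> k then v else 0)"
proof (cases "0 \<le> k")
  case True
  then have "Q q k (Q q 0 v) = Q q 0 v" using assms QQ[of v q k 0] by (simp add: mart_def)
  then show ?thesis using assms True by (simp add: mart_def)
next
  case False
  then have "Q q k (Q q (- 1) v) = Q q k v" using assms QQ[of v q k "- 1"] by (simp add: mart_def)
  then show ?thesis using assms False by (simp add: mart_def bop_zero[OF bop_Q])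
qed

lemma mart_QU: assumes "mart q v" shows "Q q l (U q k v) = (if k \<le> l then U q k v else 0)"
proof -
  have "Q q l (U q k v) = U q k (Q q (l - k) v)" using assms by (simp add: mart_def UQ)
  then show ?thesis by (simp add: mart_Q[OF assms] bop_zero[OF bop_U])
qed

text \<open>\<open>U q k g\<close> lives exactly at level \<open>k\<close>, so no term except the
  one with index \<open>0\<close> can survive.\<close>

lemma gsums_mart:
  assumes "mart q g" "q \<in> S"
  shows "gsums (summand_range t) (\<lambda>k. summand_op q t k g) (limit_op S q t g)"
proof -
  have g: "g \<in> V" using assms by (simp add: mart_def)
  have d: "diff_proj q (U q k g) = (if k = 0 then g else 0)" for k
    using g by (auto simp: diff_proj_def mart_QU[OF assms(1)] U0)
  have a: "Q q 0 (U q k g) = (if k = 0 then g else 0)" if "k \<ge> 0" for k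
    using g that by (auto simp: mart_QU[OF assms(1)] U0)
  show ?thesis
  proof (cases t)
    case Mart
    then show ?thesis using assms g by (simp add: gsums_All_ints d)
  next
    case Past
    then show ?thesis
      using assms g gsums_cong[OF gsums_zero[of "From 0"], of "\<lambda>k. Q q (- 1) (U q k g)"]
      by (simp add: mart_QU[OF assms(1)])
  next
    case Future
    then show ?thesis
      using assms g gsums_cong[OF gsums_zero[of "From 1"], of "\<lambda>k. U q (- k) g - Q q (- 1) (U q (- k) g)"]
      by (simp add: mart_QU[OF assms(1)])
  next
    case Adapt
    have "gsums (From 0) (\<lambda>k. if k = 0 then g else 0) g"
      by (auto intro!: conv_cong[OF conv_const[OF g]] eventually_sequentiallyI[of 1])
    then have "gsums (From 0) (\<lambda>k. Q q 0 (U q k g)) g"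
      by (rule gsums_cong) (simp add: a)
    then show ?thesis using Adapt assms by simp
  qed
qed

section \<open>Telescoping in one coordinate\<close>

lemma sum_telescope_From:
  "(\<Sum>k = a..<a + int n. D k - D (k + 1)) = D a - (D (a + int n) :: 'v)"
proof (induction n)
  case (Suc n)
  have "{a..<a + int (Suc n)} = insert (a + int n) {a..<a + int n}" by auto
  then show ?case using Suc by (simp add: algebra_simps)
qed simp

lemma sum_telescope_All_ints:
  "(\<Sum>k = - int m..int n. D k - D (k + 1)) = D (- int m) - (D (int n + 1) :: 'v)"
proof -
  have "{- int m..int n} = {- int m..<- int m + int (Suc (m + n))}" by auto
  then show ?thesis by (simp only: sum_telescope_From) (simp add: algebra_simps)
qed

text \<open>The partial sums telescope, and regularity in \<open>q\<close> removes the moving end;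
  in the two-sided case each of the two ends depends on its own index and vanishes
  separately.\<close>

lemma gsums_cob:
  assumes g: "reg q g" and S: "q \<notin> S"
  shows "gsums (summand_range t) (\<lambda>k. summand_op q t k (g - U q 1 g)) (limit_op S q t g)"
proof -
  have v: "g \<in> V" using g by (simp add: reg_def)
  have past: "gsums (From 0) (\<lambda>k. Q q l (U q k (g - U q 1 g))) (Q q l g)" for l
  proof -
    have "(\<Sum>k = 0..<0 + int n. Q q l (U q k (g - U q 1 g))) = Q q l g - Q q l (U q (int n + 0) g)" for n
      using sum_telescope_From[of "\<lambda>k. Q q l (U q k g)" 0 n] v by (simp add: UU U0 lin_simps)
    moreover have "conv (\<lambda>n. Q q l g - Q q l (U q (int n + 0) g)) (Q q l g - 0) sequentially"
      using v by (intro conv_diff conv_const conv_QU_past[OF g]) simp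
    ultimately show ?thesis by simp
  qed
  \<comment> \<open>\<open>diff_proj\<close> is a difference of two operators of the form
    \<open>I - Q\<close>, and equally of two operators \<open>Q\<close>; hence it inherits the decay
    in both directions.\<close>
  have fut: "conv (\<lambda>n. diff_proj q (U q (- int n) g)) 0 sequentially"
    using conv_diff[OF conv_QU_future[OF g, of "- 1"] conv_QU_future[OF g, of 0]]
    by (simp add: diff_proj_def)
  have pst: "conv (\<lambda>n. diff_proj q (U q (int n + 1) g)) 0 sequentially"
    using conv_diff[OF conv_QU_past[OF g, of 0] conv_QU_past[OF g, of "- 1"]]
    by (simp add: diff_proj_def)
  show ?thesis
  proof (cases t)
    case Mart
    have "(\<Sum>k = - int m..int n. diff_proj q (U q k (g - U q 1 g)))
        = diff_proj q (U q (- int m) g) - diff_proj q (U q (int n + 1) g)" for m n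
      using sum_telescope_All_ints[of "\<lambda>k. diff_proj q (U q k g)" m n] v
      by (simp add: UU lin_simps diff_proj_def algebra_simps)
    moreover have "conv (\<lambda>z. diff_proj q (U q (- int (fst z)) g) - diff_proj q (U q (int (snd z) + 1) g)) (0 - 0)
        (sequentially \<times>\<^sub>F sequentially)"
      by (intro conv_diff conv_compose[OF fut filterlim_fst] conv_compose[OF pst filterlim_snd])
    ultimately show ?thesis using Mart S by (simp add: gsums_All_ints)
  next
    case Past
    then show ?thesis using past S by simp
  next
    case Adapt
    then show ?thesis using past S by simp
  next
    case Future
    \<comment> \<open>Shift and sign are chosen so that \<open>D 1\<close> is the claimed sum and
      the other end is the vanishing one.\<close>
    define D where "D k = - (U q (1 - k) g - Q q (- 1) (U q (1 - k) g))" for k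
    have "U q (- k) (g - U q 1 g) - Q q (- 1) (U q (- k) (g - U q 1 g)) = D k - D (k + 1)" for k
      using v by (simp add: D_def UU lin_simps algebra_simps)
    then have "(\<Sum>k = 1..<1 + int n. summand_op q t k (g - U q 1 g))
        = D 1 - - (U q (- int n) g - Q q (- 1) (U q (- int n) g))" for n
      using sum_telescope_From[of D 1 n] Future by (simp add: D_def)
    moreover have "conv (\<lambda>n. D 1 - - (U q (- int n) g - Q q (- 1) (U q (- int n) g))) (D 1 - - 0) sequentially"
      using v by (intro conv_diff conv_uminus conv_const conv_QU_future[OF g]) (simp add: D_def)
    ultimately show ?thesis using Future S v by (simp add: D_def U0)
  qed
qed

text \<open>A bounded operator \<open>W\<close> turns the terms into differences. Applied to the sum
  it gives \<open>W s\<close>, by telescoping it gives the part, and limits are unique. The value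
  \<open>W s\<close> is then rewritten as \<open>recover q t s\<close>.\<close>

lemma recover_if_gsums:
  assumes x: "reg q x" and t: "t \<noteq> Mart"
    and s: "gsums (summand_range t) (\<lambda>k. summand_op q t k x) s"
  shows "part q t x = recover q t s"
proof -
  have v: "x \<in> V" "s \<in> V" using x gsums_closed[OF s] by (auto simp: reg_def)
  \<comment> \<open>One argument for two types: \<open>l = - 1\<close> is \<open>Past\<close> and
    \<open>l = 0\<close> is \<open>Adapt\<close>.\<close>
  have past: "part q t x = recover q t s"
    if r: "summand_range t = From 0" and o: "summand_op q t = (\<lambda>k v. Q q l (U q k v))"
      and p: "part q t = Q q l" and rec: "recover q t s = Q q l (Q q l s - U q 1 (Q q l s))" for l
  proof -
    define W where "W v = Q q l (Q q l v - U q 1 (Q q l v))" for v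
    have W: "bop W"
      unfolding W_def[abs_def] by (rule bop_comp[OF bop_Q bop_diff[OF bop_Q bop_comp[OF bop_U bop_Q]]])
    have "W (Q q l (U q k x)) = Q q l (U q k x) - Q q l (U q (k + 1) x)" for k
      using v by (simp add: W_def UQ_simps add.commute)
    then have "(\<Sum>k = 0..<0 + int n. W (Q q l (U q k x))) = Q q l x - Q q l (U q (int n + 0) x)" for n
      using sum_telescope_From[of "\<lambda>k. Q q l (U q k x)" 0 n] v by (simp add: U0)
    moreover have "conv (\<lambda>n. Q q l x - Q q l (U q (int n + 0) x)) (Q q l x - 0) sequentially"
      using v by (intro conv_diff conv_const conv_QU_past[OF x]) simp
    ultimately have "gsums (From 0) (\<lambda>k. W (Q q l (U q k x))) (Q q l x)" by simp
    moreover have "gsums (From 0) (\<lambda>k. W (Q q l (U q k x))) (W s)"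
      using s gsums_bop[OF W, of "From 0"] v by (simp add: r o)
    ultimately show ?thesis
      using conv_unique[of _ "Q q l x" sequentially "W s"] by (simp add: p rec W_def)
  qed
  show ?thesis
  proof (cases t)
    case Past
    then show ?thesis
      using v by (intro past[of "- 1"]) (auto simp: recover_def diff_proj_def UQ_simps algebra_simps)
  next
    case Adapt
    then show ?thesis
      using v by (intro past[of 0]) (auto simp: recover_def diff_proj_def UQ_simps algebra_simps)
  next
    case Future
    \<comment> \<open>\<open>U\<close> raises the level of \<open>I - Q_{-1}\<close> to that of
      \<open>I - Q_0\<close>; the outer factor \<open>I - Q_0\<close> brings the unshifted half to
      the same level, so that the difference telescopes.\<close>
    define W where "W v = (U q 1 (v - Q q (- 1) v) - (v - Q q (- 1) v)) -
      Q q 0 (U q 1 (v - Q q (- 1) v) - (v - Q q (- 1) v))" for v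
    have C: "bop (\<lambda>v. U q 1 (v - Q q (- 1) v) - (v - Q q (- 1) v))"
      by (rule bop_diff[OF bop_comp[OF bop_U] ]) (rule bop_diff[OF bop_ident bop_Q])+
    have W: "bop W"
      unfolding W_def[abs_def] by (rule bop_diff[OF C bop_comp[OF bop_Q C]])
    define D where "D k = U q (1 - k) x - Q q 0 (U q (1 - k) x)" for k
    have "W (summand_op q Future k x) = D k - D (k + 1)" for k
      using v by (simp add: W_def D_def UQ_simps algebra_simps)
    then have "(\<Sum>k = 1..<1 + int n. W (summand_op q Future k x))
        = (x - Q q 0 x) - (U q (- int n) x - Q q 0 (U q (- int n) x))" for n
      using sum_telescope_From[of D 1 n] v by (simp add: D_def U0)
    moreover have "conv (\<lambda>n. (x - Q q 0 x) - (U q (- int n) x - Q q 0 (U q (- int n) x)))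
        ((x - Q q 0 x) - 0) sequentially"
      using v by (intro conv_diff[of "\<lambda>_. x - Q q 0 x"] conv_const conv_QU_future[OF x]) simp
    ultimately have "gsums (From 1) (\<lambda>k. W (summand_op q Future k x)) (x - Q q 0 x)" by simp
    moreover have "gsums (From 1) (\<lambda>k. W (summand_op q Future k x)) (W s)"
      using s gsums_bop[OF W, of "From 1"] v Future by simp
    ultimately have "x - Q q 0 x = W s"
      using conv_unique[of _ "x - Q q 0 x" sequentially "W s"] by simp
    then show ?thesis
      using Future v by (simp add: W_def recover_def diff_proj_def UQ_simps algebra_simps)
  qed (use t in simp)
qed

section \<open>Limits of the filtration and regular parts\<close>

lemma Q_Ep: "v \<in> V \<Longrightarrow> Q q k (Ep q v) = Q q k v"
proof (rule conv_unique)
  assume v: "v \<in> V"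
  show "conv (\<lambda>n. Q q k (Q q (int n) v)) (Q q k (Ep q v)) sequentially"
    by (rule conv_bop[OF bop_Q conv_Ep[OF v]])
  have "\<forall>\<^sub>F n in sequentially. Q q k v = Q q k (Q q (int n) v)"
    using eventually_ge_at_top[of "nat k"] by eventually_elim (use v in \<open>simp add: QQ nat_le_iff min_def\<close>)
  then show "conv (\<lambda>n. Q q k (Q q (int n) v)) (Q q k v) sequentially"
    using v conv_cong[OF conv_const[of "Q q k v"]] by simp
qed simp

lemma Q_Em: "v \<in> V \<Longrightarrow> Q q k (Em q v) = Em q v"
proof (rule conv_unique)
  assume v: "v \<in> V"
  show "conv (\<lambda>n. Q q k (Q q (- int n) v)) (Q q k (Em q v)) sequentially"
    by (rule conv_bop[OF bop_Q conv_Em[OF v]])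
  have "\<forall>\<^sub>F n in sequentially. Q q (- int n) v = Q q k (Q q (- int n) v)"
    using eventually_ge_at_top[of "nat (- k)"]
  proof eventually_elim
    case (elim n)
    then have "min k (- int n) = - int n" by (simp add: nat_le_iff)
    then show ?case using v by (simp add: QQ)
  qed
  then show "conv (\<lambda>n. Q q k (Q q (- int n) v)) (Em q v) sequentially"
    by (rule conv_cong[OF conv_Em[OF v]])
qed simp

lemma Ep_Ep: "v \<in> V \<Longrightarrow> Ep q (Ep q v) = Ep q v"
  using conv_unique[of _ "Ep q (Ep q v)" sequentially "Ep q v"] conv_Ep[of "Ep q v" q] conv_Ep[of v q]
  by (simp add: Q_Ep)

lemma Em_Ep: "v \<in> V \<Longrightarrow> Em q (Ep q v) = Em q v"
  using conv_unique[of _ "Em q (Ep q v)" sequentially "Em q v"] conv_Em[of "Ep q v" q] conv_Em[of v q]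
  by (simp add: Q_Ep)

lemma Ep_Em: "v \<in> V \<Longrightarrow> Ep q (Em q v) = Em q v"
  using conv_unique[of _ "Ep q (Em q v)" sequentially "Em q v"] conv_Ep[of "Em q v" q] by (simp add: Q_Em)

lemma Em_Em: "v \<in> V \<Longrightarrow> Em q (Em q v) = Em q v"
  using conv_unique[of _ "Em q (Em q v)" sequentially "Em q v"] conv_Em[of "Em q v" q] by (simp add: Q_Em)

lemma Ep_U: assumes v: "v \<in> V" shows "Ep q (U q k v) = U q k (Ep q v)"
proof (rule conv_unique)
  show "conv (\<lambda>n. U q k (Q q (int n + - k) v)) (U q k (Ep q v)) sequentially"
    by (rule conv_bop[OF bop_U conv_Q_at_top[OF v]])
  then show "conv (\<lambda>n. U q k (Q q (int n + - k) v)) (Ep q (U q k v)) sequentially"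
    using v conv_Ep[of "U q k v" q] by (simp add: UQ)
qed simp

lemma Em_U: assumes v: "v \<in> V" shows "Em q (U q k v) = U q k (Em q v)"
proof (rule conv_unique)
  show "conv (\<lambda>n. U q k (Q q (- k - int n) v)) (U q k (Em q v)) sequentially"
    by (rule conv_bop[OF bop_U conv_Q_at_bot[OF v]])
  then show "conv (\<lambda>n. U q k (Q q (- k - int n) v)) (Em q (U q k v)) sequentially"
    using v conv_Em[of "U q k v" q] by (simp add: UQ)
qed simp

text \<open>The projection onto elements regular in \<open>q\<close>: it discards what lies outside
  the filtration and what lies in the tail.\<close>

definition proj :: "'n \<Rightarrow> 'v \<Rightarrow> 'v" where
  "proj q v = Ep q v - Em q v"

lemma op_proj: "coord_op q (proj q)"
  unfolding proj_def[abs_def] by (intro op_diff op_Ep op_Em)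

lemma coord_ops_proj: "coord_ops proj"
  by (simp add: coord_ops_def op_proj)

lemma coord_ops_cob: "coord_ops (cob S)"
  by (simp add: coord_ops_def op_cob)

lemma coord_ops_summand: "coord_ops (\<lambda>q. summand_op q (t q) (i q))"
  by (simp add: coord_ops_def op_summand_op)

lemma coord_ops_limit: "coord_ops (\<lambda>q. limit_op S q (t q))"
  by (simp add: coord_ops_def op_limit_op)

lemma coord_ops_part: "coord_ops (\<lambda>q. part q (t q))"
  by (simp add: coord_ops_def op_part)

lemma coord_ops_recover: "coord_ops (\<lambda>q. recover q (t q))"
  by (simp add: coord_ops_def op_recover)

lemma reg_proj: "v \<in> V \<Longrightarrow> reg q (proj q v)"
  by (simp add: reg_def proj_def bop_minus2[OF bop_Ep] bop_minus2[OF bop_Em] Ep_Ep Ep_Em Em_Ep Em_Em)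

lemma proj_reg: "reg q v \<Longrightarrow> proj q v = v"
  by (simp add: reg_def proj_def)

text \<open>\<open>Q q k v\<close> is constant in \<open>k\<close> on either side of the jump at
  \<open>0\<close>, so both limits can be read off.\<close>

lemma mart_imp_reg:
  assumes "mart q v" shows "reg q v"
proof -
  have v: "v \<in> V" using assms by (simp add: mart_def)
  have "conv (\<lambda>n. Q q (int n) v) v sequentially" using v by (simp add: mart_Q[OF assms])
  then have "Ep q v = v" using conv_unique[OF conv_Ep[OF v]] by simp
  moreover have "\<forall>\<^sub>F n in sequentially. 0 = Q q (- int n) v"
    by (intro eventually_sequentiallyI[of 1]) (simp add: mart_Q[OF assms])
  then have "conv (\<lambda>n. Q q (- int n) v) 0 sequentially" by (rule conv_cong[OF conv_const[OF zero_closed]])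
  then have "Em q v = 0" using conv_unique[OF conv_Em[OF v]] by simp
  ultimately show ?thesis using v by (simp add: reg_def)
qed

lemma cob_proj: "v \<in> V \<Longrightarrow> proj q (cob S q v) = cob S q (proj q v)"
  by (simp add: cob_def proj_def bop_minus2[OF bop_Ep] bop_minus2[OF bop_Em] bop_minus2[OF bop_U] Ep_U Em_U)

lemma reg_foldr_proj: "v \<in> V \<Longrightarrow> q \<in> set L \<Longrightarrow> reg q (foldr proj L v)"
proof (induction L)
  case (Cons r L)
  then show ?case
    by (cases "q = r") (auto intro: reg_proj foldr_closed[OF coord_ops_proj] reg_coord_op[OF op_proj])
qed simp

lemma mart_foldr_proj: "mart q v \<Longrightarrow> mart q (foldr proj L v)"
proof (induction L)
  case (Cons r L)
  then show ?case
    by (cases "q = r") (auto simp: proj_reg[OF mart_imp_reg] intro: mart_coord_op[OF op_proj])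
qed simp

lemma foldr_proj_reg: "(\<And>q. q \<in> set L \<Longrightarrow> reg q v) \<Longrightarrow> foldr proj L v = v"
  by (induction L) (auto simp: proj_reg)

section \<open>Convergence of all series, given a decomposition\<close>

lemma iterated_gsums_cob:
  assumes "distinct L" "g \<in> V"
    and "\<And>q. q \<in> set L \<Longrightarrow> reg q g" "\<And>q. q \<in> set L \<Longrightarrow> q \<in> S \<Longrightarrow> mart q g"
    and "\<And>j. (\<And>r. r \<notin> set L \<Longrightarrow> j r = i r) \<Longrightarrow>
      a j = foldr (\<lambda>q. summand_op q (t q) (j q)) L (foldr (cob S) L g)"
  shows "iterated_gsums (\<lambda>q. summand_range (t q)) L a i (foldr (\<lambda>q. limit_op S q (t q)) L g)"
  using assms
proof (induction L arbitrary: i g)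
  case (Cons q L)
  \<comment> \<open>\<open>G k\<close> absorbs both the summand and the coboundary factor of the
    outermost coordinate; what remains is a series of the same form over \<open>L\<close>.\<close>
  define G where "G k = summand_op q (t q) k (cob S q g)" for k
  have q: "q \<notin> set L" "distinct L" and g: "g \<in> V" using Cons.prems by auto
  have G: "G k \<in> V" for k using g by (simp add: G_def)
  have base: "gsums (summand_range (t q)) G (limit_op S q (t q) g)"
  proof (cases "q \<in> S")
    case True
    then show ?thesis
      using gsums_mart[of q g S "t q"] Cons.prems(4) by (simp add: G_def[abs_def] cob_def)
  next
    case False
    then show ?thesis
      using gsums_cob[of q g S "t q"] Cons.prems(3) by (simp add: G_def[abs_def] cob_def)
  qed
  let ?L = "foldr (\<lambda>q. limit_op S q (t q)) L"
  \<comment> \<open>By induction the inner sums are the images of the outer terms under one bounded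
    operator, so the outer series reduces to the one-coordinate case.\<close>
  have "gsums (summand_range (t q)) (\<lambda>k. ?L (G k)) (?L (limit_op S q (t q) g))"
    by (rule gsums_bop[OF bop_foldr[OF coord_ops_limit] base G])
  also have "?L (limit_op S q (t q) g) = limit_op S q (t q) (?L g)"
    using coord_op_foldr_commute[OF op_limit_op coord_ops_limit q(1) g] by simp
  finally have sums: "gsums (summand_range (t q)) (\<lambda>k. ?L (G k)) (limit_op S q (t q) (?L g))" .
  have "iterated_gsums (\<lambda>q. summand_range (t q)) L a (i(q := k)) (?L (G k))" for k
  proof (rule Cons.IH[OF q(2) G])
    fix r assume r: "r \<in> set L"
    then have rq: "r \<noteq> q" using q by auto
    show "reg r (G k)"
      using Cons.prems(3)[of r] r rq unfolding G_def by (auto intro!: reg_coord_op[OF op_summand_op] reg_coord_op[OF op_cob])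
    show "mart r (G k)" if "r \<in> S"
      using Cons.prems(4)[of r] r rq that unfolding G_def
      by (auto intro!: mart_coord_op[OF op_summand_op] mart_coord_op[OF op_cob])
  next
    fix j assume j: "\<And>r. r \<notin> set L \<Longrightarrow> j r = (i(q := k)) r"
    let ?O = "foldr (\<lambda>q. summand_op q (t q) (j q)) L" and ?C = "foldr (cob S) L"
    have "j q = k" using j[of q] q by simp
    have "a j = foldr (\<lambda>q. summand_op q (t q) (j q)) (q # L) (foldr (cob S) (q # L) g)"
      by (rule Cons.prems(5)) (use j in auto)
    also have "\<dots> = summand_op q (t q) k (?O (cob S q (?C g)))"
      using \<open>j q = k\<close> by simp
    also have "cob S q (?C g) = ?C (cob S q g)"
      by (rule coord_op_foldr_commute[OF op_cob coord_ops_cob q(1) g])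
    also have "summand_op q (t q) k (?O (?C (cob S q g))) = ?O (summand_op q (t q) k (?C (cob S q g)))"
      using g by (intro coord_op_foldr_commute[OF op_summand_op coord_ops_summand q(1)]
        foldr_closed[OF coord_ops_cob]) simp
    also have "summand_op q (t q) k (?C (cob S q g)) = ?C (G k)"
      using g unfolding G_def by (intro coord_op_foldr_commute[OF op_summand_op coord_ops_cob q(1)]) simp
    finally show "a j = ?O (?C (G k))" .
  qed
  then show ?case using sums by (auto intro: exI[of _ "\<lambda>k. ?L (G k)"])
qed simp

definition decomp :: "'n list \<Rightarrow> 'v \<Rightarrow> bool" where
  "decomp qs f \<longleftrightarrow>
     (\<exists>g. (\<forall>S. g S \<in> V \<and> (\<forall>q \<in> S. mart q (g S))) \<and> f = (\<Sum>S \<in> UNIV. foldr (cob S) qs (g S)))"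

text \<open>Telescoping requires regular transfer functions, which the \<open>g S\<close> need not
  be. The projections fix \<open>f\<close>, commute with \<open>cob\<close> and preserve
  \<open>mart\<close>, so the projected functions decompose the same \<open>f\<close>.\<close>

theorem iterated_gsums_if_decomp:
  assumes qs: "distinct qs" "set qs = UNIV" and L: "distinct L" "set L = UNIV"
    and f: "\<And>q. reg q f" and "decomp qs f"
  shows "\<exists>s. iterated_gsums (\<lambda>q. summand_range (t q)) L
    (\<lambda>i. foldr (\<lambda>q. summand_op q (t q) (i q)) L f) i s"
proof -
  from \<open>decomp qs f\<close> obtain g where g: "\<And>S. g S \<in> V" "\<And>S q. q \<in> S \<Longrightarrow> mart q (g S)"
    and f_eq: "f = (\<Sum>S \<in> UNIV. foldr (cob S) qs (g S))" unfolding decomp_def by blast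
  define h where "h S = foldr proj qs (g S)" for S
  have h: "h S \<in> V" "reg q (h S)" "q \<in> S \<Longrightarrow> mart q (h S)" for S q
    using g qs by (auto simp: h_def foldr_closed[OF coord_ops_proj] reg_foldr_proj mart_foldr_proj)
  have "f = foldr proj qs f" using f by (simp add: foldr_proj_reg)
  also have "\<dots> = (\<Sum>S \<in> UNIV. foldr proj qs (foldr (cob S) qs (g S)))"
    by (subst f_eq, rule bop_sum[OF bop_foldr[OF coord_ops_proj]]) (simp add: g foldr_closed[OF coord_ops_cob])
  also have "\<dots> = (\<Sum>S \<in> UNIV. foldr (cob S) L (h S))"
  proof (rule sum.cong[OF refl])
    fix S
    have "foldr proj qs (foldr (cob S) qs (g S)) = foldr (cob S) qs (h S)"
      unfolding h_def by (intro foldr_foldr_commute coord_ops_proj coord_ops_cob qs g cob_proj)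
    also have "\<dots> = foldr (cob S) L (h S)"
      using foldr_perm[OF coord_ops_cob h(1) qs(1) L(1)] qs L by simp
    finally show "foldr proj qs (foldr (cob S) qs (g S)) = foldr (cob S) L (h S)" .
  qed
  finally have f': "f = (\<Sum>S \<in> UNIV. foldr (cob S) L (h S))" .
  have "iterated_gsums (\<lambda>q. summand_range (t q)) L
     (\<lambda>i. \<Sum>S \<in> UNIV. foldr (\<lambda>q. summand_op q (t q) (i q)) L (foldr (cob S) L (h S))) i
     (\<Sum>S \<in> UNIV. foldr (\<lambda>q. limit_op S q (t q)) L (h S))"
    by (intro iterated_gsums_sum iterated_gsums_cob L h finite) auto
  also have "(\<lambda>i. \<Sum>S \<in> UNIV. foldr (\<lambda>q. summand_op q (t q) (i q)) L (foldr (cob S) L (h S)))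
    = (\<lambda>i. foldr (\<lambda>q. summand_op q (t q) (i q)) L f)"
  proof
    fix i
    let ?A = "foldr (\<lambda>q. summand_op q (t q) (i q)) L"
    have "?A (\<Sum>S \<in> UNIV. foldr (cob S) L (h S)) = (\<Sum>S \<in> UNIV. ?A (foldr (cob S) L (h S)))"
      by (rule bop_sum[OF bop_foldr[OF coord_ops_summand]]) (simp add: h foldr_closed[OF coord_ops_cob])
    then show "(\<Sum>S \<in> UNIV. ?A (foldr (cob S) L (h S))) = ?A f" using f' by simp
  qed
  finally show ?thesis ..
qed

section \<open>From sums back to a decomposition\<close>

lemma foldr_recover_if_iterated_gsums:
  assumes "distinct L" "w \<in> V" "\<And>q. q \<in> set L \<Longrightarrow> reg q w" "\<And>q. q \<in> set L \<Longrightarrow> t q \<noteq> Mart"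
    and "\<And>j. (\<And>r. r \<notin> set L \<Longrightarrow> j r = i r) \<Longrightarrow> a j = foldr (\<lambda>q. summand_op q (t q) (j q)) L w"
    and "iterated_gsums (\<lambda>q. summand_range (t q)) L a i s"
  shows "s \<in> V \<and> foldr (\<lambda>q. part q (t q)) L w = foldr (\<lambda>q. recover q (t q)) L s"
  using assms
proof (induction L arbitrary: i w s)
  case Nil
  then show ?case by simp
next
  case (Cons q L)
  have q: "q \<notin> set L" "distinct L" and w: "w \<in> V" using Cons.prems by auto
  let ?P = "foldr (\<lambda>q. part q (t q)) L" and ?R = "foldr (\<lambda>q. recover q (t q)) L"
  from Cons.prems(6) obtain b where
    b: "\<And>k. k \<in> idx_set (summand_range (t q)) \<Longrightarrow>
         iterated_gsums (\<lambda>q. summand_range (t q)) L a (i(q := k)) (b k)"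
    and s: "gsums (summand_range (t q)) b s" by auto
  have IH: "b k \<in> V \<and> ?P (summand_op q (t q) k w) = ?R (b k)"
    if k: "k \<in> idx_set (summand_range (t q))" for k
  proof (rule Cons.IH[OF q(2) _ _ _ _ b[OF k]])
    show "summand_op q (t q) k w \<in> V" using w by simp
    show "reg r (summand_op q (t q) k w)" if "r \<in> set L" for r
      using that q Cons.prems(3)[of r] by (intro reg_coord_op[OF op_summand_op]) auto
    show "t r \<noteq> Mart" if "r \<in> set L" for r using that Cons.prems(4) by simp
    fix j assume j: "\<And>r. r \<notin> set L \<Longrightarrow> j r = (i(q := k)) r"
    have "j q = k" using j[of q] q by simp
    have "a j = foldr (\<lambda>q. summand_op q (t q) (j q)) (q # L) w"
      by (rule Cons.prems(5)) (use j in auto)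
    also have "\<dots> = foldr (\<lambda>q. summand_op q (t q) (j q)) L (summand_op q (t q) k w)"
      using \<open>j q = k\<close> coord_op_foldr_commute[OF op_summand_op coord_ops_summand q(1) w] by simp
    finally show "a j = foldr (\<lambda>q. summand_op q (t q) (j q)) L (summand_op q (t q) k w)" .
  qed
  \<comment> \<open>The relations for the inner sums hold index by index. Applying the bounded
    \<open>?R\<close> to the outer series turns it into the one-coordinate series of
    \<open>?P w\<close>, with sum \<open>?R s\<close>.\<close>
  have "gsums (summand_range (t q)) (\<lambda>k. ?R (b k)) (?R s)"
    using IH by (intro gsums_bop[OF bop_foldr[OF coord_ops_recover] s]) auto
  then have "gsums (summand_range (t q)) (\<lambda>k. summand_op q (t q) k (?P w)) (?R s)"
    by (rule gsums_cong) (simp add: IH coord_op_foldr_commute[OF op_summand_op coord_ops_part q(1) w])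
  then have "part q (t q) (?P w) = recover q (t q) (?R s)"
    using Cons.prems(3,4) q by (intro recover_if_gsums reg_foldr[OF coord_ops_part]) auto
  then show ?case using gsums_closed[OF s] by simp
qed

lemma mart_diff_proj: "v \<in> V \<Longrightarrow> mart q (diff_proj q v)"
  by (simp add: mart_def diff_proj_def lin_simps QQ)

lemma diff_proj_mart: "mart q v \<Longrightarrow> diff_proj q v = v"
  by (simp add: mart_def diff_proj_def)

lemma recover_Mart: "v \<in> V \<Longrightarrow> recover q Mart v = diff_proj q v"
  by (simp add: recover_def bop_zero[OF bop_U])

text \<open>As the \<open>Mart\<close> coordinates \<open>rs\<close> are outermost, index
  \<open>0\<close> can be selected in each of them; what is left is a convergent series over
  \<open>L\<close> for the projected function.\<close>

lemma ex_recover_if_iterated_gsums: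
  assumes "distinct (rs @ L)" "w \<in> V" "\<And>q. q \<in> set L \<Longrightarrow> reg q w" "\<And>q. q \<in> set L \<Longrightarrow> t q \<noteq> Mart"
    and "\<And>q. q \<in> set rs \<Longrightarrow> t q = Mart"
    and "\<And>j. (\<And>r. r \<notin> set (rs @ L) \<Longrightarrow> j r = i r) \<Longrightarrow> a j = foldr (\<lambda>q. summand_op q (t q) (j q)) (rs @ L) w"
    and "iterated_gsums (\<lambda>q. summand_range (t q)) (rs @ L) a i s"
  shows "\<exists>z \<in> V. foldr (\<lambda>q. part q (t q)) (rs @ L) w = foldr (\<lambda>q. recover q (t q)) (rs @ L) z"
  using assms
proof (induction rs arbitrary: i w s)
  case Nil
  then show ?case using foldr_recover_if_iterated_gsums[of L w t i a s] by auto
next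
  case (Cons q rs)
  let ?L = "rs @ L"
  have q: "q \<notin> set ?L" "distinct ?L" and w: "w \<in> V" and t: "t q = Mart" using Cons.prems by auto
  let ?P = "foldr (\<lambda>q. part q (t q)) ?L" and ?R = "foldr (\<lambda>q. recover q (t q)) ?L"
  from Cons.prems(7) t obtain b :: "int \<Rightarrow> 'v" where
    "\<forall>k. iterated_gsums (\<lambda>q. summand_range (t q)) ?L a (i(q := k)) (b k)"
    by auto
  then have b: "iterated_gsums (\<lambda>q. summand_range (t q)) ?L a (i(q := 0)) (b 0)" ..
  have "\<exists>z \<in> V. ?P (summand_op q (t q) 0 w) = ?R z"
  proof (rule Cons.IH[OF q(2) _ _ _ _ _ b])
    show "summand_op q (t q) 0 w \<in> V" using w by simp
    show "reg r (summand_op q (t q) 0 w)" if "r \<in> set L" for r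
      using that q Cons.prems(3)[of r] by (intro reg_coord_op[OF op_summand_op]) auto
    show "t r \<noteq> Mart" if "r \<in> set L" for r using that Cons.prems(4) by simp
    show "t r = Mart" if "r \<in> set rs" for r using that Cons.prems(5) by simp
    fix j assume j: "\<And>r. r \<notin> set ?L \<Longrightarrow> j r = (i(q := 0)) r"
    have "j q = 0" using j[of q] q by simp
    have "a j = foldr (\<lambda>q. summand_op q (t q) (j q)) ((q # rs) @ L) w"
      by (rule Cons.prems(6)) (use j in auto)
    also have "\<dots> = summand_op q (t q) 0 (foldr (\<lambda>q. summand_op q (t q) (j q)) ?L w)"
      using \<open>j q = 0\<close> by simp
    also have "\<dots> = foldr (\<lambda>q. summand_op q (t q) (j q)) ?L (summand_op q (t q) 0 w)"
      by (rule coord_op_foldr_commute[OF op_summand_op coord_ops_summand q(1) w])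
    finally show "a j = foldr (\<lambda>q. summand_op q (t q) (j q)) ?L (summand_op q (t q) 0 w)" .
  qed
  then obtain z where z: "z \<in> V" "?P (diff_proj q w) = ?R z" using w t by (auto simp: U0)
  have "?P w \<in> V" "?R z \<in> V" using w z by (auto intro!: foldr_closed coord_ops_part coord_ops_recover simp del: foldr_append)
  have "diff_proj q (?P w) = ?R z"
    using coord_op_foldr_commute[OF op_diff_proj coord_ops_part q(1) w, of t] z by simp
  \<comment> \<open>The left side lies in the range of the idempotent \<open>diff_proj q\<close>, so
    the right side may be projected too; this is the factor \<open>recover q Mart\<close>.\<close>
  then have "diff_proj q (?P w) = diff_proj q (?R z)"
    using diff_proj_mart[OF mart_diff_proj[OF \<open>?P w \<in> V\<close>], of q] by simp
  then have "foldr (\<lambda>q. part q (t q)) (q # ?L) w = foldr (\<lambda>q. recover q (t q)) (q # ?L) z"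
    using t \<open>?R z \<in> V\<close> by (simp add: recover_Mart)
  then show ?case using z(1) by auto
qed

section \<open>Assembling the decomposition\<close>

lemma decomp_add: "decomp qs v \<Longrightarrow> decomp qs w \<Longrightarrow> decomp qs (v + w)"
proof -
  assume "decomp qs v" "decomp qs w"
  from \<open>decomp qs v\<close> obtain g where g: "\<And>S. g S \<in> V" "\<And>S q. q \<in> S \<Longrightarrow> mart q (g S)"
    and v: "v = (\<Sum>S \<in> UNIV. foldr (cob S) qs (g S))" unfolding decomp_def by blast
  from \<open>decomp qs w\<close> obtain h where h: "\<And>S. h S \<in> V" "\<And>S q. q \<in> S \<Longrightarrow> mart q (h S)"
    and w: "w = (\<Sum>S \<in> UNIV. foldr (cob S) qs (h S))" unfolding decomp_def by blast
  have "v + w = (\<Sum>S \<in> UNIV. foldr (cob S) qs (g S + h S))"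
    by (simp add: v w sum.distrib bop_plus[OF bop_foldr[OF coord_ops_cob]] g h)
  moreover have "mart q (g S + h S)" if "q \<in> S" for q S
    using g(2)[OF that] h(2)[OF that] by (simp add: mart_def lin_simps)
  ultimately show ?thesis
    unfolding decomp_def by (intro exI[of _ "\<lambda>S. g S + h S"]) (auto simp: g h)
qed

lemma decomp_foldr_cob:
  assumes "g \<in> V" "\<And>q. q \<in> S \<Longrightarrow> mart q g" shows "decomp qs (foldr (cob S) qs g)"
proof -
  have "foldr (cob R) qs (if R = S then g else 0) = (if R = S then foldr (cob S) qs g else 0)" for R
    using bop_zero[OF bop_foldr[OF coord_ops_cob]] by simp
  then have "foldr (cob S) qs g = (\<Sum>R \<in> UNIV. foldr (cob R) qs (if R = S then g else 0))"
    by simp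
  then show ?thesis
    using assms unfolding decomp_def
    by (intro exI[of _ "\<lambda>R. if R = S then g else 0"]) (auto simp: mart_def bop_zero[OF bop_Q])
qed

text \<open>The product of the \<open>recover\<close> factors is expanded one factor at a time, from
  the right end of \<open>L1\<close>. The \<open>mpart\<close> term puts \<open>q\<close> into
  \<open>S\<close>; the \<open>gpart\<close> term keeps it out and contributes a factor
  \<open>I - U\<close>. The mixed product over \<open>L1\<close> and \<open>L2\<close> is the
  invariant.\<close>

lemma decomp_foldr_recover:
  assumes "distinct (L1 @ L2)" "g \<in> V" "S \<subseteq> set L2" "\<And>q. q \<in> S \<Longrightarrow> mart q g"
  shows "decomp (L1 @ L2) (foldr (\<lambda>q. recover q (t q)) L1 (foldr (cob S) L2 g))"
  using assms
proof (induction L1 arbitrary: L2 S g rule: rev_induct)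
  case Nil
  then show ?case using decomp_foldr_cob by simp
next
  case (snoc q L1)
  then have q: "q \<notin> set L2" "q \<notin> S" and g: "g \<in> V" and d: "distinct (L1 @ q # L2)" by auto
  let ?R = "foldr (\<lambda>q. recover q (t q)) L1"
  let ?C = "foldr (cob S) L2" and ?D = "foldr (cob (insert q S)) L2"
  let ?m = "mpart q (t q) g" and ?g = "gpart q (t q) g"
  \<comment> \<open>Adding \<open>q\<close> to \<open>S\<close> is invisible on \<open>L2\<close>,
    which does not contain \<open>q\<close>.\<close>
  have D: "?D v = ?C v" if "v \<in> V" for v
    using q by (intro foldr_cong_on[OF coord_ops_cob _ that]) (auto simp: cob_def)
  have CV: "v \<in> V \<Longrightarrow> ?C v \<in> V" for v by (rule foldr_closed[OF coord_ops_cob])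
  have "recover q (t q) (?C g) = ?C (recover q (t q) g)"
    by (rule coord_op_foldr_commute[OF op_recover coord_ops_cob q(1) g])
  also have "\<dots> = ?C ?m + ?C (?g - U q 1 ?g)"
    unfolding recover_def using g by (simp add: bop_plus[OF bop_foldr[OF coord_ops_cob]])
  also have "?g - U q 1 ?g = cob S q ?g" using q by (simp add: cob_def)
  also have "?C (cob S q ?g) = cob S q (?C ?g)"
    using g coord_op_foldr_commute[OF op_cob coord_ops_cob q(1), of ?g S S] by simp
  also have "?C ?m = cob (insert q S) q (?D ?m)" using D g by (simp add: cob_def)
  finally have "recover q (t q) (?C g) = cob (insert q S) q (?D ?m) + cob S q (?C ?g)" .
  then have eq: "foldr (\<lambda>q. recover q (t q)) (L1 @ [q]) (?C g)
      = ?R (foldr (cob (insert q S)) (q # L2) ?m) + ?R (foldr (cob S) (q # L2) ?g)"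
    using g D CV by (simp add: bop_plus[OF bop_foldr[OF coord_ops_recover]])
  have "decomp (L1 @ q # L2) (?R (foldr (cob (insert q S)) (q # L2) ?m))"
  proof (rule snoc.IH[OF d])
    show "mart r ?m" if "r \<in> insert q S" for r
    proof (cases "r = q")
      case True
      have "mart q ?m" by (cases "t q") (simp_all add: mart_diff_proj g)
      then show ?thesis using True by simp
    next
      case False
      then show ?thesis using that snoc.prems(4) by (intro mart_coord_op[OF op_mpart]) auto
    qed
  qed (use g snoc.prems in auto)
  moreover have "decomp (L1 @ q # L2) (?R (foldr (cob S) (q # L2) ?g))"
    by (rule snoc.IH[OF d]) (use g q snoc.prems in \<open>auto intro: mart_coord_op[OF op_gpart]\<close>)
  ultimately show ?case unfolding eq using decomp_add by simp
qed

text \<open>Coordinates are removed one by one: adding the versions with \<open>Mart\<close>,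
  \<open>Past\<close> and \<open>Future\<close> at \<open>q\<close> cancels the factor there,
  because these three parts sum to the identity.\<close>

lemma decomp_if_parts:
  assumes "distinct L" "f \<in> V"
    and "\<And>t. (\<And>q. t q \<noteq> Adapt) \<Longrightarrow> decomp qs (foldr (\<lambda>q. part q (t q)) L f)"
  shows "decomp qs f"
  using assms
proof (induction L)
  case Nil
  from Nil(3)[of "\<lambda>_. Mart"] show ?case by simp
next
  case (Cons q L)
  show ?case
  proof (rule Cons.IH)
    fix t :: "'n \<Rightarrow> summand" assume t: "\<And>q. t q \<noteq> Adapt"
    let ?x = "foldr (\<lambda>q. part q (t q)) L f"
    have *: "decomp qs (part q \<tau> ?x)" if "\<tau> \<noteq> Adapt" for \<tau>
    proof -
      have "foldr (\<lambda>r. part r ((t(q := \<tau>)) r)) L f = ?x"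
        using Cons.prems by (intro foldr_cong_on[OF coord_ops_part]) auto
      then show ?thesis using Cons.prems(3)[of "t(q := \<tau>)"] t that by simp
    qed
    have "decomp qs (part q Mart ?x + part q Past ?x + part q Future ?x)"
      by (intro decomp_add *) auto
    then show "decomp qs ?x" by (simp add: diff_proj_def)
  qed (use Cons.prems in auto)
qed

theorem decomp_if_iterated_gsums:
  assumes qs: "distinct qs" "set qs = UNIV" and f: "\<And>q. reg q f"
    and sums: "\<And>t. \<forall>q. t q \<noteq> Adapt \<Longrightarrow>
      let L = filter (\<lambda>q. t q = Mart) qs @ filter (\<lambda>q. t q = Past) qs @ filter (\<lambda>q. t q = Future) qs
      in \<exists>s. iterated_gsums (\<lambda>q. summand_range (t q)) L (\<lambda>i. foldr (\<lambda>q. summand_op q (t q) (i q)) L f) i s"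
  shows "decomp qs f"
proof (rule decomp_if_parts[OF qs(1)])
  show V: "f \<in> V" using f by (auto simp: reg_def)
  fix t :: "'n \<Rightarrow> summand" assume t: "\<And>q. t q \<noteq> Adapt"
  define rs where "rs = filter (\<lambda>q. t q = Mart) qs"
  define L where "L = filter (\<lambda>q. t q = Past) qs @ filter (\<lambda>q. t q = Future) qs"
  have rs: "distinct (rs @ L)" using qs by (auto simp: rs_def L_def)
  have "t q = Mart \<or> t q = Past \<or> t q = Future" for q using t[of q] by (cases "t q") auto
  then have set: "set (rs @ L) = set qs" by (auto simp: rs_def L_def)
  obtain s where s: "iterated_gsums (\<lambda>q. summand_range (t q)) (rs @ L)
      (\<lambda>i. foldr (\<lambda>q. summand_op q (t q) (i q)) (rs @ L) f) i s"
    using sums[of t] t by (auto simp: Let_def rs_def L_def)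
  have "\<exists>z \<in> V. foldr (\<lambda>q. part q (t q)) (rs @ L) f = foldr (\<lambda>q. recover q (t q)) (rs @ L) z"
  proof (rule ex_recover_if_iterated_gsums[OF rs V f _ _ refl s])
    show "t q \<noteq> Mart" if "q \<in> set L" for q using that by (auto simp: L_def)
    show "t q = Mart" if "q \<in> set rs" for q using that by (simp add: rs_def)
  qed
  then obtain z where z: "z \<in> V"
    "foldr (\<lambda>q. part q (t q)) (rs @ L) f = foldr (\<lambda>q. recover q (t q)) (rs @ L) z" ..
  then have "foldr (\<lambda>q. part q (t q)) qs f = foldr (\<lambda>q. recover q (t q)) qs z"
    using foldr_perm[OF coord_ops_part V rs qs(1) set, of t] foldr_perm[OF coord_ops_recover z(1) rs qs(1) set, of t]
    by simp
  \<comment> \<open>The expansion starts with only \<open>recover\<close> factors and with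
    \<open>S\<close> empty, where no martingale condition is imposed on \<open>z\<close>.\<close>
  then show "decomp qs (foldr (\<lambda>q. part q (t q)) qs f)"
    using decomp_foldr_recover[of qs "[]" z "{}" t] z qs by simp
qed

text \<open>An adapted \<open>f\<close> is its own \<open>Adapt\<close> part in every coordinate, so
  one series recovers all of it.\<close>

theorem decomp_if_iterated_gsums_adapted:
  assumes qs: "distinct qs" "set qs = UNIV" and f: "\<And>q. reg q f" "\<And>q. Q q 0 f = f"
    and sums: "iterated_gsums (\<lambda>q. From 0) qs (\<lambda>i. foldr (\<lambda>q. summand_op q Adapt (i q)) qs f) i s"
  shows "decomp qs f"
proof -
  have V: "f \<in> V" using f by (auto simp: reg_def)
  have "s \<in> V \<and> foldr (\<lambda>q. part q Adapt) qs f = foldr (\<lambda>q. recover q Adapt) qs s"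
    using foldr_recover_if_iterated_gsums[of qs f "\<lambda>_. Adapt" i _ s] qs V f sums by simp
  moreover have "foldr (\<lambda>q. part q Adapt) L f = f" for L using f by (induction L) auto
  ultimately show ?thesis
    using decomp_foldr_recover[of qs "[]" s "{}" "\<lambda>_. Adapt"] qs by simp
qed

end

subsection \<open>Conditional expectations\<close>

lemma (in prob_space) sigma_finite_subalgebraI: "subalgebra M G \<Longrightarrow> sigma_finite_subalgebra M G"
  by (intro finite_measure_subalgebra_is_sigma_finite finite_measure_subalgebra.intro
      finite_measure_subalgebra_axioms.intro finite_measure_axioms)

text \<open>Dynkin's argument: the sets over which the two integrals agree are closed under
  complements and disjoint countable unions.\<close>

lemma set_integral_eq_on_sigma_sets:
  fixes f g :: "'a \<Rightarrow> real"
  assumes P: "Int_stable P" "P \<subseteq> sets M" "space M \<in> P"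
    and int: "integrable M f" "integrable M g"
    and eq: "\<And>A. A \<in> P \<Longrightarrow> (\<integral>x \<in> A. f x \<partial>M) = (\<integral>x \<in> A. g x \<partial>M)"
    and A: "A \<in> sigma_sets (space M) P"
  shows "(\<integral>x \<in> A. f x \<partial>M) = (\<integral>x \<in> A. g x \<partial>M)"
proof -
  have Pow: "P \<subseteq> Pow (space M)" using P(2) sets.sets_into_space by blast
  have sets: "B \<in> sets M" if "B \<in> sigma_sets (space M) P" for B
    using that P(2) sets.sigma_sets_subset by blast
  have si: "set_integrable M B h" if "B \<in> sets M" "integrable M h" for B and h :: "'a \<Rightarrow> real"
    using that unfolding set_integrable_def by (intro integrable_mult_indicator)
  show ?thesis
    using P(1) Pow A
  proof (induction rule: sigma_sets_induct_disjoint)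
    case (basic A)
    then show ?case by (rule eq)
  next
    case empty
    show ?case by (simp add: set_lebesgue_integral_def)
  next
    case (compl A)
    have "(\<integral>x \<in> space M - A. h x \<partial>M) = (\<integral>x \<in> space M. h x \<partial>M) - (\<integral>x \<in> A. h x \<partial>M)"
      if h: "integrable M h" for h :: "'a \<Rightarrow> real"
    proof -
      have "space M = (space M - A) \<union> A" using sets[OF compl(1)] sets.sets_into_space by blast
      then have "(\<integral>x \<in> space M. h x \<partial>M) = (\<integral>x \<in> (space M - A) \<union> A. h x \<partial>M)" by simp
      also have "\<dots> = (\<integral>x \<in> space M - A. h x \<partial>M) + (\<integral>x \<in> A. h x \<partial>M)"
        using sets[OF compl(1)] by (intro set_integral_Un si h) auto
      finally show ?thesis by simp
    qed
    then show ?case using compl eq[OF P(3)] int by simp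
  next
    case (union A)
    have Ai: "A i \<in> sets M" for i using union(2) sets by blast
    have "(\<integral>x \<in> (\<Union>i. A i). h x \<partial>M) = (\<Sum>i. \<integral>x \<in> A i. h x \<partial>M)"
      if h: "integrable M h" for h :: "'a \<Rightarrow> real"
      using union(1) Ai by (intro lebesgue_integral_countable_add si h) (auto simp: disjoint_family_on_def)
    then show ?case using union int by simp
  qed
qed

context prob_space
begin

lemma integrable_cond_exp: "subalgebra M G \<Longrightarrow> integrable M f \<Longrightarrow> integrable M (real_cond_exp M G f)"
  by (rule sigma_finite_subalgebra.real_cond_exp_int(1)[OF sigma_finite_subalgebraI])

lemma cond_exp_indicator_bounds:
  assumes G: "subalgebra M G" and A: "A \<in> sets M"
  shows "AE x in M. \<bar>real_cond_exp M G (indicator A) x\<bar> \<le> 1"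
proof -
  interpret G: sigma_finite_subalgebra M G by (rule sigma_finite_subalgebraI[OF G])
  have "integrable M (indicator A :: _ \<Rightarrow> real)" using A by (simp add: emeasure_eq_measure)
  then show ?thesis
    using G.real_cond_exp_ge_c[of "indicator A" 0] G.real_cond_exp_le_c[of "indicator A" 1]
    by (auto simp: indicator_def elim: AE_mp)
qed

text \<open>Self-adjointness of conditional expectation, with a bounded function on one side so that
  it covers every integrable \<open>f\<close>.\<close>

lemma set_integral_cond_exp_swap:
  assumes G: "subalgebra M G" and A: "A \<in> sets M" and f: "integrable M f"
  shows "integrable M (\<lambda>x. real_cond_exp M G (indicator A) x * f x)"
    and "(\<integral>x \<in> A. real_cond_exp M G f x \<partial>M) = (\<integral>x. real_cond_exp M G (indicator A) x * f x \<partial>M)"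
proof -
  interpret G: sigma_finite_subalgebra M G by (rule sigma_finite_subalgebraI[OF G])
  have mf [measurable]: "f \<in> borel_measurable M" using f by simp
  have Ef: "integrable M (real_cond_exp M G f)" by (rule integrable_cond_exp[OF G f])
  show int: "integrable M (\<lambda>x. real_cond_exp M G (indicator A) x * f x)"
  proof (rule Bochner_Integration.integrable_bound[OF f])
    show "AE x in M. norm (real_cond_exp M G (indicator A) x * f x) \<le> norm (f x)"
      using cond_exp_indicator_bounds[OF G A]
      by eventually_elim (simp add: abs_mult mult_left_le_one_le)
  qed simp
  have "(\<integral>x. real_cond_exp M G (indicator A) x * f x \<partial>M)
      = (\<integral>x. real_cond_exp M G (indicator A) x * real_cond_exp M G f x \<partial>M)"
    using G.real_cond_exp_intg(2)[OF int] by simp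
  also have "\<dots> = (\<integral>x. real_cond_exp M G f x * real_cond_exp M G (indicator A) x \<partial>M)"
    by (simp add: mult.commute)
  also have "\<dots> = (\<integral>x. real_cond_exp M G f x * indicator A x \<partial>M)"
    using A Ef by (intro G.real_cond_exp_intg(2)) (auto simp: integrable_real_mult_indicator)
  finally show "(\<integral>x \<in> A. real_cond_exp M G f x \<partial>M) = (\<integral>x. real_cond_exp M G (indicator A) x * f x \<partial>M)"
    by (simp add: set_lebesgue_integral_def mult.commute)
qed

end

section \<open>Algebras generated by boxes of indices\<close>

locale action_filtration = prob_space M
  for M :: "'a measure" +
  fixes T :: "('n::finite \<Rightarrow> int) \<Rightarrow> 'a \<Rightarrow> 'a" and F :: "('n \<Rightarrow> int) \<Rightarrow> 'a measure"
  assumes action: "measure_preserving_action M T"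
    and filtration: "completely_commuting_filtration M T F"
begin

lemma subalgebra_F: "subalgebra M (F i)"
  and F_mono: "i \<le> j \<Longrightarrow> sets (F i) \<subseteq> sets (F j)"
  and F_commute: "integrable M f \<Longrightarrow>
    AE x in M. real_cond_exp M (F j) (real_cond_exp M (F i) f) x = real_cond_exp M (F (inf i j)) f x"
  using filtration by (auto simp: completely_commuting_filtration_def)

text \<open>A common form for the one-coordinate algebras, the algebra of the whole filtration and,
  with \<open>{..j}\<close>, the sets of \<open>F j\<close>.\<close>

definition gen :: "('n \<Rightarrow> int) set \<Rightarrow> 'a measure" where
  "gen D = sigma (space M) (\<Union>i \<in> D. sets (F i))"

text \<open>In the last clause, \<open>b'\<close> is the projection of \<open>b\<close> to the product of half-lines \<open>D\<close>.\<close>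

definition box :: "('n \<Rightarrow> int) set \<Rightarrow> bool" where
  "box D \<longleftrightarrow> (\<forall>i \<in> D. \<forall>j \<in> D. sup i j \<in> D) \<and> (\<forall>i \<in> D. \<forall>j \<le> i. j \<in> D) \<and>
     (\<forall>b. \<exists>b' \<in> D. b' \<le> b \<and> (\<forall>c \<in> D. inf c b \<le> b'))"

lemma box_UNIV: "box UNIV"
  unfolding box_def by (auto intro: exI[of _ "b" for b])

lemma box_le_coord: "box {i. i q \<le> l}"
proof -
  have "\<exists>b' \<in> {i. i q \<le> l}. b' \<le> b \<and> (\<forall>c \<in> {i. i q \<le> l}. inf c b \<le> b')" for b :: "'n \<Rightarrow> int"
    by (rule bexI[of _ "b(q := min (b q) l)"]) (auto simp: le_fun_def inf_int_def)
  then show ?thesis unfolding box_def by (auto simp: le_fun_def intro: order_trans)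
qed

lemma box_proj:
  assumes "box D" obtains b' where "b' \<in> D" "b' \<le> b" "\<And>c. c \<in> D \<Longrightarrow> inf c b \<le> b'"
proof -
  have "\<exists>b' \<in> D. b' \<le> b \<and> (\<forall>c \<in> D. inf c b \<le> b')" using assms by (simp add: box_def)
  then show thesis using that by auto
qed

lemma box_Int: assumes D: "box D" and D': "box D'" shows "box (D \<inter> D')"
proof -
  have "\<exists>b'' \<in> D \<inter> D'. b'' \<le> b \<and> (\<forall>c \<in> D \<inter> D'. inf c b \<le> b'')" for b
  proof -
    obtain b' where b': "b' \<in> D" "b' \<le> b" "\<And>c. c \<in> D \<Longrightarrow> inf c b \<le> b'"
      by (rule box_proj[OF D, where b = b], blast)
    obtain b'' where b'': "b'' \<in> D'" "b'' \<le> b'" "\<And>c. c \<in> D' \<Longrightarrow> inf c b' \<le> b''"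
      by (rule box_proj[OF D', where b = b'], blast)
    have "inf c b \<le> b''" if "c \<in> D \<inter> D'" for c
      using that b'(3)[of c] b''(3)[of c] by (meson IntD1 IntD2 inf_le1 le_inf_iff order_trans)
    moreover have "b'' \<in> D" using D b' b'' by (auto simp: box_def)
    ultimately show ?thesis using b' b'' by (intro bexI[of _ b'']) auto
  qed
  then show ?thesis using D D' by (auto simp: box_def)
qed

lemma gen_Pow: "(\<Union>i \<in> D. sets (F i)) \<subseteq> Pow (space M)"
  using subalgebra_F sets.sets_into_space by (fastforce simp: subalgebra_def)

lemma sets_gen: "sets (gen D) = sigma_sets (space M) (\<Union>i \<in> D. sets (F i))"
  unfolding gen_def by (rule sets_measure_of[OF gen_Pow])

lemma space_gen [simp]: "space (gen D) = space M"
  unfolding gen_def by (rule space_measure_of[OF gen_Pow])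

lemma F_le_M: "sets (F i) \<subseteq> sets M"
  using subalgebra_F by (simp add: subalgebra_def)

lemma subalgebra_gen: "subalgebra M (gen D)"
  unfolding subalgebra_def sets_gen using F_le_M by (auto intro!: sets.sigma_sets_subset)

lemma F_le_gen: "i \<in> D \<Longrightarrow> sets (F i) \<subseteq> sets (gen D)"
  unfolding sets_gen by auto

lemma gen_mono: "D \<subseteq> D' \<Longrightarrow> sets (gen D) \<subseteq> sets (gen D')"
  unfolding sets_gen by (rule sigma_sets_mono') auto

text \<open>Closure of \<open>D\<close> under \<open>sup\<close> places any two generators in a
  common \<open>F\<close>.\<close>

lemma Int_stable_F: assumes "box D" shows "Int_stable (\<Union>i \<in> D. sets (F i))"
proof (rule Int_stableI)
  fix A B assume "A \<in> (\<Union>i \<in> D. sets (F i))" "B \<in> (\<Union>i \<in> D. sets (F i))"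
  then obtain i j where ij: "i \<in> D" "j \<in> D" "A \<in> sets (F i)" "B \<in> sets (F j)" by auto
  then have "A \<in> sets (F (sup i j))" "B \<in> sets (F (sup i j))" using F_mono[of i "sup i j"] F_mono[of j "sup i j"] by auto
  then show "A \<inter> B \<in> (\<Union>i \<in> D. sets (F i))" using assms ij by (auto simp: box_def)
qed

lemma set_integral_eq_on_gen:
  fixes f g :: "'a \<Rightarrow> real"
  assumes "box D" "integrable M f" "integrable M g"
    and "\<And>i A. i \<in> D \<Longrightarrow> A \<in> sets (F i) \<Longrightarrow> (\<integral>x \<in> A. f x \<partial>M) = (\<integral>x \<in> A. g x \<partial>M)"
    and "A \<in> sets (gen D)"
  shows "(\<integral>x \<in> A. f x \<partial>M) = (\<integral>x \<in> A. g x \<partial>M)"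
proof (rule set_integral_eq_on_sigma_sets[OF Int_stable_F[OF assms(1)]])
  obtain i where "i \<in> D" using assms(1) by (auto simp: box_def)
  moreover have "space M \<in> sets (F i)" using subalgebra_F[of i] sets.top[of "F i"] by (simp add: subalgebra_def)
  ultimately show "space M \<in> (\<Union>i \<in> D. sets (F i))" by auto
  show "A \<in> sigma_sets (space M) (\<Union>i \<in> D. sets (F i))" using assms(5) by (simp add: sets_gen)
qed (use F_le_M assms in auto)

lemma integrable_indicator [simp]: "A \<in> sets M \<Longrightarrow> integrable M (indicator A :: 'a \<Rightarrow> real)"
  by (simp add: emeasure_eq_measure)

lemma measurable_gen_if_F: "i \<in> D \<Longrightarrow> f \<in> borel_measurable (F i) \<Longrightarrow> f \<in> borel_measurable (gen D)"
  using measurable_from_subalg[of "gen D" "F i" f borel] F_le_gen subalgebra_F by (auto simp: subalgebra_def)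

text \<open>\<open>b\<close> and its projection \<open>b'\<close> have the same meet with every
  \<open>c \<in> D\<close>. By complete commutation, the indicator of \<open>B\<close> and its
  conditional expectation given \<open>F b'\<close> therefore look the same to every
  \<open>F c\<close>.\<close>

lemma cond_exp_gen_indicator:
  assumes D: "box D" and B: "B \<in> sets (F b)"
    and b': "b' \<in> D" "b' \<le> b" "\<And>c. c \<in> D \<Longrightarrow> inf c b \<le> b'"
  shows "AE x in M. real_cond_exp M (gen D) (indicator B) x = real_cond_exp M (F b') (indicator B) x"
proof -
  interpret G: sigma_finite_subalgebra M "gen D" by (rule sigma_finite_subalgebraI[OF subalgebra_gen])
  have BM [simp]: "integrable M (indicator B :: 'a \<Rightarrow> real)" using B F_le_M by (intro integrable_indicator) auto
  have E [simp]: "integrable M (real_cond_exp M (F b') (indicator B))"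
    by (intro integrable_cond_exp subalgebra_F BM)
  show ?thesis
  proof (rule G.real_cond_exp_charact)
    show "real_cond_exp M (F b') (indicator B) \<in> borel_measurable (gen D)"
      by (rule measurable_gen_if_F[OF b'(1)]) simp
    fix A assume "A \<in> sets (gen D)"
    then show "(\<integral>x \<in> A. indicator B x \<partial>M) = (\<integral>x \<in> A. real_cond_exp M (F b') (indicator B) x \<partial>M)"
    proof (rule set_integral_eq_on_gen[OF D BM E, rotated])
      fix c A assume c: "c \<in> D" and A: "A \<in> sets (F c)"
      interpret C: sigma_finite_subalgebra M "F c" by (rule sigma_finite_subalgebraI[OF subalgebra_F])
      interpret B: sigma_finite_subalgebra M "F b" by (rule sigma_finite_subalgebraI[OF subalgebra_F])
      have *: "inf b c = inf b' c"
        using b'(2) b'(3)[OF c] by (intro antisym) (simp_all add: inf.commute le_infI1 le_infI2)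
      \<comment> \<open>Conditioning on \<open>F b\<close> fixes the indicator of \<open>B\<close>;
        inserting it makes complete commutation applicable.\<close>
      have "AE x in M. real_cond_exp M (F b) (indicator B) x = indicator B x"
        using B by (intro B.real_cond_exp_F_meas) auto
      then have "AE x in M. real_cond_exp M (F c) (real_cond_exp M (F b) (indicator B)) x
          = real_cond_exp M (F c) (indicator B) x"
        by (rule C.real_cond_exp_cong) (simp_all add: borel_measurable_integrable[OF BM])
      with F_commute[OF BM, of c b] F_commute[OF BM, of c b']
      have "AE x in M. real_cond_exp M (F c) (indicator B) x
          = real_cond_exp M (F c) (real_cond_exp M (F b') (indicator B)) x"
        unfolding * by eventually_elim simp
      then have "(\<integral>x \<in> A. real_cond_exp M (F c) (indicator B) x \<partial>M)
          = (\<integral>x \<in> A. real_cond_exp M (F c) (real_cond_exp M (F b') (indicator B)) x \<partial>M)"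
        using A F_le_M by (intro set_lebesgue_integral_cong_AE) auto
      then show "(\<integral>x \<in> A. indicator B x \<partial>M) = (\<integral>x \<in> A. real_cond_exp M (F b') (indicator B) x \<partial>M)"
        using C.real_cond_exp_intA[OF BM A] C.real_cond_exp_intA[OF E A] by simp
    qed
  qed simp_all
qed

text \<open>When tested on \<open>B\<close> in \<open>F b\<close>, self-adjointness moves the
  conditioning from \<open>A\<close> to \<open>B\<close>. There the projection of \<open>b\<close>
  to \<open>D\<close> lies below \<open>b\<close>, hence in \<open>D'\<close> as well, and serves
  both \<open>D\<close> and \<open>D \<inter> D'\<close>.\<close>

lemma cond_exp_gen_Int_indicator:
  assumes D: "box D" and D': "box D'" and A: "A \<in> sets (gen D)"
  shows "AE x in M. real_cond_exp M (gen D') (indicator A) x = real_cond_exp M (gen (D \<inter> D')) (indicator A) x"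
proof -
  interpret G: sigma_finite_subalgebra M "gen D'" by (rule sigma_finite_subalgebraI[OF subalgebra_gen])
  interpret GD: sigma_finite_subalgebra M "gen D" by (rule sigma_finite_subalgebraI[OF subalgebra_gen])
  have AM: "A \<in> sets M" using A subalgebra_gen by (auto simp: subalgebra_def)
  then have AI [simp]: "integrable M (indicator A :: 'a \<Rightarrow> real)" by simp
  have E [simp]: "integrable M (real_cond_exp M (gen (D \<inter> D')) (indicator A))"
    by (intro integrable_cond_exp subalgebra_gen AI)
  show ?thesis
  proof (rule G.real_cond_exp_charact)
    show "real_cond_exp M (gen (D \<inter> D')) (indicator A) \<in> borel_measurable (gen D')"
      by (rule measurable_from_subalg[of _ "gen (D \<inter> D')"]) (auto simp: subalgebra_def gen_mono)
    fix B assume "B \<in> sets (gen D')"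
    then show "(\<integral>x \<in> B. indicator A x \<partial>M) = (\<integral>x \<in> B. real_cond_exp M (gen (D \<inter> D')) (indicator A) x \<partial>M)"
    proof (rule set_integral_eq_on_gen[OF D' AI E, rotated])
      fix b B assume b: "b \<in> D'" and B: "B \<in> sets (F b)"
      have BM: "B \<in> sets M" using B F_le_M by auto
      obtain b' where b': "b' \<in> D" "b' \<le> b" "\<And>c. c \<in> D \<Longrightarrow> inf c b \<le> b'"
        by (rule box_proj[OF D, where b = b], blast)
      have b'': "b' \<in> D \<inter> D'" using b b' D' by (auto simp: box_def)
      have ae: "AE x in M. real_cond_exp M (gen D) (indicator B) x = real_cond_exp M (gen (D \<inter> D')) (indicator B) x"
        using cond_exp_gen_indicator[OF D B b'] cond_exp_gen_indicator[OF box_Int[OF D D'] B b'' b'(2)] b'(3)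
        by (auto elim: AE_mp)
      have "(\<integral>x \<in> B. indicator A x \<partial>M) = (\<integral>x \<in> A. indicator B x \<partial>M :: real)"
        by (simp add: set_lebesgue_integral_def mult.commute)
      also have "\<dots> = (\<integral>x \<in> A. real_cond_exp M (gen D) (indicator B) x \<partial>M)"
        using BM by (intro GD.real_cond_exp_intA A) simp
      also have "\<dots> = (\<integral>x \<in> A. real_cond_exp M (gen (D \<inter> D')) (indicator B) x \<partial>M)"
        using ae AM by (intro set_lebesgue_integral_cong_AE) auto
      also have "\<dots> = (\<integral>x. real_cond_exp M (gen (D \<inter> D')) (indicator A) x * indicator B x \<partial>M)"
        using BM by (intro set_integral_cond_exp_swap subalgebra_gen AM) simp
      also have "\<dots> = (\<integral>x \<in> B. real_cond_exp M (gen (D \<inter> D')) (indicator A) x \<partial>M)"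
        by (simp add: set_lebesgue_integral_def mult.commute)
      finally show "(\<integral>x \<in> B. indicator A x \<partial>M) = (\<integral>x \<in> B. real_cond_exp M (gen (D \<inter> D')) (indicator A) x \<partial>M)" .
    qed
  qed simp_all
qed

text \<open>Self-adjointness once more, now to pass from indicators of sets in \<open>gen D\<close>
  to an arbitrary integrable \<open>f\<close>.\<close>

theorem cond_exp_gen_gen:
  assumes D: "box D" and D': "box D'" and f: "integrable M f"
  shows "AE x in M. real_cond_exp M (gen D) (real_cond_exp M (gen D') f) x = real_cond_exp M (gen (D \<inter> D')) f x"
proof -
  interpret G: sigma_finite_subalgebra M "gen D" by (rule sigma_finite_subalgebraI[OF subalgebra_gen])
  show ?thesis
  proof (rule G.real_cond_exp_charact)
    show "real_cond_exp M (gen (D \<inter> D')) f \<in> borel_measurable (gen D)"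
      by (rule measurable_from_subalg[of _ "gen (D \<inter> D')"]) (auto simp: subalgebra_def gen_mono)
    fix A assume A: "A \<in> sets (gen D)"
    then have AM: "A \<in> sets M" using subalgebra_gen by (auto simp: subalgebra_def)
    have mf [measurable]: "f \<in> borel_measurable M" using f by simp
    have "(\<integral>x \<in> A. real_cond_exp M (gen D') f x \<partial>M) = (\<integral>x. real_cond_exp M (gen D') (indicator A) x * f x \<partial>M)"
      by (rule set_integral_cond_exp_swap(2)[OF subalgebra_gen AM f])
    also have "\<dots> = (\<integral>x. real_cond_exp M (gen (D \<inter> D')) (indicator A) x * f x \<partial>M)"
      using cond_exp_gen_Int_indicator[OF D D' A] by (intro integral_cong_AE) (auto elim: AE_mp)
    also have "\<dots> = (\<integral>x \<in> A. real_cond_exp M (gen (D \<inter> D')) f x \<partial>M)"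
      by (rule set_integral_cond_exp_swap(2)[OF subalgebra_gen AM f, symmetric])
    finally show "(\<integral>x \<in> A. real_cond_exp M (gen D') f x \<partial>M) = (\<integral>x \<in> A. real_cond_exp M (gen (D \<inter> D')) f x \<partial>M)" .
  qed (auto intro: integrable_cond_exp subalgebra_gen f)
qed

section \<open>Conditional expectations under the action\<close>

definition shift :: "('n \<Rightarrow> int) \<Rightarrow> ('n \<Rightarrow> int) set \<Rightarrow> ('n \<Rightarrow> int) set" where
  "shift i D = {d. (\<lambda>q. d q - i q) \<in> D}"

lemma T_measurable [measurable]: "T i \<in> measurable M M"
  and T_distr: "distr M M (T i) = M"
  and T_zero: "x \<in> space M \<Longrightarrow> T (\<lambda>_. 0) x = x"
  and T_add: "x \<in> space M \<Longrightarrow> T (\<lambda>q. i q + j q) x = T i (T j x)"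
  using action by (auto simp: measure_preserving_action_def)

lemma T_space: "x \<in> space M \<Longrightarrow> T i x \<in> space M"
  using measurable_space[OF T_measurable] .

lemma T_minus: "x \<in> space M \<Longrightarrow> T (- i) (T i x) = x" "x \<in> space M \<Longrightarrow> T i (T (- i) x) = x"
  using T_add[of x "- i" i] T_add[of x i "- i"] T_zero[of x] by simp_all

text \<open>The filtration consists of images under \<open>T (- i)\<close>; invertibility turns the
  preimage of such an image into another one, with the indices added.\<close>

lemma T_vimage_F:
  assumes B: "B \<in> sets (F d)" shows "T i -` B \<inter> space M \<in> sets (F (\<lambda>q. d q + i q))"
proof -
  obtain G where G: "subalgebra M G" "\<And>i. sets (F i) = (\<lambda>A. T (- i) ` A) ` sets G"
    using filtration by (auto simp: completely_commuting_filtration_def)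
  from B obtain C where C: "C \<in> sets G" "B = T (- d) ` C" by (auto simp: G(2))
  have CM: "C \<subseteq> space M" using C(1) G(1) sets.sets_into_space by (fastforce simp: subalgebra_def)
  let ?di = "\<lambda>q. d q + i q"
  have eq: "T (- ?di) x = T (- i) (T (- d) x)" if "x \<in> space M" for x
  proof -
    have "- ?di = (\<lambda>q. (- i) q + (- d) q)" by (auto simp: fun_eq_iff)
    then show ?thesis using T_add[OF that, of "- i" "- d"] by simp
  qed
  have "T i -` B \<inter> space M = T (- ?di) ` C"
  proof (intro set_eqI iffI)
    fix x assume x: "x \<in> T i -` B \<inter> space M"
    then obtain y where y: "y \<in> C" "T i x = T (- d) y" using C by auto
    then have "x = T (- ?di) y" using x CM T_minus(1)[of x i] by (auto simp: eq)
    then show "x \<in> T (- ?di) ` C" using y by auto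
  next
    fix x assume "x \<in> T (- ?di) ` C"
    then obtain y where y: "y \<in> C" "x = T (- i) (T (- d) y)" using CM eq by auto
    then show "x \<in> T i -` B \<inter> space M" using CM C(2) by (auto simp: T_minus T_space)
  qed
  then show ?thesis using C(1) G(2) by auto
qed

lemma T_measurable_gen: "T i \<in> measurable (gen (shift i D)) (gen D)"
  unfolding gen_def[of D]
proof (rule measurable_measure_of[OF gen_Pow])
  show "T i \<in> space (gen (shift i D)) \<rightarrow> space M" by (simp add: T_space)
  fix B assume "B \<in> (\<Union>i \<in> D. sets (F i))"
  then obtain d where d: "d \<in> D" "B \<in> sets (F d)" by auto
  then have "(\<lambda>q. d q + i q) \<in> shift i D" by (simp add: shift_def)
  then show "T i -` B \<inter> space (gen (shift i D)) \<in> sets (gen (shift i D))"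
    using T_vimage_F[OF d(2), of i] F_le_gen by auto
qed

lemma integral_T: "f \<in> borel_measurable M \<Longrightarrow> (\<integral>x. f (T i x) \<partial>M) = (\<integral>x. (f x :: real) \<partial>M)"
  using integral_distr[OF T_measurable, of f i] by (simp add: T_distr)

lemma integrable_T: "integrable M f \<Longrightarrow> integrable M (\<lambda>x. f (T i x) :: real)"
  using integrable_distr[OF T_measurable, of i f] by (simp add: T_distr)

lemma AE_T: "AE x in M. P x \<Longrightarrow> AE x in M. P (T i x)"
  using AE_distrD[OF T_measurable[of i], of P] unfolding T_distr .

text \<open>A set of the shifted algebra is the preimage under \<open>T i\<close> of a set
  \<open>B\<close> in \<open>gen D\<close>, and \<open>T i\<close> preserves integrals.\<close>

theorem cond_exp_gen_T:
  assumes f: "integrable M f"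
  shows "AE x in M. real_cond_exp M (gen (shift i D)) (\<lambda>x. f (T i x)) x = real_cond_exp M (gen D) f (T i x)"
proof -
  interpret G: sigma_finite_subalgebra M "gen (shift i D)" by (rule sigma_finite_subalgebraI[OF subalgebra_gen])
  interpret GD: sigma_finite_subalgebra M "gen D" by (rule sigma_finite_subalgebraI[OF subalgebra_gen])
  have E: "integrable M (real_cond_exp M (gen D) f)" by (rule integrable_cond_exp[OF subalgebra_gen f])
  show ?thesis
  proof (rule G.real_cond_exp_charact)
    show "(\<lambda>x. real_cond_exp M (gen D) f (T i x)) \<in> borel_measurable (gen (shift i D))"
      by (rule measurable_compose[OF T_measurable_gen]) simp
    fix A assume A: "A \<in> sets (gen (shift i D))"
    define B where "B = T (- i) -` A \<inter> space M"
    have "shift (- i) (shift i D) = D" by (auto simp: shift_def)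
    then have B: "B \<in> sets (gen D)"
      using measurable_sets[OF T_measurable_gen[of "- i" "shift i D"] A] by (simp add: B_def)
    then have [measurable]: "B \<in> sets M" using subalgebra_gen by (auto simp: subalgebra_def)
    have [measurable]: "f \<in> borel_measurable M" using f by simp
    have AB: "x \<in> A \<longleftrightarrow> T i x \<in> B" if "x \<in> space M" for x
      using that by (simp add: B_def T_minus T_space)
    have *: "(\<integral>x \<in> A. h (T i x) \<partial>M) = (\<integral>x \<in> B. h x \<partial>M)" if h: "h \<in> borel_measurable M" for h :: "'a \<Rightarrow> real"
    proof -
      have "(\<integral>x \<in> A. h (T i x) \<partial>M) = (\<integral>x. indicator B (T i x) *\<^sub>R h (T i x) \<partial>M)"
        unfolding set_lebesgue_integral_def by (intro Bochner_Integration.integral_cong) (auto simp: AB indicator_def)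
      also have "\<dots> = (\<integral>x \<in> B. h x \<partial>M)"
        unfolding set_lebesgue_integral_def using h by (intro integral_T) measurable
      finally show ?thesis .
    qed
    show "(\<integral>x \<in> A. f (T i x) \<partial>M) = (\<integral>x \<in> A. real_cond_exp M (gen D) f (T i x) \<partial>M)"
      using GD.real_cond_exp_intA[OF f B] by (simp add: *)
  qed (auto intro: integrable_T f E)
qed

end

subsection \<open>The spaces \<open>L\<^sup>p\<close>\<close>

text \<open>Comparison with twice the larger absolute value yields the factor
  \<open>2 powr p\<close>, which becomes the constant \<open>K\<close> of the quasi-norm.\<close>

lemma powr_abs_add_le:
  fixes x y p :: real
  assumes "1 \<le> p"
  shows "\<bar>x + y\<bar> powr p \<le> 2 powr p * (\<bar>x\<bar> powr p + \<bar>y\<bar> powr p)"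
proof -
  have "\<bar>x + y\<bar> powr p \<le> (2 * max \<bar>x\<bar> \<bar>y\<bar>) powr p"
    using assms by (intro powr_mono2) auto
  also have "\<dots> = 2 powr p * max \<bar>x\<bar> \<bar>y\<bar> powr p" by (simp add: powr_mult)
  also have "max \<bar>x\<bar> \<bar>y\<bar> powr p \<le> \<bar>x\<bar> powr p + \<bar>y\<bar> powr p" by (simp add: max_def)
  finally show ?thesis by simp
qed

lemma convex_on_powr_abs:
  fixes p :: real
  assumes p: "1 \<le> p" shows "convex_on UNIV (\<lambda>x::real. \<bar>x\<bar> powr p)"
proof (rule convex_onI)
  fix t x y :: real assume t: "0 < t" "t < 1"
  \<comment> \<open>For the case that one argument is \<open>0\<close>, where the claim reduces to
    \<open>s powr p \<le> s\<close> for \<open>s\<close> between 0 and 1.\<close>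
  have scale: "(s * a) powr p \<le> s * a powr p" if "0 < s" "s < 1" "0 \<le> a" for s a :: real
  proof -
    have "s powr p \<le> s powr 1" using that p by (intro powr_mono') auto
    then show ?thesis using that by (auto simp: powr_mult intro: mult_right_mono)
  qed
  have "\<bar>(1 - t) *\<^sub>R x + t *\<^sub>R y\<bar> powr p \<le> ((1 - t) * \<bar>x\<bar> + t * \<bar>y\<bar>) powr p"
    using t p abs_triangle_ineq[of "(1 - t) * x" "t * y"] by (intro powr_mono2) (auto simp: abs_mult)
  also have "\<dots> \<le> (1 - t) * \<bar>x\<bar> powr p + t * \<bar>y\<bar> powr p"
  proof (cases "x = 0 \<or> y = 0")
    case True
    then show ?thesis using scale[of t "\<bar>y\<bar>"] scale[of "1 - t" "\<bar>x\<bar>"] t p by auto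
  next
    case False
    then show ?thesis using convex_onD[OF powr_convex[OF p], of t "\<bar>x\<bar>" "\<bar>y\<bar>"] t by simp
  qed
  finally show "\<bar>(1 - t) *\<^sub>R x + t *\<^sub>R y\<bar> powr p \<le> (1 - t) * \<bar>x\<bar> powr p + t * \<bar>y\<bar> powr p" .
qed simp

text \<open>The p-th power of the norm; it tends to \<open>0\<close> exactly when the norm does and
  spares all roots.\<close>

definition moment :: "'a measure \<Rightarrow> real \<Rightarrow> ('a \<Rightarrow> real) \<Rightarrow> real" where
  "moment M p f = (\<integral>x. \<bar>f x\<bar> powr p \<partial>M)"

lemma moment_nonneg [simp]: "0 \<le> moment M p f"
  unfolding moment_def by (rule integral_nonneg_AE) simp

lemma moment_cong: "AE x in M. f x = g x \<Longrightarrow> f \<in> borel_measurable M \<Longrightarrow> g \<in> borel_measurable M \<Longrightarrow>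
    moment M p f = moment M p g"
  unfolding moment_def by (rule integral_cong_AE) (auto elim: AE_mp)

lemma moment_uminus: "moment M p (\<lambda>x. - f x) = moment M p f"
  by (simp add: moment_def)

lemma Lp_measurable: "f \<in> Lp M p \<Longrightarrow> f \<in> borel_measurable M"
  by (simp add: Lp_def)

lemma Lp_zero: "(\<lambda>x. 0) \<in> Lp M p"
  by (simp add: Lp_def)

lemma Lp_uminus: "f \<in> Lp M p \<Longrightarrow> (\<lambda>x. - f x) \<in> Lp M p"
  by (simp add: Lp_def)

lemma Lp_add: assumes p: "1 \<le> p" and f: "f \<in> Lp M p" "g \<in> Lp M p" shows "(\<lambda>x. f x + g x) \<in> Lp M p"
proof -
  have [measurable]: "f \<in> borel_measurable M" "g \<in> borel_measurable M" using f by (auto simp: Lp_def)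
  have "integrable M (\<lambda>x. 2 powr p * (\<bar>f x\<bar> powr p + \<bar>g x\<bar> powr p))"
    using f by (simp add: Lp_def)
  then have "integrable M (\<lambda>x. \<bar>f x + g x\<bar> powr p)"
    by (rule Bochner_Integration.integrable_bound) (simp_all add: powr_abs_add_le[OF p])
  then show ?thesis by (simp add: Lp_def)
qed

lemma Lp_diff_fun: "1 \<le> p \<Longrightarrow> f \<in> Lp M p \<Longrightarrow> g \<in> Lp M p \<Longrightarrow> (\<lambda>x. f x - g x) \<in> Lp M p"
  using Lp_add[of p f M "\<lambda>x. - g x"] Lp_uminus[of g M p] by simp

lemma Lp_sum: "1 \<le> p \<Longrightarrow> (\<And>k. k \<in> I \<Longrightarrow> f k \<in> Lp M p) \<Longrightarrow> (\<lambda>x. \<Sum>k \<in> I. f k x) \<in> Lp M p"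
  by (induction I rule: infinite_finite_induct) (simp_all add: Lp_zero Lp_add)

lemma moment_add:
  assumes p: "1 \<le> p" and f: "f \<in> Lp M p" "g \<in> Lp M p"
  shows "moment M p (\<lambda>x. f x + g x) \<le> 2 powr p * (moment M p f + moment M p g)"
proof -
  have "moment M p (\<lambda>x. f x + g x) \<le> (\<integral>x. 2 powr p * (\<bar>f x\<bar> powr p + \<bar>g x\<bar> powr p) \<partial>M)"
    unfolding moment_def using f Lp_add[OF p f] powr_abs_add_le[OF p] by (intro integral_mono) (auto simp: Lp_def)
  also have "\<dots> = 2 powr p * (moment M p f + moment M p g)" using f by (simp add: Lp_def moment_def)
  finally show ?thesis .
qed

lemma moment_eq_0_iff: "f \<in> Lp M p \<Longrightarrow> moment M p f = 0 \<longleftrightarrow> (AE x in M. f x = 0)"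
  unfolding moment_def Lp_def by (subst integral_nonneg_eq_0_iff_AE) auto

context prob_space
begin

lemma Lp_integrable: assumes p: "1 \<le> p" and f: "f \<in> Lp M p" shows "integrable M f"
proof (rule Bochner_Integration.integrable_bound)
  show "integrable M (\<lambda>x. 1 + \<bar>f x\<bar> powr p)" using f by (simp add: Lp_def)
  have "\<bar>y\<bar> \<le> 1 + \<bar>y\<bar> powr p" for y :: real
  proof (cases "\<bar>y\<bar> \<le> 1")
    case False
    then have "\<bar>y\<bar> powr 1 \<le> \<bar>y\<bar> powr p" using p by (intro powr_mono) auto
    then show ?thesis using False by simp
  qed (simp add: add_increasing2)
  then show "AE x in M. norm (f x) \<le> norm (1 + \<bar>f x\<bar> powr p)" by (auto simp: abs_of_nonneg)
qed (use f in \<open>simp add: Lp_def\<close>)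

lemma Lp_bounded:
  assumes p: "1 \<le> p" and f: "f \<in> borel_measurable M" "AE x in M. \<bar>f x\<bar> \<le> c" shows "f \<in> Lp M p"
proof -
  have "integrable M (\<lambda>x. \<bar>f x\<bar> powr p)"
  proof (rule integrable_const_bound)
    show "AE x in M. norm (\<bar>f x\<bar> powr p) \<le> c powr p"
      using f(2) by eventually_elim (use p in \<open>auto intro: powr_mono2\<close>)
  qed (use f in simp)
  then show ?thesis using f by (simp add: Lp_def)
qed

text \<open>Jensen's inequality for conditional expectations, applied to the p-th power of the
  absolute value.\<close>

lemma Lp_cond_exp:
  assumes p: "1 \<le> p" and G: "subalgebra M G" and f: "f \<in> Lp M p"
  shows "real_cond_exp M G f \<in> Lp M p" and "moment M p (real_cond_exp M G f) \<le> moment M p f"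
proof -
  interpret G: sigma_finite_subalgebra M G by (rule sigma_finite_subalgebraI[OF G])
  have f': "integrable M f" "integrable M (\<lambda>x. \<bar>f x\<bar> powr p)" using f Lp_integrable[OF p f] by (auto simp: Lp_def)
  have m: "(\<lambda>x. \<bar>x\<bar> powr p) \<in> borel_measurable borel" by measurable
  have int: "integrable M (\<lambda>x. \<bar>real_cond_exp M G f x\<bar> powr p)"
    by (rule G.integrable_convex_cond_exp[OF f'(1) _ _ f'(2) convex_on_powr_abs[OF p] m]) auto
  then show "real_cond_exp M G f \<in> Lp M p" by (simp add: Lp_def)
  have "AE x in M. \<bar>real_cond_exp M G f x\<bar> powr p \<le> real_cond_exp M G (\<lambda>x. \<bar>f x\<bar> powr p) x"
    by (rule G.real_cond_exp_jensens_inequality(2)[OF f'(1) _ _ f'(2) convex_on_powr_abs[OF p] m]) auto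
  then have "moment M p (real_cond_exp M G f) \<le> (\<integral>x. real_cond_exp M G (\<lambda>x. \<bar>f x\<bar> powr p) x \<partial>M)"
    unfolding moment_def by (intro integral_mono_AE int G.real_cond_exp_int(1) f'(2))
  then show "moment M p (real_cond_exp M G f) \<le> moment M p f"
    using G.real_cond_exp_int(2)[OF f'(2)] by (simp add: moment_def)
qed

subsection \<open>Martingale convergence in \<open>L\<^sup>p\<close>\<close>

lemma cond_exp_bounded:
  assumes G: "subalgebra M G" and f: "f \<in> borel_measurable M" "\<And>x. \<bar>f x\<bar> \<le> c"
  shows "AE x in M. \<bar>real_cond_exp M G f x\<bar> \<le> c"
proof -
  interpret G: sigma_finite_subalgebra M G by (rule sigma_finite_subalgebraI[OF G])
  have int: "integrable M f" using f by (intro integrable_const_bound[where B = c]) auto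
  have "AE x in M. - c \<le> real_cond_exp M G f x" "AE x in M. real_cond_exp M G f x \<le> c"
    using f(2) by (auto intro!: G.real_cond_exp_ge_c G.real_cond_exp_le_c int simp: abs_le_iff minus_le_iff)
  then show ?thesis by eventually_elim auto
qed

text \<open>Pythagoras for nested algebras, for bounded functions so that all products are
  integrable.\<close>

lemma integral_cond_exp_diff_square:
  assumes G: "subalgebra M G" and H: "subalgebra M H" and GH: "sets G \<subseteq> sets H"
    and f: "f \<in> borel_measurable M" "\<And>x. \<bar>f x\<bar> \<le> c"
  shows "(\<integral>x. (real_cond_exp M H f x - real_cond_exp M G f x)\<^sup>2 \<partial>M)
    = (\<integral>x. (real_cond_exp M H f x)\<^sup>2 \<partial>M) - (\<integral>x. (real_cond_exp M G f x)\<^sup>2 \<partial>M)"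
proof -
  interpret G: sigma_finite_subalgebra M G by (rule sigma_finite_subalgebraI[OF G])
  have int: "integrable M f" using f by (intro integrable_const_bound[where B = c]) auto
  have GH': "subalgebra H G" using G H GH by (simp add: subalgebra_def)
  let ?g = "real_cond_exp M G f" and ?h = "real_cond_exp M H f"
  have prod: "integrable M (\<lambda>x. u x * v x)"
    if "u \<in> {?g, ?h}" "v \<in> {?g, ?h}" for u v
  proof (rule integrable_const_bound[where B = "c * c"])
    have "AE x in M. \<bar>u x\<bar> \<le> c" "AE x in M. \<bar>v x\<bar> \<le> c"
      using that cond_exp_bounded[OF G f] cond_exp_bounded[OF H f] by auto
    then show "AE x in M. norm (u x * v x) \<le> c * c"
      by eventually_elim (auto simp: abs_mult intro: mult_mono)
  qed (use that in auto)
  have "(\<integral>x. ?g x * ?h x \<partial>M) = (\<integral>x. ?g x * real_cond_exp M G ?h x \<partial>M)"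
    using prod by (intro G.real_cond_exp_intg(2)[symmetric]) auto
  also have "\<dots> = (\<integral>x. ?g x * ?g x \<partial>M)"
    using G.real_cond_exp_nested_subalg[OF H GH' int] by (intro integral_cong_AE) (auto elim: AE_mp)
  finally have gh: "(\<integral>x. ?g x * ?h x \<partial>M) = (\<integral>x. ?g x * ?g x \<partial>M)" .
  have "(\<integral>x. (?h x - ?g x)\<^sup>2 \<partial>M) = (\<integral>x. ?h x * ?h x - 2 * (?g x * ?h x) + ?g x * ?g x \<partial>M)"
    by (simp add: power2_eq_square algebra_simps)
  also have "\<dots> = (\<integral>x. ?h x * ?h x \<partial>M) - 2 * (\<integral>x. ?g x * ?h x \<partial>M) + (\<integral>x. ?g x * ?g x \<partial>M)"
    using prod[of ?h ?h] prod[of ?g ?h] prod[of ?g ?g] by simp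
  finally show ?thesis by (simp add: gh power2_eq_square)
qed

lemma AE_convergent_if_summable_L1:
  fixes X :: "nat \<Rightarrow> 'a \<Rightarrow> real"
  assumes int: "\<And>k. integrable M (X k)" and sum: "summable (\<lambda>k. \<integral>x. \<bar>X (Suc k) x - X k x\<bar> \<partial>M)"
  shows "AE x in M. convergent (\<lambda>k. X k x)"
proof -
  let ?d = "\<lambda>k x. \<bar>X (Suc k) x - X k x\<bar>"
  have [measurable]: "X k \<in> borel_measurable M" for k using int by auto
  have "(\<integral>\<^sup>+x. (\<Sum>k. ennreal (?d k x)) \<partial>M) = (\<Sum>k. \<integral>\<^sup>+x. ennreal (?d k x) \<partial>M)"
    by (rule nn_integral_suminf) measurable
  also have "\<dots> = (\<Sum>k. ennreal (\<integral>x. ?d k x \<partial>M))"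
    using int by (intro suminf_cong nn_integral_eq_integral) auto
  also have "\<dots> = ennreal (\<Sum>k. \<integral>x. ?d k x \<partial>M)"
    using sum by (intro suminf_ennreal2) auto
  finally have "(\<integral>\<^sup>+x. (\<Sum>k. ennreal (?d k x)) \<partial>M) \<noteq> \<infinity>" by simp
  then have "AE x in M. (\<Sum>k. ennreal (?d k x)) \<noteq> \<infinity>"
    by (intro nn_integral_PInf_AE) measurable
  then show ?thesis
  proof eventually_elim
    case (elim x)
    then have "summable (\<lambda>k. ?d k x)" by (intro summable_suminf_not_top) auto
    then have "summable (\<lambda>k. X (Suc k) x - X k x)" by (rule summable_rabs_cancel)
    then have "convergent (\<lambda>n. \<Sum>k<n. X (Suc k) x - X k x)" by (simp add: summable_iff_convergent)
    then have "convergent (\<lambda>n. X n x - X 0 x)" using sum_lessThan_telescope[of "\<lambda>k. X k x"] by simp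
    then have "convergent (\<lambda>n. (X n x - X 0 x) + X 0 x)" by (intro convergent_add convergent_const)
    then show ?case by simp
  qed
qed

end

lemma Cauchy_fast_subseq:
  fixes a :: "nat \<Rightarrow> real"
  assumes "Cauchy a" and e: "\<And>k::nat. 0 < e k"
  obtains r :: "nat \<Rightarrow> nat" where "strict_mono r" "\<And>k m n. r k \<le> m \<Longrightarrow> r k \<le> n \<Longrightarrow> \<bar>a m - a n\<bar> < e k"
proof -
  have "\<exists>N. \<forall>m \<ge> N. \<forall>n \<ge> N. \<bar>a m - a n\<bar> < e k" for k
    using metric_CauchyD[OF assms(1) e[of k]] by (simp add: dist_real_def)
  then obtain N where N: "\<And>k m n. N k \<le> m \<Longrightarrow> N k \<le> n \<Longrightarrow> \<bar>a m - a n\<bar> < e k" by metis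
  \<comment> \<open>The sum dominates every \<open>N k\<close>; the summand \<open>k\<close> makes
    \<open>r\<close> strictly increasing.\<close>
  define r where "r k = k + (\<Sum>j\<le>k. N j)" for k
  have "strict_mono r" by (simp add: strict_mono_Suc_iff r_def)
  moreover have "N k \<le> r k" for k unfolding r_def by (simp add: trans_le_add2 member_le_sum)
  ultimately show thesis by (intro that[of r] N) (auto intro: order_trans)
qed

text \<open>Lets second moments control all p-th moments of uniformly bounded functions: up to
  \<open>\<delta>\<close> the first term suffices, beyond it \<open>x^2 / \<delta>^2\<close> is at
  least 1.\<close>

lemma powr_le_square_bound:
  fixes x :: real
  assumes p: "1 \<le> p" and d: "0 < \<delta>" "\<delta> \<le> 1" and x: "\<bar>x\<bar> \<le> C"
  shows "\<bar>x\<bar> powr p \<le> \<delta> + C powr p / \<delta>\<^sup>2 * x\<^sup>2"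
proof (cases "\<bar>x\<bar> \<le> \<delta>")
  case True
  have "\<bar>x\<bar> powr p \<le> \<bar>x\<bar>"
    using True p d by (cases "x = 0") (auto intro: powr_le_one_le)
  moreover have "0 \<le> C powr p / \<delta>\<^sup>2 * x\<^sup>2" by simp
  ultimately show ?thesis using True by linarith
next
  case False
  then have "\<delta>\<^sup>2 \<le> x\<^sup>2" using d by (intro abs_le_square_iff[THEN iffD1]) auto
  then have "1 \<le> x\<^sup>2 / \<delta>\<^sup>2" using d by simp
  then have "C powr p * 1 \<le> C powr p * (x\<^sup>2 / \<delta>\<^sup>2)" by (rule mult_left_mono) simp
  moreover have "\<bar>x\<bar> powr p \<le> C powr p" using x p by (intro powr_mono2) auto
  ultimately show ?thesis using d by simp
qed

context prob_space
begin

text \<open>Both directions of time are treated at once, since orthogonality only takes two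
  comparable algebras. The second moments are monotone and bounded, hence Cauchy, and by Pythagoras
  so are the conditional expectations. An explicit limit of a fast subsequence gives a version
  measurable for every algebra that contains a tail of the \<open>H n\<close>.\<close>

lemma bounded_martingale_converges:
  fixes H :: "nat \<Rightarrow> 'a measure"
  assumes H: "\<And>n. subalgebra M (H n)"
    and nested: "(\<forall>m n. m \<le> n \<longrightarrow> sets (H m) \<subseteq> sets (H n)) \<or> (\<forall>m n. m \<le> n \<longrightarrow> sets (H n) \<subseteq> sets (H m))"
    and f: "f \<in> borel_measurable M" "\<And>x. \<bar>f x\<bar> \<le> c"
  shows "\<exists>h. h \<in> borel_measurable M \<and> (AE x in M. \<bar>h x\<bar> \<le> c) \<and>
    (\<forall>G j. space G = space M \<longrightarrow> (\<forall>n \<ge> j. sets (H n) \<subseteq> sets G) \<longrightarrow> h \<in> borel_measurable G) \<and>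
    (\<forall>p \<ge> 1. (\<lambda>n. moment M p (\<lambda>x. real_cond_exp M (H n) f x - h x)) \<longlonglongrightarrow> 0)"
proof -
  define E where "E n = real_cond_exp M (H n) f" for n
  define a where "a n = (\<integral>x. (E n x)\<^sup>2 \<partial>M)" for n
  have c: "0 \<le> c" using f(2)[of undefined] by linarith
  have E_meas [measurable]: "E n \<in> borel_measurable M" for n by (simp add: E_def)
  have E_bound: "AE x in M. \<bar>E n x\<bar> \<le> c" for n unfolding E_def by (rule cond_exp_bounded[OF H f])
  have E_int: "integrable M (E n)" for n
    using E_bound[of n] by (intro integrable_const_bound[where B = c]) auto
  have sq_int: "integrable M (\<lambda>x. (u x)\<^sup>2)" if "u \<in> borel_measurable M" "AE x in M. \<bar>u x\<bar> \<le> C" for u :: "'a \<Rightarrow> real" and C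
  proof (rule integrable_const_bound)
    show "AE x in M. norm ((u x)\<^sup>2) \<le> C\<^sup>2"
      using that(2) by eventually_elim (simp add: abs_le_square_iff[symmetric])
  qed (use that in simp)
  have diff_bound: "AE x in M. \<bar>u x - v x\<bar> \<le> 2 * c"
    if "AE x in M. \<bar>u x\<bar> \<le> c" "AE x in M. \<bar>v x\<bar> \<le> c" for u v :: "'a \<Rightarrow> real"
    using that by eventually_elim auto
  have sq_diff: "(\<integral>x. (E n x - E m x)\<^sup>2 \<partial>M) = a n - a m" if "sets (H m) \<subseteq> sets (H n)" for m n
    unfolding a_def E_def by (rule integral_cond_exp_diff_square[OF H H that f])
  have a_mono: "a m \<le> a n" if "sets (H m) \<subseteq> sets (H n)" for m n
  proof -
    have "0 \<le> (\<integral>x. (E n x - E m x)\<^sup>2 \<partial>M)" by simp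
    then show ?thesis using sq_diff[OF that] by simp
  qed
  have sq: "(\<integral>x. (E m x - E n x)\<^sup>2 \<partial>M) = \<bar>a m - a n\<bar>" for m n
  proof -
    have "sets (H m) \<subseteq> sets (H n) \<or> sets (H n) \<subseteq> sets (H m)" using nested nat_le_linear by blast
    then show ?thesis
      using sq_diff[of m n] sq_diff[of n m] a_mono[of m n] a_mono[of n m] by (auto simp: power2_commute)
  qed
  have "monoseq a"
    using nested
  proof
    assume "\<forall>m n. m \<le> n \<longrightarrow> sets (H m) \<subseteq> sets (H n)"
    then have "\<forall>m n. m \<le> n \<longrightarrow> a m \<le> a n" using a_mono by simp
    then show ?thesis by (simp add: monoseq_def)
  next
    assume "\<forall>m n. m \<le> n \<longrightarrow> sets (H n) \<subseteq> sets (H m)"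
    then have "\<forall>m n. m \<le> n \<longrightarrow> a n \<le> a m" using a_mono by simp
    then show ?thesis by (simp add: monoseq_def)
  qed
  moreover have "\<bar>a n\<bar> \<le> c\<^sup>2" for n
  proof -
    have "a n \<le> (\<integral>x. c\<^sup>2 \<partial>M)" unfolding a_def
      using E_bound[of n] by (intro integral_mono_AE sq_int[OF E_meas E_bound] integrable_const)
        (auto elim!: eventually_mono simp: abs_le_square_iff[symmetric])
    moreover have "0 \<le> a n" unfolding a_def by simp
    ultimately show ?thesis by (simp add: prob_space)
  qed
  then have "Bseq a" by (intro BseqI'[of _ "c\<^sup>2"]) simp
  ultimately have "Cauchy a" using Bseq_monoseq_convergent convergent_Cauchy by blast
  then obtain r :: "nat \<Rightarrow> nat" where r: "strict_mono r"
    "\<And>k m n. r k \<le> m \<Longrightarrow> r k \<le> n \<Longrightarrow> \<bar>a m - a n\<bar> < (1/4) ^ k"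
    using Cauchy_fast_subseq[of a "\<lambda>k. (1/4) ^ k"] by auto
  have "(\<integral>x. \<bar>E (r (Suc k)) x - E (r k) x\<bar> \<partial>M) \<le> 2 * (1/2) ^ k" for k
  proof -
    let ?d = "\<lambda>x. E (r (Suc k)) x - E (r k) x"
    have sqd: "integrable M (\<lambda>x. (?d x)\<^sup>2)" by (rule sq_int[OF _ diff_bound[OF E_bound E_bound]]) simp
    \<comment> \<open>The weights are balanced so that a second moment below
      \<open>(1/4) ^ k\<close> costs \<open>(1/2) ^ k\<close> again, which is summable.\<close>
    have pt: "\<bar>y\<bar> \<le> (1/2) ^ k + 2 ^ k * y\<^sup>2" for y :: real
    proof (cases "\<bar>y\<bar> \<le> (1/2) ^ k")
      case True
      then show ?thesis by (simp add: add_increasing2)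
    next
      case False
      then have "1 \<le> 2 ^ k * \<bar>y\<bar>" by (simp add: power_one_over field_simps)
      then have "\<bar>y\<bar> * 1 \<le> \<bar>y\<bar> * (2 ^ k * \<bar>y\<bar>)" by (intro mult_left_mono) auto
      then have "\<bar>y\<bar> \<le> 2 ^ k * y\<^sup>2" by (simp add: power2_eq_square algebra_simps abs_mult_self_eq)
      moreover have "0 \<le> (1/2 :: real) ^ k" by simp
      ultimately show ?thesis by linarith
    qed
    have "(\<integral>x. \<bar>?d x\<bar> \<partial>M) \<le> (\<integral>x. (1/2) ^ k + 2 ^ k * (?d x)\<^sup>2 \<partial>M)"
      using sqd E_int pt by (intro integral_mono) auto
    also have "\<dots> = (1/2) ^ k + 2 ^ k * \<bar>a (r (Suc k)) - a (r k)\<bar>"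
      using sqd sq[of "r (Suc k)" "r k"] by (simp add: prob_space)
    also have "\<dots> \<le> (1/2) ^ k + 2 ^ k * (1/4) ^ k"
      using r(2)[of k "r (Suc k)" "r k"] strict_mono_leD[OF r(1), of k "Suc k"]
      by (intro add_left_mono mult_left_mono) auto
    also have "(2::real) ^ k * (1/4) ^ k = (1/2) ^ k" by (simp flip: power_mult_distrib)
    finally show ?thesis by simp
  qed
  note L1_le = this
  have "summable (\<lambda>k. 2 * (1/2 :: real) ^ k)" by (intro summable_mult summable_geometric) simp
  then have "summable (\<lambda>k. \<integral>x. \<bar>E (r (Suc k)) x - E (r k) x\<bar> \<partial>M)"
    by (rule summable_comparison_test') (simp add: L1_le)
  then have AE_conv: "AE x in M. convergent (\<lambda>k. E (r k) x)"
    by (rule AE_convergent_if_summable_L1[OF E_int])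
  \<comment> \<open>The pointwise \<open>lim\<close> is taken without correction on a null set, so
    \<open>h\<close> depends only on a tail of the sequence and inherits its measurability.\<close>
  define h where "h x = lim (\<lambda>k. E (r k) x)" for x
  have h_meas [measurable]: "h \<in> borel_measurable M" unfolding h_def[abs_def] by measurable
  have lim: "AE x in M. (\<lambda>k. E (r k) x) \<longlonglongrightarrow> h x"
    using AE_conv unfolding h_def by eventually_elim (simp add: convergent_LIMSEQ_iff)
  have "AE x in M. \<forall>k. \<bar>E (r k) x\<bar> \<le> c" using E_bound by (simp add: AE_all_countable)
  with lim have h_bound: "AE x in M. \<bar>h x\<bar> \<le> c"
  proof eventually_elim
    case (elim x)
    then show ?case using LIMSEQ_le_const2[OF tendsto_rabs[OF elim(1)], of c] by blast
  qed
  define D where "D n = (\<integral>x. (E n x - h x)\<^sup>2 \<partial>M)" for n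
  have D_int: "integrable M (\<lambda>x. (E n x - h x)\<^sup>2)" for n
    by (rule sq_int[OF _ diff_bound[OF E_bound h_bound]]) simp
  have "(\<lambda>k. D (r k)) \<longlonglongrightarrow> (\<integral>x. 0 \<partial>M)" unfolding D_def
  proof (rule integral_dominated_convergence[where w = "\<lambda>_. (2 * c)\<^sup>2"])
    show "AE x in M. (\<lambda>k. (E (r k) x - h x)\<^sup>2) \<longlonglongrightarrow> 0"
      using lim
    proof eventually_elim
      case (elim x)
      then have "(\<lambda>k. (E (r k) x - h x)\<^sup>2) \<longlonglongrightarrow> (h x - h x)\<^sup>2" by (intro tendsto_intros)
      then show ?case by simp
    qed
    show "AE x in M. norm ((E (r k) x - h x)\<^sup>2) \<le> (2 * c)\<^sup>2" for k
      using diff_bound[OF E_bound[of "r k"] h_bound]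
    proof eventually_elim
      case (elim x)
      then have "\<bar>E (r k) x - h x\<bar>\<^sup>2 \<le> (2 * c)\<^sup>2" by (intro power_mono) auto
      then show ?case by simp
    qed
  qed simp_all
  then have "(\<lambda>k. 2 * (1/4) ^ k + 2 * D (r k)) \<longlonglongrightarrow> 2 * 0 + 2 * 0"
    by (intro tendsto_intros LIMSEQ_realpow_zero) auto
  then have bound0: "(\<lambda>k. 2 * (1/4) ^ k + 2 * D (r k)) \<longlonglongrightarrow> 0" by simp
  \<comment> \<open>From the subsequence to all \<open>n\<close>: the distance from
    \<open>E n\<close> to \<open>E (r k)\<close> is read off from the Cauchy sequence
    \<open>a\<close>.\<close>
  have D_le: "D n \<le> 2 * (1/4) ^ k + 2 * D (r k)" if "r k \<le> n" for k n
  proof -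
    have i1: "integrable M (\<lambda>x. (E n x - E (r k) x)\<^sup>2)" by (rule sq_int[OF _ diff_bound[OF E_bound E_bound]]) simp
    have pt: "(u - w)\<^sup>2 \<le> 2 * (u - v)\<^sup>2 + 2 * (v - w)\<^sup>2" for u v w :: real
      using zero_le_power2[of "(u - v) - (v - w)"] by (simp add: power2_eq_square algebra_simps)
    have "D n \<le> (\<integral>x. 2 * (E n x - E (r k) x)\<^sup>2 + 2 * (E (r k) x - h x)\<^sup>2 \<partial>M)"
      unfolding D_def using i1 D_int pt by (intro integral_mono) auto
    also have "\<dots> = 2 * \<bar>a n - a (r k)\<bar> + 2 * D (r k)"
      using i1 D_int sq[of n "r k"] by (simp add: D_def)
    finally show ?thesis using r(2)[of k n "r k"] that by simp
  qed
  have D_nonneg: "0 \<le> D n" for n unfolding D_def by simp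
  have D0: "D \<longlonglongrightarrow> 0"
  proof (rule LIMSEQ_I)
    fix e :: real assume "0 < e"
    then have "\<forall>\<^sub>F k in sequentially. 2 * (1/4) ^ k + 2 * D (r k) < e"
      using order_tendstoD(2)[OF bound0] by blast
    then obtain k where "2 * (1/4) ^ k + 2 * D (r k) < e" by (auto simp: eventually_sequentially)
    then show "\<exists>N. \<forall>n \<ge> N. norm (D n - 0) < e"
      using D_le[of k] D_nonneg by (intro exI[of _ "r k"]) (fastforce intro: order.strict_trans1)
  qed
  have moments: "(\<lambda>n. moment M p (\<lambda>x. E n x - h x)) \<longlonglongrightarrow> 0" if p: "1 \<le> p" for p
  proof (rule LIMSEQ_I)
    fix e :: real assume e: "0 < e"
    \<comment> \<open>Half of \<open>e\<close> pays for the points where the difference is at most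
      \<open>\<delta>\<close>; \<open>D n\<close> pays for the others.\<close>
    define \<delta> where "\<delta> = min 1 (e / 2)"
    have d: "0 < \<delta>" "\<delta> \<le> 1" "\<delta> \<le> e / 2" using e by (auto simp: \<delta>_def)
    let ?C = "(2 * c) powr p / \<delta>\<^sup>2"
    have le: "moment M p (\<lambda>x. E n x - h x) \<le> \<delta> + ?C * D n" for n
    proof -
      have "AE x in M. \<bar>E n x - h x\<bar> powr p \<le> \<delta> + ?C * (E n x - h x)\<^sup>2"
        using diff_bound[OF E_bound[of n] h_bound] by eventually_elim (rule powr_le_square_bound[OF p d(1,2)])
      moreover have "(\<lambda>x. E n x - h x) \<in> Lp M p"
        by (rule Lp_bounded[OF p _ diff_bound[OF E_bound[of n] h_bound]]) simp
      ultimately have "moment M p (\<lambda>x. E n x - h x) \<le> (\<integral>x. \<delta> + ?C * (E n x - h x)\<^sup>2 \<partial>M)"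
        unfolding moment_def using D_int by (intro integral_mono_AE) (auto simp: Lp_def)
      also have "\<dots> = \<delta> + ?C * D n" using D_int by (simp add: D_def prob_space)
      finally show ?thesis .
    qed
    have "(\<lambda>n. ?C * D n) \<longlonglongrightarrow> ?C * 0" by (intro tendsto_intros D0)
    then have "\<forall>\<^sub>F n in sequentially. ?C * D n < e / 2"
      by (rule order_tendstoD(2)) (use e in simp)
    then obtain N where "\<And>n. n \<ge> N \<Longrightarrow> ?C * D n < e / 2" by (auto simp: eventually_sequentially)
    then show "\<exists>N. \<forall>n \<ge> N. norm (moment M p (\<lambda>x. E n x - h x) - 0) < e"
      using le d(3) by (intro exI[of _ N]) (smt (verit) moment_nonneg real_norm_def field_sum_of_halves)
  qed
  have h_meas_G: "h \<in> borel_measurable G" if G: "space G = space M" "\<forall>n \<ge> j. sets (H n) \<subseteq> sets G" for G j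
  proof -
    have "(\<lambda>k. E (r k) x) \<longlonglongrightarrow> l \<longleftrightarrow> (\<lambda>k. E (r (k + j)) x) \<longlonglongrightarrow> l" for x l
      using LIMSEQ_ignore_initial_segment[of "\<lambda>k. E (r k) x" l j] LIMSEQ_offset[of "\<lambda>k. E (r k) x" j l] by blast
    then have h_eq: "h = (\<lambda>x. lim (\<lambda>k. E (r (k + j)) x))" by (simp add: fun_eq_iff h_def lim_def)
    have "E (r (k + j)) \<in> borel_measurable G" for k
    proof -
      have "k + j \<le> r (k + j)" by (rule strict_mono_imp_increasing[OF r(1)])
      then have "sets (H (r (k + j))) \<subseteq> sets G" using G(2) by simp
      moreover have "space (H (r (k + j))) = space M" using H[of "r (k + j)"] by (simp add: subalgebra_def)
      ultimately have "subalgebra G (H (r (k + j)))" using G(1) by (simp add: subalgebra_def)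
      then show ?thesis unfolding E_def by (rule measurable_from_subalg[OF _ borel_measurable_cond_exp])
    qed
    then show ?thesis unfolding h_eq by (rule borel_measurable_lim_metric)
  qed
  with h_meas h_bound moments show ?thesis unfolding E_def by blast
qed

lemma set_integral_LIMSEQ:
  fixes X :: "nat \<Rightarrow> 'a \<Rightarrow> real"
  assumes A: "A \<in> sets M" and int: "\<And>n. integrable M (X n)" "integrable M h"
    and lim: "(\<lambda>n. moment M 1 (\<lambda>x. X n x - h x)) \<longlonglongrightarrow> 0"
  shows "(\<lambda>n. \<integral>x \<in> A. X n x \<partial>M) \<longlonglongrightarrow> (\<integral>x \<in> A. h x \<partial>M)"
proof (rule LIM_zero_cancel, rule Lim_null_comparison[OF _ lim], rule always_eventually, rule allI)
  fix n
  have i: "integrable M (\<lambda>x. indicator A x * u x)" if "integrable M u" for u :: "'a \<Rightarrow> real"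
    using integrable_mult_indicator[OF A that] by simp
  have "\<bar>(\<integral>x \<in> A. X n x \<partial>M) - (\<integral>x \<in> A. h x \<partial>M)\<bar> = \<bar>\<integral>x. indicator A x * (X n x - h x) \<partial>M\<bar>"
    using i int by (simp add: set_lebesgue_integral_def right_diff_distrib)
  also have "\<dots> \<le> (\<integral>x. \<bar>indicator A x * (X n x - h x)\<bar> \<partial>M)" by (rule integral_abs_bound)
  also have "\<dots> \<le> moment M 1 (\<lambda>x. X n x - h x)"
    unfolding moment_def using int i[OF Bochner_Integration.integrable_diff[OF int(1)[of n] int(2)]]
    by (intro integral_mono) (auto simp: indicator_def)
  finally show "norm ((\<integral>x \<in> A. X n x \<partial>M) - (\<integral>x \<in> A. h x \<partial>M)) \<le> moment M 1 (\<lambda>x. X n x - h x)" by simp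
qed

text \<open>The limit is identified on the generating system \<open>P\<close>: a member lies in some
  \<open>H m\<close>, so the integrals over it are constant from \<open>m\<close> on.\<close>

lemma bounded_increasing_martingale:
  assumes H: "\<And>n. subalgebra M (H n)" "\<And>m n. m \<le> n \<Longrightarrow> sets (H m) \<subseteq> sets (H n)"
    and G: "subalgebra M G" "\<And>n::nat. sets (H n) \<subseteq> sets G"
    and P: "Int_stable P" "space M \<in> P" "\<And>A. A \<in> P \<Longrightarrow> \<exists>n. A \<in> sets (H n)" "sets G = sigma_sets (space M) P"
    and f: "f \<in> borel_measurable M" "\<And>x. \<bar>f x\<bar> \<le> c" and p: "1 \<le> p"
  shows "(\<lambda>n. moment M p (\<lambda>x. real_cond_exp M (H n) f x - real_cond_exp M G f x)) \<longlonglongrightarrow> 0"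
proof -
  interpret G: sigma_finite_subalgebra M G by (rule sigma_finite_subalgebraI[OF G(1)])
  obtain h where h: "h \<in> borel_measurable M" "AE x in M. \<bar>h x\<bar> \<le> c"
    and hG: "\<forall>G j. space G = space M \<longrightarrow> (\<forall>n \<ge> j. sets (H n) \<subseteq> sets G) \<longrightarrow> h \<in> borel_measurable G"
    and lim: "\<forall>p \<ge> 1. (\<lambda>n. moment M p (\<lambda>x. real_cond_exp M (H n) f x - h x)) \<longlonglongrightarrow> 0"
    using bounded_martingale_converges[of H, OF H(1) _ f] H(2) by auto
  have int: "integrable M f" "integrable M h"
    using f h by (auto intro!: integrable_const_bound[where B = c])
  have hG: "h \<in> borel_measurable G" using hG G by (simp add: subalgebra_def)
  have "AE x in M. real_cond_exp M G f x = h x"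
  proof (rule G.real_cond_exp_charact[OF _ int hG])
    fix A assume A: "A \<in> sets G"
    show "(\<integral>x \<in> A. f x \<partial>M) = (\<integral>x \<in> A. h x \<partial>M)"
    proof (rule set_integral_eq_on_sigma_sets[OF P(1) _ P(2) int])
      show "P \<subseteq> sets M" using P(3) H(1) by (fastforce simp: subalgebra_def)
      show "A \<in> sigma_sets (space M) P" using A P(4) by simp
      fix B assume "B \<in> P"
      then obtain m where m: "B \<in> sets (H m)" using P(3) by auto
      then have "B \<in> sets M" using H(1) by (auto simp: subalgebra_def)
      then have "(\<lambda>n. \<integral>x \<in> B. real_cond_exp M (H n) f x \<partial>M) \<longlonglongrightarrow> (\<integral>x \<in> B. h x \<partial>M)"
        using lim by (intro set_integral_LIMSEQ int integrable_cond_exp H) auto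
      moreover have "(\<integral>x \<in> B. real_cond_exp M (H n) f x \<partial>M) = (\<integral>x \<in> B. f x \<partial>M)" if "m \<le> n" for n
        using m H(2)[OF that]
        by (intro sigma_finite_subalgebra.real_cond_exp_intA[OF sigma_finite_subalgebraI[OF H(1)] int(1), symmetric]) auto
      then have "(\<lambda>n. \<integral>x \<in> B. real_cond_exp M (H n) f x \<partial>M) \<longlonglongrightarrow> (\<integral>x \<in> B. f x \<partial>M)"
        by (intro tendsto_eventually eventually_sequentiallyI[of m])
      ultimately show "(\<integral>x \<in> B. f x \<partial>M) = (\<integral>x \<in> B. h x \<partial>M)"
        using LIMSEQ_unique by blast
    qed
  qed
  then have "moment M p (\<lambda>x. real_cond_exp M (H n) f x - real_cond_exp M G f x)
      = moment M p (\<lambda>x. real_cond_exp M (H n) f x - h x)" for n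
    using h by (intro moment_cong) auto
  then show ?thesis using lim p by simp
qed

text \<open>A set of the intersection lies in every \<open>H n\<close>, so the integrals over it do
  not change at all. The limit is measurable for each \<open>H m\<close> because initial segments do
  not matter.\<close>

lemma bounded_decreasing_martingale:
  assumes H: "\<And>n. subalgebra M (H n)" "\<And>m n. m \<le> n \<Longrightarrow> sets (H n) \<subseteq> sets (H m)"
    and G: "subalgebra M G" "sets G = (\<Inter>n::nat. sets (H n))"
    and f: "f \<in> borel_measurable M" "\<And>x. \<bar>f x\<bar> \<le> c" and p: "1 \<le> p"
  shows "(\<lambda>n. moment M p (\<lambda>x. real_cond_exp M (H n) f x - real_cond_exp M G f x)) \<longlonglongrightarrow> 0"
proof -
  interpret G: sigma_finite_subalgebra M G by (rule sigma_finite_subalgebraI[OF G(1)])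
  obtain h where h: "h \<in> borel_measurable M" "AE x in M. \<bar>h x\<bar> \<le> c"
    and hG: "\<forall>G j. space G = space M \<longrightarrow> (\<forall>n \<ge> j. sets (H n) \<subseteq> sets G) \<longrightarrow> h \<in> borel_measurable G"
    and lim: "\<forall>p \<ge> 1. (\<lambda>n. moment M p (\<lambda>x. real_cond_exp M (H n) f x - h x)) \<longlonglongrightarrow> 0"
    using bounded_martingale_converges[of H, OF H(1) _ f] H(2) by auto
  have int: "integrable M f" "integrable M h"
    using f h by (auto intro!: integrable_const_bound[where B = c])
  have sp: "space (H n) = space M" for n using H(1) by (simp add: subalgebra_def)
  have hH: "h \<in> borel_measurable (H m)" for m using hG sp[of m] H(2)[of m] by blast
  have hG: "h \<in> borel_measurable G"
  proof (rule measurableI)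
    fix B :: "real set" assume "B \<in> sets borel"
    then have "h -` B \<inter> space M \<in> sets (H m)" for m using measurable_sets[OF hH[of m]] sp by simp
    then show "h -` B \<inter> space G \<in> sets G" using G by (simp add: subalgebra_def)
  qed simp
  have "AE x in M. real_cond_exp M G f x = h x"
  proof (rule G.real_cond_exp_charact[OF _ int hG])
    fix B assume "B \<in> sets G"
    then have B: "B \<in> sets (H n)" for n using G(2) by simp
    then have "B \<in> sets M" using H(1) by (auto simp: subalgebra_def)
    then have "(\<lambda>n. \<integral>x \<in> B. real_cond_exp M (H n) f x \<partial>M) \<longlonglongrightarrow> (\<integral>x \<in> B. h x \<partial>M)"
      using lim by (intro set_integral_LIMSEQ int integrable_cond_exp H) auto
    moreover have "(\<integral>x \<in> B. real_cond_exp M (H n) f x \<partial>M) = (\<integral>x \<in> B. f x \<partial>M)" for n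
      by (rule sigma_finite_subalgebra.real_cond_exp_intA[OF sigma_finite_subalgebraI[OF H(1)] int(1) B, symmetric])
    ultimately show "(\<integral>x \<in> B. f x \<partial>M) = (\<integral>x \<in> B. h x \<partial>M)"
      by (simp add: LIMSEQ_const_iff)
  qed
  then have "moment M p (\<lambda>x. real_cond_exp M (H n) f x - real_cond_exp M G f x)
      = moment M p (\<lambda>x. real_cond_exp M (H n) f x - h x)" for n
    using h by (intro moment_cong) auto
  then show ?thesis using lim p by simp
qed

definition trunc :: "nat \<Rightarrow> ('a \<Rightarrow> real) \<Rightarrow> 'a \<Rightarrow> real" where
  "trunc m f x = max (- real m) (min (real m) (f x))"

lemma moment_diff_trunc_tendsto_0:
  assumes p: "1 \<le> p" and f: "f \<in> Lp M p"
  shows "(\<lambda>m. moment M p (\<lambda>x. f x - trunc m f x)) \<longlonglongrightarrow> 0"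
proof -
  have [measurable]: "f \<in> borel_measurable M" using f by (simp add: Lp_def)
  have "(\<lambda>m. \<integral>x. \<bar>f x - trunc m f x\<bar> powr p \<partial>M) \<longlonglongrightarrow> (\<integral>x. 0 \<partial>M)"
  proof (rule integral_dominated_convergence[where w = "\<lambda>x. \<bar>f x\<bar> powr p"])
    show "AE x in M. (\<lambda>m. \<bar>f x - trunc m f x\<bar> powr p) \<longlonglongrightarrow> 0"
    proof (rule AE_I2)
      fix x
      obtain N :: nat where "\<bar>f x\<bar> \<le> real N" using real_arch_simple by blast
      then show "(\<lambda>m. \<bar>f x - trunc m f x\<bar> powr p) \<longlonglongrightarrow> 0"
        by (intro tendsto_eventually eventually_sequentiallyI[of N]) (auto simp: trunc_def)
    qed
    show "AE x in M. norm (\<bar>f x - trunc m f x\<bar> powr p) \<le> \<bar>f x\<bar> powr p" for m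
      using p by (auto intro!: AE_I2 powr_mono2 simp: trunc_def)
  qed (use f in \<open>auto simp: Lp_def trunc_def\<close>)
  then show ?thesis by (simp add: moment_def)
qed

text \<open>Density of bounded functions; the truncation error is controlled uniformly in
  \<open>n\<close>, as conditional expectation does not increase the moment.\<close>

lemma martingale_converges_if_bounded:
  assumes H: "\<And>n::nat. subalgebra M (H n)" and G: "subalgebra M G" and p: "1 \<le> p"
    and bounded: "\<And>f c. f \<in> borel_measurable M \<Longrightarrow> (\<And>x. \<bar>f x\<bar> \<le> c) \<Longrightarrow>
      (\<lambda>n. moment M p (\<lambda>x. real_cond_exp M (H n) f x - real_cond_exp M G f x)) \<longlonglongrightarrow> 0"
    and f: "f \<in> Lp M p"
  shows "(\<lambda>n. moment M p (\<lambda>x. real_cond_exp M (H n) f x - real_cond_exp M G f x)) \<longlonglongrightarrow> 0"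
proof (rule LIMSEQ_I)
  define K where "K = (2::real) powr p"
  have K: "0 < K" by (simp add: K_def)
  have f_meas [measurable]: "f \<in> borel_measurable M" using f by (simp add: Lp_def)
  fix e :: real assume e: "0 < e"
  \<comment> \<open>The quasi-triangle inequality is applied twice, so the two truncation errors
    carry the factors \<open>K\<close> and \<open>K * K\<close>; together they amount to
    \<open>e / 2\<close>.\<close>
  define d where "d = e / (2 * (K + K * K))"
  have d: "0 < d" using e K by (simp add: d_def add_pos_pos)
  then have "\<forall>\<^sub>F m in sequentially. moment M p (\<lambda>x. f x - trunc m f x) < d"
    using moment_diff_trunc_tendsto_0[OF p f] order_tendstoD(2) by blast
  then obtain m where m: "moment M p (\<lambda>x. f x - trunc m f x) < d" by (auto simp: eventually_sequentially)
  let ?t = "trunc m f" and ?u = "\<lambda>x. f x - trunc m f x"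
  have t_meas [measurable]: "?t \<in> borel_measurable M" unfolding trunc_def[abs_def] by measurable
  have t_bound: "\<bar>?t x\<bar> \<le> real m" for x by (auto simp: trunc_def)
  have t: "?t \<in> Lp M p" using t_bound by (intro Lp_bounded[OF p, where c = "real m"]) auto
  have u: "?u \<in> Lp M p" by (rule Lp_diff_fun[OF p f t])
  have split: "AE x in M. real_cond_exp M A f x = real_cond_exp M A ?u x + real_cond_exp M A ?t x"
    if A: "subalgebra M A" for A
  proof -
    interpret A: sigma_finite_subalgebra M A by (rule sigma_finite_subalgebraI[OF A])
    show ?thesis
      using A.real_cond_exp_add[OF Lp_integrable[OF p u] Lp_integrable[OF p t]] by simp
  qed
  have le: "moment M p (\<lambda>x. real_cond_exp M (H n) f x - real_cond_exp M G f x)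
      \<le> (K + K * K) * d + K * K * moment M p (\<lambda>x. real_cond_exp M (H n) ?t x - real_cond_exp M G ?t x)" for n
  proof -
    let ?a = "real_cond_exp M (H n) ?u" and ?b = "\<lambda>x. real_cond_exp M (H n) ?t x - real_cond_exp M G ?t x"
      and ?c = "real_cond_exp M G ?u"
    have a: "?a \<in> Lp M p" "moment M p ?a \<le> d" using Lp_cond_exp[OF p H u, of n] m by auto
    have c: "?c \<in> Lp M p" "moment M p ?c \<le> d" using Lp_cond_exp[OF p G u] m by auto
    have b: "?b \<in> Lp M p" by (intro Lp_diff_fun p Lp_cond_exp(1) H G t)
    have bc: "(\<lambda>x. ?b x - ?c x) \<in> Lp M p" by (rule Lp_diff_fun[OF p b c(1)])
    have "moment M p (\<lambda>x. ?b x - ?c x) \<le> K * (moment M p ?b + moment M p ?c)"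
      using moment_add[OF p b Lp_uminus[OF c(1)]] by (simp add: K_def moment_uminus)
    also have "\<dots> \<le> K * (moment M p ?b + d)" using c K by (intro mult_left_mono add_left_mono) auto
    finally have mbc: "moment M p (\<lambda>x. ?b x - ?c x) \<le> K * (moment M p ?b + d)" .
    have "moment M p (\<lambda>x. real_cond_exp M (H n) f x - real_cond_exp M G f x) = moment M p (\<lambda>x. ?a x + (?b x - ?c x))"
    proof (rule moment_cong)
      show "AE x in M. real_cond_exp M (H n) f x - real_cond_exp M G f x = ?a x + (?b x - ?c x)"
        using split[OF H[of n]] split[OF G] by eventually_elim simp
    qed auto
    also have "\<dots> \<le> K * (moment M p ?a + moment M p (\<lambda>x. ?b x - ?c x))"
      using moment_add[OF p a(1) bc] by (simp add: K_def)
    also have "\<dots> \<le> K * (d + K * (moment M p ?b + d))"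
      using a mbc K by (intro mult_left_mono add_mono) auto
    finally show ?thesis by (simp add: algebra_simps)
  qed
  have "(\<lambda>n. K * K * moment M p (\<lambda>x. real_cond_exp M (H n) ?t x - real_cond_exp M G ?t x)) \<longlonglongrightarrow> K * K * 0"
    by (intro tendsto_intros bounded[OF t_meas t_bound])
  then have "\<forall>\<^sub>F n in sequentially. K * K * moment M p (\<lambda>x. real_cond_exp M (H n) ?t x - real_cond_exp M G ?t x) < e / 2"
    by (rule order_tendstoD(2)) (use e in simp)
  then obtain N where N: "\<And>n. N \<le> n \<Longrightarrow>
      K * K * moment M p (\<lambda>x. real_cond_exp M (H n) ?t x - real_cond_exp M G ?t x) < e / 2"
    by (auto simp: eventually_sequentially)
  have Kd: "(K + K * K) * d = e / 2"
  proof -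
    have "K + K * K \<noteq> 0" using K add_pos_pos[OF K mult_pos_pos[OF K K]] by linarith
    then show ?thesis unfolding d_def by (simp add: field_simps)
  qed
  have "norm (moment M p (\<lambda>x. real_cond_exp M (H n) f x - real_cond_exp M G f x) - 0) < e" if "N \<le> n" for n
    using le[of n] N[OF that] Kd by simp
  then show "\<exists>N. \<forall>n \<ge> N. norm (moment M p (\<lambda>x. real_cond_exp M (H n) f x - real_cond_exp M G f x) - 0) < e"
    by blast
qed

end

subsection \<open>Classes of \<open>p\<close>-integrable functions\<close>

text \<open>Allows \<open>gen {..j}\<close> to replace \<open>F j\<close>: the two have the same
  sets but need not be equal as measures.\<close>

lemma real_cond_exp_sets_cong:
  "sets G = sets H \<Longrightarrow> space G = space H \<Longrightarrow> real_cond_exp M G f = real_cond_exp M H f"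
  by (simp add: real_cond_exp_def nn_cond_exp_def restr_to_subalg_def subalgebra_def)

text \<open>Turns measurability up to null sets into a fixed-point equation, a form that makes sense
  for classes.\<close>

lemma (in prob_space) ae_measurable_iff:
  assumes G: "subalgebra M G" and f: "integrable M f"
  shows "ae_measurable M G f \<longleftrightarrow> (AE x in M. real_cond_exp M G f x = f x)"
proof
  interpret G: sigma_finite_subalgebra M G by (rule sigma_finite_subalgebraI[OF G])
  assume "ae_measurable M G f"
  then obtain h where h: "h \<in> borel_measurable G" "AE x in M. f x = h x" by (auto simp: ae_measurable_def)
  have [measurable]: "h \<in> borel_measurable M" "f \<in> borel_measurable M" using h(1) measurable_from_subalg[OF G] f by auto
  have "integrable M h" using f h(2) integrable_cong_AE[of f M h] by simp
  then have "AE x in M. real_cond_exp M G h x = h x" using h(1) by (rule G.real_cond_exp_F_meas)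
  moreover have "AE x in M. real_cond_exp M G f x = real_cond_exp M G h x"
    by (rule G.real_cond_exp_cong[OF h(2)]) simp_all
  ultimately show "AE x in M. real_cond_exp M G f x = f x" using h(2) by eventually_elim simp
next
  assume a: "AE x in M. real_cond_exp M G f x = f x"
  then have "AE x in M. f x = real_cond_exp M G f x" by eventually_elim simp
  moreover have "real_cond_exp M G f \<in> borel_measurable G" by simp
  ultimately show "ae_measurable M G f" unfolding ae_measurable_def by blast
qed

section \<open>The group of classes of functions\<close>

locale Lp_filtration = action_filtration M T F
  for M :: "'a measure" and T :: "('n::finite \<Rightarrow> int) \<Rightarrow> 'a \<Rightarrow> 'a" and F :: "('n \<Rightarrow> int) \<Rightarrow> 'a measure" +
  fixes p :: real
  assumes p: "1 \<le> p"
begin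

text \<open>
  An element of \<open>L\<^sup>p\<close> modulo null functions is represented by its indefinite integral, so that
  almost everywhere identities become identities in the group of set functions.
\<close>

definition cls :: "('a \<Rightarrow> real) \<Rightarrow> 'a set \<Rightarrow> real" where
  "cls f = (\<lambda>A. if A \<in> sets M then \<integral>x \<in> A. f x \<partial>M else 0)"

definition LpV :: "('a set \<Rightarrow> real) set" where
  "LpV = cls ` Lp M p"

definition rep :: "('a set \<Rightarrow> real) \<Rightarrow> 'a \<Rightarrow> real" where
  "rep v = (SOME f. f \<in> Lp M p \<and> cls f = v)"

definition LpN :: "('a set \<Rightarrow> real) \<Rightarrow> real" where
  "LpN v = moment M p (rep v)"

lemmas int_Lp = Lp_integrable[OF p]
lemmas add_Lp = Lp_add[OF p]
lemmas diff_Lp = Lp_diff_fun[OF p]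

lemma cls_cong: "AE x in M. f x = g x \<Longrightarrow> f \<in> Lp M p \<Longrightarrow> g \<in> Lp M p \<Longrightarrow> cls f = cls g"
  unfolding cls_def by (auto simp: fun_eq_iff Lp_measurable intro!: set_lebesgue_integral_cong_AE elim: eventually_mono)

text \<open>Conditioning on \<open>M\<close> itself shows that integrals over all measurable sets
  determine a function almost everywhere.\<close>

lemma cls_eq_iff:
  assumes f: "f \<in> Lp M p" and g: "g \<in> Lp M p"
  shows "cls f = cls g \<longleftrightarrow> (AE x in M. f x = g x)"
proof
  assume eq: "cls f = cls g"
  have sub: "subalgebra M M" by (simp add: subalgebra_def)
  interpret S: sigma_finite_subalgebra M M by (rule sigma_finite_subalgebraI[OF sub])
  have "(\<integral>x \<in> A. f x \<partial>M) = (\<integral>x \<in> A. g x \<partial>M)" if "A \<in> sets M" for A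
    using fun_cong[OF eq, of A] that by (simp add: cls_def)
  then have "AE x in M. real_cond_exp M M f x = g x"
    by (rule S.real_cond_exp_charact) (use f g int_Lp Lp_measurable in auto)
  moreover have "AE x in M. real_cond_exp M M f x = f x"
    by (rule S.real_cond_exp_F_meas[OF int_Lp[OF f] Lp_measurable[OF f]])
  ultimately show "AE x in M. f x = g x" by eventually_elim simp
qed (rule cls_cong[OF _ f g])

lemma set_integrable_Lp: "f \<in> Lp M p \<Longrightarrow> A \<in> sets M \<Longrightarrow> set_integrable M A f"
  unfolding set_integrable_def by (intro integrable_mult_indicator int_Lp)

lemma cls_add: "f \<in> Lp M p \<Longrightarrow> g \<in> Lp M p \<Longrightarrow> cls (\<lambda>x. f x + g x) = cls f + cls g"
  by (auto simp: cls_def fun_eq_iff set_integral_add(2) set_integrable_Lp)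

lemma cls_diff: "f \<in> Lp M p \<Longrightarrow> g \<in> Lp M p \<Longrightarrow> cls (\<lambda>x. f x - g x) = cls f - cls g"
  by (auto simp: cls_def fun_eq_iff set_integral_diff(2) set_integrable_Lp)

lemma cls_zero: "cls (\<lambda>x. 0) = 0"
  by (auto simp: cls_def fun_eq_iff set_lebesgue_integral_def)

lemma cls_uminus: "f \<in> Lp M p \<Longrightarrow> cls (\<lambda>x. - f x) = - cls f"
  using cls_diff[OF Lp_zero, of f] by (simp add: cls_zero)

lemma cls_sum: "(\<And>k. k \<in> I \<Longrightarrow> f k \<in> Lp M p) \<Longrightarrow> cls (\<lambda>x. \<Sum>k \<in> I. f k x) = (\<Sum>k \<in> I. cls (f k))"
  by (induction I rule: infinite_finite_induct) (simp_all add: cls_zero cls_add Lp_sum[OF p])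

lemma cls_in_LpV [simp]: "f \<in> Lp M p \<Longrightarrow> cls f \<in> LpV"
  by (simp add: LpV_def)

lemma LpV_cases: assumes "v \<in> LpV" obtains f where "f \<in> Lp M p" "v = cls f"
  using assms by (auto simp: LpV_def)

lemma rep_Lp: "v \<in> LpV \<Longrightarrow> rep v \<in> Lp M p" and cls_rep: "v \<in> LpV \<Longrightarrow> cls (rep v) = v"
  using someI_ex[of "\<lambda>f. f \<in> Lp M p \<and> cls f = v"] unfolding rep_def LpV_def by auto

lemma AE_rep_cls: "f \<in> Lp M p \<Longrightarrow> AE x in M. rep (cls f) x = f x"
  using cls_eq_iff[of "rep (cls f)" f] by (simp add: rep_Lp cls_rep)

lemma LpN_cls: "f \<in> Lp M p \<Longrightarrow> LpN (cls f) = moment M p f"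
  unfolding LpN_def by (intro moment_cong AE_rep_cls Lp_measurable[where p = p] rep_Lp cls_in_LpV)

sublocale quasi_normed_group LpV LpN "2 powr p"
proof
  show "0 \<in> LpV" using cls_in_LpV[OF Lp_zero] by (simp add: cls_zero)
  show "LpN 0 = 0" using LpN_cls[OF Lp_zero] by (simp add: cls_zero moment_def)
  show "0 \<le> (2::real) powr p" by simp
  fix v w assume v: "v \<in> LpV" and w: "w \<in> LpV"
  obtain f where f: "f \<in> Lp M p" "v = cls f" using v by (rule LpV_cases)
  obtain g where g: "g \<in> Lp M p" "w = cls g" using w by (rule LpV_cases)
  show "v + w \<in> LpV" using cls_in_LpV[OF add_Lp[OF f(1) g(1)]] f g by (simp add: cls_add)
  show "LpN (v + w) \<le> 2 powr p * (LpN v + LpN w)"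
    using moment_add[OF p f(1) g(1)] LpN_cls[OF add_Lp[OF f(1) g(1)]] f g by (simp add: cls_add LpN_cls)
next
  fix v assume v: "v \<in> LpV"
  obtain f where f: "f \<in> Lp M p" "v = cls f" using v by (rule LpV_cases)
  show "- v \<in> LpV" using cls_in_LpV[OF Lp_uminus[OF f(1)]] f by (simp add: cls_uminus)
  show "0 \<le> LpN v" using f by (simp add: LpN_cls)
  show "LpN (- v) = LpN v"
    using LpN_cls[OF Lp_uminus[OF f(1)]] f by (simp add: cls_uminus LpN_cls moment_uminus)
  show "v = 0" if "LpN v = 0"
    using that f moment_eq_0_iff[OF f(1)] cls_eq_iff[OF f(1) Lp_zero] by (simp add: LpN_cls cls_zero)
qed

definition lift :: "(('a \<Rightarrow> real) \<Rightarrow> 'a \<Rightarrow> real) \<Rightarrow> ('a set \<Rightarrow> real) \<Rightarrow> 'a set \<Rightarrow> real" where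
  "lift A v = cls (A (rep v))"

text \<open>The last clause makes \<open>lift\<close> independent of the representative; additivity
  is asked for almost everywhere, which is how conditional expectations provide it.\<close>

definition contraction :: "(('a \<Rightarrow> real) \<Rightarrow> 'a \<Rightarrow> real) \<Rightarrow> bool" where
  "contraction A \<longleftrightarrow> (\<forall>f \<in> Lp M p. A f \<in> Lp M p \<and> moment M p (A f) \<le> moment M p f) \<and>
     (\<forall>f \<in> Lp M p. \<forall>g \<in> Lp M p. AE x in M. A (\<lambda>x. f x + g x) x = A f x + A g x) \<and>
     (\<forall>f \<in> Lp M p. \<forall>g \<in> Lp M p. (AE x in M. f x = g x) \<longrightarrow> (AE x in M. A f x = A g x))"

lemma contraction_Lp: "contraction A \<Longrightarrow> f \<in> Lp M p \<Longrightarrow> A f \<in> Lp M p"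
  by (simp add: contraction_def)

lemma lift_cls: assumes A: "contraction A" and f: "f \<in> Lp M p" shows "lift A (cls f) = cls (A f)"
proof -
  have r: "rep (cls f) \<in> Lp M p" using f by (simp add: rep_Lp)
  have "AE x in M. A (rep (cls f)) x = A f x"
    using A r f AE_rep_cls[OF f] unfolding contraction_def by blast
  then show ?thesis unfolding lift_def by (rule cls_cong) (use A r f contraction_Lp in auto)
qed

lemma bop_lift: assumes A: "contraction A" shows "bop (lift A)"
  unfolding bop_def
proof (intro conjI ballI exI[of _ "1::real"])
  fix v w assume v: "v \<in> LpV" and w: "w \<in> LpV"
  obtain f where f: "f \<in> Lp M p" "v = cls f" using v by (rule LpV_cases)
  obtain g where g: "g \<in> Lp M p" "w = cls g" using w by (rule LpV_cases)
  have "AE x in M. A (\<lambda>x. f x + g x) x = A f x + A g x" using A f g by (simp add: contraction_def)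
  then have "cls (A (\<lambda>x. f x + g x)) = cls (\<lambda>x. A f x + A g x)"
    by (rule cls_cong) (auto intro: contraction_Lp[OF A] add_Lp f g)
  then show "lift A (v + w) = lift A v + lift A w"
    using f g lift_cls[OF A add_Lp[OF f(1) g(1)]] by (simp add: cls_add lift_cls[OF A] contraction_Lp[OF A])
next
  fix v assume v: "v \<in> LpV"
  obtain f where f: "f \<in> Lp M p" "v = cls f" using v by (rule LpV_cases)
  show "lift A v \<in> LpV" using f by (simp add: lift_cls[OF A] contraction_Lp[OF A])
  show "LpN (lift A v) \<le> 1 * LpN v"
    using f A by (simp add: lift_cls[OF A] LpN_cls contraction_Lp[OF A]) (simp add: contraction_def)
qed simp

lemma contraction_cond_exp: assumes G: "subalgebra M G" shows "contraction (real_cond_exp M G)"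
proof -
  interpret G: sigma_finite_subalgebra M G by (rule sigma_finite_subalgebraI[OF G])
  show ?thesis
    unfolding contraction_def
  proof (intro conjI ballI impI)
    fix f g assume f: "f \<in> Lp M p" and g: "g \<in> Lp M p"
    show "AE x in M. real_cond_exp M G (\<lambda>x. f x + g x) x = real_cond_exp M G f x + real_cond_exp M G g x"
      by (rule G.real_cond_exp_add[OF int_Lp[OF f] int_Lp[OF g]])
    show "AE x in M. real_cond_exp M G f x = real_cond_exp M G g x" if "AE x in M. f x = g x"
      by (rule G.real_cond_exp_cong[OF that Lp_measurable[OF f] Lp_measurable[OF g]])
  qed (use Lp_cond_exp[OF p G] in auto)
qed

lemma contraction_koop: "contraction (koop T i)"
proof -
  have k: "koop T i f = (\<lambda>x. f (T i x))" for f by (simp add: koop_def comp_def)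
  have "(\<lambda>x. f (T i x)) \<in> Lp M p \<and> moment M p (\<lambda>x. f (T i x)) \<le> moment M p f" if f: "f \<in> Lp M p" for f
  proof -
    have [measurable]: "f \<in> borel_measurable M" using f by (simp add: Lp_def)
    have "integrable M (\<lambda>x. \<bar>f (T i x)\<bar> powr p)"
      using f integrable_T[of "\<lambda>x. \<bar>f x\<bar> powr p" i] by (simp add: Lp_def)
    moreover have "moment M p (\<lambda>x. f (T i x)) = moment M p f"
      unfolding moment_def by (rule integral_T[of "\<lambda>x. \<bar>f x\<bar> powr p"]) simp
    ultimately show ?thesis by (simp add: Lp_def)
  qed
  moreover have "AE x in M. f (T i x) = g (T i x)" if "AE x in M. f x = g x" for f g :: "'a \<Rightarrow> real"
    by (rule AE_T[OF that])
  ultimately show ?thesis unfolding contraction_def k by simp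
qed

lemma moment_koop: assumes f: "f \<in> Lp M p" shows "moment M p (koop T i f) = moment M p f"
proof -
  have [measurable]: "f \<in> borel_measurable M" using f by (rule Lp_measurable)
  have "(\<lambda>x. \<bar>f x\<bar> powr p) \<in> borel_measurable M" by measurable
  then show ?thesis using integral_T[of "\<lambda>x. \<bar>f x\<bar> powr p" i] by (simp add: moment_def koop_def)
qed

lemma koop_koop: "x \<in> space M \<Longrightarrow> koop T i (koop T j f) x = koop T (\<lambda>q. i q + j q) f x"
  using T_add[of x j i] by (simp add: koop_def add.commute)

lemma koop_zero: "x \<in> space M \<Longrightarrow> koop T (\<lambda>_. 0) f x = f x"
  by (simp add: koop_def T_zero)

section \<open>One-coordinate algebras and the operators on classes\<close>

definition coord :: "'n \<Rightarrow> int \<Rightarrow> ('n \<Rightarrow> int) set" where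
  "coord q l = {i. i q \<le> l}"

lemma marginal_gen: "marginal M F q l = gen (coord q l)"
  by (simp add: marginal_def gen_def coord_def)

lemma filtration_sup_gen: "filtration_sup M F = gen UNIV"
  by (simp add: filtration_sup_def gen_def)

lemma box_coord: "box (coord q l)"
  unfolding coord_def by (rule box_le_coord)

lemma shift_coord: "shift (\<lambda>r. k * unit_idx q r) (coord s l) = coord s (if q = s then l + k else l)"
  by (auto simp: shift_def coord_def unit_idx_def)

text \<open>An intersection of sigma-algebras is one already, so \<open>sigma\<close> in
  \<open>marginal_tail\<close> adds no sets.\<close>

lemma sets_marginal_tail: "sets (marginal_tail M F q) = (\<Inter>n. sets (gen (coord q (- int n))))"
  and subalgebra_marginal_tail: "subalgebra M (marginal_tail M F q)"
proof -
  let ?I = "\<Inter>n. sets (gen (coord q (- int n)))"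
  have "?I \<subseteq> sets (gen (coord q (- int 0)))" by blast
  also have "\<dots> \<subseteq> sets M" using subalgebra_gen by (simp add: subalgebra_def)
  finally have I: "?I \<subseteq> sets M" .
  then have Pow: "?I \<subseteq> Pow (space M)" using sets.sets_into_space by blast
  have "sigma_sets (space M) ?I \<subseteq> sets (gen (coord q (- int n)))" for n
    using sets.sigma_sets_subset[of ?I "gen (coord q (- int n))"] by auto
  then have "sigma_sets (space M) ?I = ?I" by auto
  then show s: "sets (marginal_tail M F q) = ?I"
    using Pow by (simp add: marginal_tail_def marginal_gen sets_measure_of)
  show "subalgebra M (marginal_tail M F q)"
    unfolding subalgebra_def s using I Pow by (simp add: marginal_tail_def marginal_gen space_measure_of)
qed

text \<open>Every index lies in \<open>coord q (int n)\<close> for large \<open>n\<close>. Hence the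
  limit along any single coordinate is the full algebra, which is why \<open>Top_op q\<close> is the
  same for all \<open>q\<close>.\<close>

lemma gen_increasing:
  assumes f: "f \<in> Lp M p"
  shows "(\<lambda>n. moment M p (\<lambda>x. real_cond_exp M (gen (coord q (int n))) f x - real_cond_exp M (gen UNIV) f x)) \<longlonglongrightarrow> 0"
proof (rule martingale_converges_if_bounded[OF subalgebra_gen subalgebra_gen p _ f])
  fix g c assume g: "g \<in> borel_measurable M" "\<And>x. \<bar>g x\<bar> \<le> (c::real)"
  show "(\<lambda>n. moment M p (\<lambda>x. real_cond_exp M (gen (coord q (int n))) g x - real_cond_exp M (gen UNIV) g x)) \<longlonglongrightarrow> 0"
  proof (rule bounded_increasing_martingale[OF subalgebra_gen _ subalgebra_gen _ Int_stable_F[OF box_UNIV] _ _ sets_gen g p])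
    show "sets (gen (coord q (int m))) \<subseteq> sets (gen (coord q (int n)))" if "m \<le> n" for m n
      using that by (intro gen_mono) (auto simp: coord_def)
    show "sets (gen (coord q (int n))) \<subseteq> sets (gen UNIV)" for n by (intro gen_mono) simp
    have "space M \<in> sets (F i)" for i using subalgebra_F[of i] sets.top[of "F i"] by (simp add: subalgebra_def)
    then show "space M \<in> (\<Union>i. sets (F i))" by blast
    fix A assume "A \<in> (\<Union>i. sets (F i))"
    then obtain i where i: "A \<in> sets (F i)" by auto
    moreover have "i \<in> coord q (int (nat (i q)))" by (simp add: coord_def)
    ultimately show "\<exists>n. A \<in> sets (gen (coord q (int n)))" using F_le_gen by blast
  qed
qed

lemma gen_decreasing:
  assumes f: "f \<in> Lp M p"
  shows "(\<lambda>n. moment M p (\<lambda>x. real_cond_exp M (gen (coord q (- int n))) f x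
    - real_cond_exp M (marginal_tail M F q) f x)) \<longlonglongrightarrow> 0"
proof (rule martingale_converges_if_bounded[OF subalgebra_gen subalgebra_marginal_tail p _ f])
  fix g c assume g: "g \<in> borel_measurable M" "\<And>x. \<bar>g x\<bar> \<le> (c::real)"
  show "(\<lambda>n. moment M p (\<lambda>x. real_cond_exp M (gen (coord q (- int n))) g x
      - real_cond_exp M (marginal_tail M F q) g x)) \<longlonglongrightarrow> 0"
    by (rule bounded_decreasing_martingale[OF subalgebra_gen _ subalgebra_marginal_tail sets_marginal_tail g p])
      (intro gen_mono, auto simp: coord_def)
qed

definition Uop :: "'n \<Rightarrow> int \<Rightarrow> ('a set \<Rightarrow> real) \<Rightarrow> 'a set \<Rightarrow> real" where
  "Uop q k = lift (koop_pow T q k)"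

definition Qop :: "'n \<Rightarrow> int \<Rightarrow> ('a set \<Rightarrow> real) \<Rightarrow> 'a set \<Rightarrow> real" where
  "Qop q l = lift (Q_op M F l q)"

definition Top_op :: "'n \<Rightarrow> ('a set \<Rightarrow> real) \<Rightarrow> 'a set \<Rightarrow> real" where
  "Top_op q = lift (real_cond_exp M (filtration_sup M F))"

definition Tail_op :: "'n \<Rightarrow> ('a set \<Rightarrow> real) \<Rightarrow> 'a set \<Rightarrow> real" where
  "Tail_op q = lift (real_cond_exp M (marginal_tail M F q))"

lemma Q_op_gen: "Q_op M F l q = real_cond_exp M (gen (coord q l))"
  by (simp add: fun_eq_iff Q_op_def marginal_gen)

lemma contraction_koop_pow: "contraction (koop_pow T q k)"
  unfolding koop_pow_def by (rule contraction_koop)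

lemma contraction_Q_op: "contraction (Q_op M F l q)"
  unfolding Q_op_gen by (rule contraction_cond_exp[OF subalgebra_gen])

lemmas koop_pow_Lp [simp] = contraction_Lp[OF contraction_koop_pow]
lemmas koop_Lp [simp] = contraction_Lp[OF contraction_koop]
lemmas Q_op_Lp [simp] = contraction_Lp[OF contraction_Q_op]
lemmas cond_exp_gen_Lp [simp] = contraction_Lp[OF contraction_cond_exp[OF subalgebra_gen]]

lemma Uop_cls: "f \<in> Lp M p \<Longrightarrow> Uop q k (cls f) = cls (koop_pow T q k f)"
  unfolding Uop_def by (rule lift_cls[OF contraction_koop_pow])

lemma Qop_cls: "f \<in> Lp M p \<Longrightarrow> Qop q k (cls f) = cls (Q_op M F k q f)"
  unfolding Qop_def by (rule lift_cls[OF contraction_Q_op])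

lemma Top_op_cls: "f \<in> Lp M p \<Longrightarrow> Top_op q (cls f) = cls (real_cond_exp M (gen UNIV) f)"
  unfolding Top_op_def filtration_sup_gen by (rule lift_cls[OF contraction_cond_exp[OF subalgebra_gen]])

lemma Tail_op_cls: "f \<in> Lp M p \<Longrightarrow> Tail_op q (cls f) = cls (real_cond_exp M (marginal_tail M F q) f)"
  unfolding Tail_op_def by (rule lift_cls[OF contraction_cond_exp[OF subalgebra_marginal_tail]])

lemma cls_Q_op_Q_op:
  assumes f: "f \<in> Lp M p"
  shows "cls (Q_op M F k q (Q_op M F l r f)) = cls (real_cond_exp M (gen (coord q k \<inter> coord r l)) f)"
  unfolding Q_op_gen
  by (rule cls_cong[OF cond_exp_gen_gen[OF box_coord box_coord int_Lp[OF f]]]) (simp_all add: f)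

lemma cls_koop_Q_op:
  assumes f: "f \<in> Lp M p"
  shows "cls (koop_pow T q k (Q_op M F l r f)) = cls (Q_op M F (if q = r then l + k else l) r (koop_pow T q k f))"
proof (rule cls_cong)
  have "AE x in M. real_cond_exp M (gen (shift (\<lambda>r. k * unit_idx q r) (coord r l))) (koop_pow T q k f) x
      = koop_pow T q k (real_cond_exp M (gen (coord r l)) f) x"
    using cond_exp_gen_T[OF int_Lp[OF f], of "\<lambda>r. k * unit_idx q r"] by (simp add: koop_pow_def koop_def comp_def)
  then show "AE x in M. koop_pow T q k (Q_op M F l r f) x = Q_op M F (if q = r then l + k else l) r (koop_pow T q k f) x"
    unfolding Q_op_gen shift_coord by eventually_elim simp
qed (simp_all add: f)

lemma cls_koop_koop:
  assumes f: "f \<in> Lp M p"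
  shows "cls (koop_pow T q k (koop_pow T r l f)) = cls (koop T (\<lambda>s. k * unit_idx q s + l * unit_idx r s) f)"
  unfolding koop_pow_def by (rule cls_cong) (auto simp: koop_koop f)

lemma conv_cls_iff:
  assumes "s \<in> Lp M p" "\<And>n. X n \<in> Lp M p"
  shows "conv (\<lambda>n. cls (X n)) (cls s) A \<longleftrightarrow> ((\<lambda>n. moment M p (\<lambda>x. X n x - s x)) \<longlongrightarrow> 0) A"
proof -
  have "LpN (cls (X n) - cls s) = moment M p (\<lambda>x. X n x - s x)" for n
    using LpN_cls[OF diff_Lp[OF assms(2)[of n] assms(1)]] assms by (simp add: cls_diff)
  then show ?thesis using assms by (simp add: conv_def)
qed

sublocale commuting_filtrations LpV LpN "2 powr p" Uop Qop Top_op Tail_op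
proof
  show "bop (Uop q k)" "bop (Qop q k)" "bop (Top_op q)" "bop (Tail_op q)" for q k
    unfolding Uop_def Qop_def Top_op_def Tail_op_def filtration_sup_gen
    by (intro bop_lift contraction_koop_pow contraction_Q_op contraction_cond_exp subalgebra_gen subalgebra_marginal_tail)+
  fix v q r k l assume v: "v \<in> LpV"
  obtain f where f: "f \<in> Lp M p" "v = cls f" using v by (rule LpV_cases)
  show "LpN (Uop q k v) = LpN v"
    using f by (simp add: Uop_cls LpN_cls) (simp add: koop_pow_def moment_koop)
  show "Uop q k (Uop q l v) = Uop q (k + l) v"
    using f cls_koop_koop[OF f(1), of q k q l] by (simp add: Uop_cls) (simp add: koop_pow_def distrib_right)
  show "Uop q 0 v = v"
    using f cls_cong[of "koop T (\<lambda>_. 0) f" f] koop_zero by (simp add: Uop_cls) (simp add: koop_pow_def)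
  show "Qop q k (Qop q l v) = Qop q (min k l) v"
  proof -
    have "coord q k \<inter> coord q l = coord q (min k l)" by (auto simp: coord_def)
    then show ?thesis using f cls_Q_op_Q_op[OF f(1), of k q l q] by (simp add: Qop_cls) (simp add: Q_op_gen)
  qed
  show "Uop q k (Qop q l v) = Qop q (l + k) (Uop q k v)"
    using f cls_koop_Q_op[OF f(1), of q k l q] by (simp add: Qop_cls Uop_cls)
  show "Uop q k (Uop r l v) = Uop r l (Uop q k v)"
    using f cls_koop_koop[OF f(1), of q k r l] cls_koop_koop[OF f(1), of r l q k] by (simp add: Uop_cls add.commute)
  show "Uop q k (Qop r l v) = Qop r l (Uop q k v)" if "q \<noteq> r"
    using that f cls_koop_Q_op[OF f(1), of q k l r] by (simp add: Qop_cls Uop_cls)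
  show "Qop q k (Qop r l v) = Qop r l (Qop q k v)"
    using f cls_Q_op_Q_op[OF f(1), of k q l r] cls_Q_op_Q_op[OF f(1), of l r k q] by (simp add: Qop_cls Int_commute)
  show "conv (\<lambda>n. Qop q (int n) v) (Top_op q v) sequentially"
    using f gen_increasing[OF f(1), of q] by (simp add: Qop_cls Top_op_cls conv_cls_iff) (simp add: Q_op_gen)
  have "real_cond_exp M (marginal_tail M F q) f \<in> Lp M p"
    by (rule contraction_Lp[OF contraction_cond_exp[OF subalgebra_marginal_tail] f(1)])
  then show "conv (\<lambda>n. Qop q (- int n) v) (Tail_op q v) sequentially"
    using f gen_decreasing[OF f(1), of q] by (simp add: Qop_cls Tail_op_cls conv_cls_iff) (simp add: Q_op_gen)
qed

subsection \<open>Iterated series\<close>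

text \<open>The powers with exponents \<open>1 / p\<close> and \<open>p\<close> both preserve
  convergence to \<open>0\<close>.\<close>

lemma Lp_tendsto_iff:
  assumes s: "s \<in> Lp M p" and X: "\<And>n. X n \<in> Lp M p"
  shows "Lp_tendsto M p X s A \<longleftrightarrow> conv (\<lambda>n. cls (X n)) (cls s) A"
proof -
  let ?m = "\<lambda>n. moment M p (\<lambda>x. X n x - s x)"
  have norm: "Lp_norm M p (\<lambda>x. X n x - s x) = ?m n powr (1 / p)" for n
    by (simp add: Lp_norm_def moment_def)
  have "((\<lambda>n. ?m n powr (1 / p)) \<longlongrightarrow> 0) A \<longleftrightarrow> (?m \<longlongrightarrow> 0) A"
  proof
    assume "(?m \<longlongrightarrow> 0) A"
    then show "((\<lambda>n. ?m n powr (1 / p)) \<longlongrightarrow> 0) A"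
      using tendsto_powr'[of ?m 0 A "\<lambda>_. 1 / p" "1 / p"] p by simp
  next
    assume "((\<lambda>n. ?m n powr (1 / p)) \<longlongrightarrow> 0) A"
    then have "((\<lambda>n. (?m n powr (1 / p)) powr p) \<longlongrightarrow> 0) A"
      using tendsto_powr'[of "\<lambda>n. ?m n powr (1 / p)" 0 A "\<lambda>_. p" p] p by simp
    then show "(?m \<longlongrightarrow> 0) A" using p by (simp add: powr_powr)
  qed
  then show ?thesis using s X by (simp add: Lp_tendsto_def norm conv_cls_iff)
qed

lemma Lp_sums_iff:
  assumes b: "\<And>k. k \<in> idx_set R \<Longrightarrow> b k \<in> Lp M p" and s: "s \<in> Lp M p"
  shows "Lp_sums M p R b s \<longleftrightarrow> gsums R (\<lambda>k. cls (b k)) (cls s)"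
proof (cases R)
  case All_ints
  have "cls (\<lambda>x. \<Sum>k = m..n. b k x) = (\<Sum>k = m..n. cls (b k))" "(\<lambda>x. \<Sum>k = m..n. b k x) \<in> Lp M p" for m n :: int
    using b All_ints by (auto intro!: cls_sum Lp_sum[OF p])
  then show ?thesis
    using All_ints Lp_tendsto_iff[OF s, of "\<lambda>z x. \<Sum>k = - int (fst z)..int (snd z). b k x" "sequentially \<times>\<^sub>F sequentially"]
    by (simp add: gsums_All_ints case_prod_unfold)
next
  case (From a)
  have "cls (\<lambda>x. \<Sum>k = a..<n. b k x) = (\<Sum>k = a..<n. cls (b k))" "(\<lambda>x. \<Sum>k = a..<n. b k x) \<in> Lp M p" for n :: int
    using b From by (auto intro!: cls_sum Lp_sum[OF p])
  then show ?thesis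
    using From Lp_tendsto_iff[OF s, of "\<lambda>n x. \<Sum>k = a..<a + int n. b k x" sequentially] by simp
qed

lemma Lp_sums_Lp: "Lp_sums M p R b s \<Longrightarrow> s \<in> Lp M p"
  by (cases R) (auto simp: Lp_tendsto_def)

lemma iterated_gsums_if_Lp:
  assumes a: "\<And>i. a i \<in> Lp M p"
  shows "iterated_Lp_sums M p R L a i s \<Longrightarrow> s \<in> Lp M p \<and> iterated_gsums R L (\<lambda>i. cls (a i)) i (cls s)"
proof (induction L arbitrary: i s)
  case (Cons q L)
  then obtain b where b: "\<And>k. k \<in> idx_set (R q) \<Longrightarrow> iterated_Lp_sums M p R L a (i(q := k)) (b k)"
    and s: "Lp_sums M p (R q) b s" by auto
  have IH: "b k \<in> Lp M p" "iterated_gsums R L (\<lambda>i. cls (a i)) (i(q := k)) (cls (b k))"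
    if "k \<in> idx_set (R q)" for k using Cons.IH[OF b[OF that]] by blast+
  have "s \<in> Lp M p" by (rule Lp_sums_Lp[OF s])
  moreover have "gsums (R q) (\<lambda>k. cls (b k)) (cls s)" using Lp_sums_iff[of "R q" b, OF IH(1) \<open>s \<in> Lp M p\<close>] s by blast
  moreover have "\<forall>k \<in> idx_set (R q). iterated_gsums R L (\<lambda>i. cls (a i)) (i(q := k)) (cls (b k))"
    using IH(2) by blast
  ultimately show ?case unfolding iterated_gsums.simps by (intro conjI exI[of _ "\<lambda>k. cls (b k)"])
qed (simp add: a)

text \<open>Going back from classes, a representative is chosen for each inner sum; at the end of
  the list it is the term \<open>a i\<close> itself.\<close>

lemma iterated_Lp_sums_if_gsums:
  assumes a: "\<And>i. a i \<in> Lp M p"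
  shows "iterated_gsums R L (\<lambda>i. cls (a i)) i v \<Longrightarrow> \<exists>s \<in> Lp M p. cls s = v \<and> iterated_Lp_sums M p R L a i s"
proof (induction L arbitrary: i v)
  case (Cons q L)
  then obtain b where b: "\<And>k. k \<in> idx_set (R q) \<Longrightarrow> iterated_gsums R L (\<lambda>i. cls (a i)) (i(q := k)) (b k)"
    and v: "gsums (R q) b v" by auto
  have "\<forall>k \<in> idx_set (R q). \<exists>s. s \<in> Lp M p \<and> cls s = b k \<and> iterated_Lp_sums M p R L a (i(q := k)) s"
    using Cons.IH[OF b] by blast
  from bchoice[OF this] obtain c where c: "\<forall>k \<in> idx_set (R q).
      c k \<in> Lp M p \<and> cls (c k) = b k \<and> iterated_Lp_sums M p R L a (i(q := k)) (c k)" ..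
  obtain s where s: "s \<in> Lp M p" "v = cls s" using gsums_closed[OF v] by (rule LpV_cases)
  have "gsums (R q) (\<lambda>k. cls (c k)) (cls s)" using gsums_cong[OF v, of "\<lambda>k. cls (c k)"] c s by simp
  then have "Lp_sums M p (R q) c s" using Lp_sums_iff[of "R q" c s] c s by blast
  then have "iterated_Lp_sums M p R (q # L) a i s" using c by auto
  then show ?case using s by blast
qed (use a in auto)

lemma iterated_Lp_summable_iff:
  assumes "\<And>i. a i \<in> Lp M p"
  shows "iterated_Lp_summable M p R L a \<longleftrightarrow> (\<exists>v. iterated_gsums R L (\<lambda>i. cls (a i)) (\<lambda>_. 0) v)"
  unfolding iterated_Lp_summable_def
  using iterated_gsums_if_Lp[of a, OF assms] iterated_Lp_sums_if_gsums[of a, OF assms] by blast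

subsection \<open>Transfer of the conditions\<close>

lemma cls_foldr:
  assumes "\<And>q h. q \<in> set L \<Longrightarrow> h \<in> Lp M p \<Longrightarrow> A q h \<in> Lp M p \<and> cls (A q h) = B q (cls h)" "f \<in> Lp M p"
  shows "foldr A L f \<in> Lp M p \<and> cls (foldr A L f) = foldr B L (cls f)"
  using assms by (induction L) auto

lemma P_op_Lp: "f \<in> Lp M p \<Longrightarrow> P_op M F 0 q f \<in> Lp M p \<and> cls (P_op M F 0 q f) = diff_proj q (cls f)"
  by (simp add: P_op_def diff_proj_def Qop_cls cls_diff diff_Lp)

lemma Q_op_compl_Lp:
  "f \<in> Lp M p \<Longrightarrow> (\<lambda>x. f x - Q_op M F l q f x) \<in> Lp M p \<and> cls (\<lambda>x. f x - Q_op M F l q f x) = cls f - Qop q l (cls f)"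
  by (simp add: Qop_cls cls_diff diff_Lp)

text \<open>The six blocks of \<open>series_term\<close> are two products over the same grouped
  list, projections outside and powers of \<open>U\<close> inside. Merging them coordinate by
  coordinate gives \<open>summand_op\<close>; \<open>J\<close> carries the sign of the
  \<open>Future\<close> indices.\<close>

lemma series_term_cls:
  assumes f: "f \<in> Lp M p" and qs: "distinct qs"
    and t: "\<And>q. t q \<noteq> Adapt" and S: "S = {q. t q = Mart}" "S' = {q. t q = Past}"
  defines "L \<equiv> filter (\<lambda>q. t q = Mart) qs @ filter (\<lambda>q. t q = Past) qs @ filter (\<lambda>q. t q = Future) qs"
  shows "series_term M T F qs S S' f i \<in> Lp M p"
    and "cls (series_term M T F qs S S' f i) = foldr (\<lambda>q. summand_op q (t q) (i q)) L (cls f)"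
proof -
  let ?rs = "filter (\<lambda>q. t q = Mart) qs" and ?us = "filter (\<lambda>q. t q = Past) qs"
    and ?vs = "filter (\<lambda>q. t q = Future) qs"
  have "q \<in> - S - S' \<longleftrightarrow> t q = Future" for q using t[of q] S by (cases "t q") auto
  then have st: "series_term M T F qs S S' f i = foldr (P_op M F 0) ?rs (foldr (Q_op M F (- 1)) ?us
      (foldr (\<lambda>v h x. h x - Q_op M F (- 1) v h x) ?vs (foldr (\<lambda>r. koop_pow T r (i r)) ?rs
        (foldr (\<lambda>u. koop_pow T u (i u)) ?us (foldr (\<lambda>v. koop_pow T v (- i v)) ?vs f)))))"
    unfolding series_term_def Let_def using S by simp
  define J where "J q = (if t q = Future then - i q else i q)" for q
  define P where "P q = (case t q of Mart \<Rightarrow> diff_proj q | Past \<Rightarrow> Qop q (- 1)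
    | Future \<Rightarrow> (\<lambda>v. v - Qop q (- 1) v) | Adapt \<Rightarrow> (\<lambda>v. v))" for q
  have U: "foldr (\<lambda>r. koop_pow T r (e r)) K h \<in> Lp M p \<and>
      cls (foldr (\<lambda>r. koop_pow T r (e r)) K h) = foldr (\<lambda>r. Uop r (J r)) K (cls h)"
    if "h \<in> Lp M p" "\<And>q. q \<in> set K \<Longrightarrow> e q = J q" for e K h
    by (rule cls_foldr[OF _ that(1)]) (simp add: Uop_cls that(2))
  have inner: "foldr (\<lambda>r. koop_pow T r (i r)) ?rs
        (foldr (\<lambda>u. koop_pow T u (i u)) ?us (foldr (\<lambda>v. koop_pow T v (- i v)) ?vs f)) \<in> Lp M p \<and>
      cls (foldr (\<lambda>r. koop_pow T r (i r)) ?rs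
        (foldr (\<lambda>u. koop_pow T u (i u)) ?us (foldr (\<lambda>v. koop_pow T v (- i v)) ?vs f)))
      = foldr (\<lambda>r. Uop r (J r)) L (cls f)" (is "?h \<in> _ \<and> _")
  proof -
    have v: "foldr (\<lambda>v. koop_pow T v (- i v)) ?vs f \<in> Lp M p \<and>
        cls (foldr (\<lambda>v. koop_pow T v (- i v)) ?vs f) = foldr (\<lambda>r. Uop r (J r)) ?vs (cls f)"
      by (rule U[OF f]) (simp add: J_def)
    have u: "foldr (\<lambda>u. koop_pow T u (i u)) ?us h \<in> Lp M p \<and>
        cls (foldr (\<lambda>u. koop_pow T u (i u)) ?us h) = foldr (\<lambda>r. Uop r (J r)) ?us (cls h)"
      if "h \<in> Lp M p" for h by (rule U[OF that]) (simp add: J_def)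
    have r: "foldr (\<lambda>u. koop_pow T u (i u)) ?rs h \<in> Lp M p \<and>
        cls (foldr (\<lambda>u. koop_pow T u (i u)) ?rs h) = foldr (\<lambda>r. Uop r (J r)) ?rs (cls h)"
      if "h \<in> Lp M p" for h by (rule U[OF that]) (simp add: J_def)
    show ?thesis unfolding L_def foldr_append using u v r by simp
  qed
  have outer: "foldr (P_op M F 0) ?rs (foldr (Q_op M F (- 1)) ?us
      (foldr (\<lambda>v h x. h x - Q_op M F (- 1) v h x) ?vs h)) \<in> Lp M p \<and>
    cls (foldr (P_op M F 0) ?rs (foldr (Q_op M F (- 1)) ?us
      (foldr (\<lambda>v h x. h x - Q_op M F (- 1) v h x) ?vs h))) = foldr P L (cls h)"
    if h: "h \<in> Lp M p" for h
  proof -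
    have v: "foldr (\<lambda>v h x. h x - Q_op M F (- 1) v h x) ?vs h \<in> Lp M p \<and>
        cls (foldr (\<lambda>v h x. h x - Q_op M F (- 1) v h x) ?vs h) = foldr P ?vs (cls h)"
      by (rule cls_foldr[OF _ h]) (simp add: Q_op_compl_Lp P_def)
    have u: "foldr (Q_op M F (- 1)) ?us h \<in> Lp M p \<and> cls (foldr (Q_op M F (- 1)) ?us h) = foldr P ?us (cls h)"
      if "h \<in> Lp M p" for h
      by (rule cls_foldr[OF _ that]) (simp add: Qop_cls P_def)
    have r: "foldr (P_op M F 0) ?rs h \<in> Lp M p \<and> cls (foldr (P_op M F 0) ?rs h) = foldr P ?rs (cls h)"
      if "h \<in> Lp M p" for h
      by (rule cls_foldr[OF _ that]) (simp add: P_op_Lp P_def)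
    show ?thesis unfolding L_def foldr_append using u v r by simp
  qed
  have *: "series_term M T F qs S S' f i \<in> Lp M p \<and>
      cls (series_term M T F qs S S' f i) = foldr P L (foldr (\<lambda>r. Uop r (J r)) L (cls f))"
    unfolding st using outer[OF conjunct1[OF inner]] conjunct2[OF inner] by simp
  have ops: "coord_ops P" "coord_ops (\<lambda>r. Uop r (J r))"
  proof -
    have "coord_op q (P q)" for q
      by (cases "t q") (simp_all add: P_def op_diff_proj op_Q op_ident op_diff[OF op_ident op_Q])
    then show "coord_ops P" "coord_ops (\<lambda>r. Uop r (J r))" by (simp_all add: coord_ops_def op_U)
  qed
  have "distinct L" unfolding L_def using qs by auto
  then have "foldr P L (foldr (\<lambda>r. Uop r (J r)) L (cls f)) = foldr (\<lambda>q w. P q (Uop q (J q) w)) L (cls f)"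
    using f by (intro foldr_foldr ops) simp_all
  also have "\<dots> = foldr (\<lambda>q. summand_op q (t q) (i q)) L (cls f)"
  proof (rule foldr_cong[OF refl refl])
    show "P q (Uop q (J q) w) = summand_op q (t q) (i q) w" for q w
      using t[of q] by (cases "t q") (simp_all add: P_def J_def)
  qed
  finally show "series_term M T F qs S S' f i \<in> Lp M p"
    "cls (series_term M T F qs S S' f i) = foldr (\<lambda>q. summand_op q (t q) (i q)) L (cls f)"
    using * by simp_all
qed

lemma series_converges_iff:
  assumes f: "f \<in> Lp M p" and qs: "distinct qs"
    and t: "\<And>q. t q \<noteq> Adapt" and S: "S = {q. t q = Mart}" "S' = {q. t q = Past}"
  shows "series_converges M T F qs p S S' f \<longleftrightarrow>
    (let L = filter (\<lambda>q. t q = Mart) qs @ filter (\<lambda>q. t q = Past) qs @ filter (\<lambda>q. t q = Future) qs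
     in \<exists>s. iterated_gsums (\<lambda>q. summand_range (t q)) L (\<lambda>i. foldr (\<lambda>q. summand_op q (t q) (i q)) L (cls f)) (\<lambda>_. 0) s)"
proof -
  let ?L = "filter (\<lambda>q. t q = Mart) qs @ filter (\<lambda>q. t q = Past) qs @ filter (\<lambda>q. t q = Future) qs"
  have F: "q \<in> - S - S' \<longleftrightarrow> t q = Future" for q using t[of q] S by (cases "t q") auto
  have R: "series_range S S' = (\<lambda>q. summand_range (t q))"
  proof
    show "series_range S S' q = summand_range (t q)" for q
      using t[of q] S by (cases "t q") (auto simp: series_range_def)
  qed
  have L: "filter (\<lambda>q. q \<in> S) qs @ filter (\<lambda>q. q \<in> S') qs @ filter (\<lambda>q. q \<in> - S - S') qs = ?L"
    unfolding F using S by simp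
  show ?thesis
    unfolding series_converges_def R L Let_def
    by (subst iterated_Lp_summable_iff) (simp_all only: series_term_cls[OF f qs t S])
qed

lemma mart_cls_iff: "g \<in> Lp M p \<Longrightarrow>
    mart q (cls g) \<longleftrightarrow> g \<in> Lp_diff M p (marginal M F q 0) (marginal M F q (- 1))"
  unfolding mart_def Lp_diff_def marginal_gen
  using ae_measurable_iff[OF subalgebra_gen int_Lp, of g "coord q 0"]
    cls_eq_iff[of "real_cond_exp M (gen (coord q 0)) g" g]
    cls_eq_iff[of "real_cond_exp M (gen (coord q (- 1))) g" "\<lambda>x. 0"]
  by (simp add: Qop_cls Q_op_gen Lp_zero cls_zero)

lemma foldr_cob_cls:
  assumes g: "g \<in> Lp M p"
  shows "foldr (\<lambda>q h y. h y - koop T (unit_idx q) h y) (filter (\<lambda>q. q \<in> - S) qs) g \<in> Lp M p \<and>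
    cls (foldr (\<lambda>q h y. h y - koop T (unit_idx q) h y) (filter (\<lambda>q. q \<in> - S) qs) g) = foldr (cob S) qs (cls g)"
proof -
  have "foldr (cob S) qs v = foldr (cob S) (filter (\<lambda>q. q \<in> - S) qs) v" for v
    by (induction qs) (auto simp: cob_def)
  moreover have "koop_pow T q 1 = koop T (unit_idx q)" for q by (simp add: koop_pow_def)
  ultimately show ?thesis
    using cls_foldr[of "filter (\<lambda>q. q \<in> - S) qs" "\<lambda>q h y. h y - koop T (unit_idx q) h y" "cob S" g] g
    by (simp add: cob_def Uop_cls cls_diff diff_Lp)
qed

lemma mart_cobound_decomp_iff:
  assumes f: "f \<in> Lp M p"
  shows "mart_cobound_decomp M T F qs p f \<longleftrightarrow> decomp qs (cls f)"
proof
  let ?C = "\<lambda>S g. foldr (\<lambda>q h y. h y - koop T (unit_idx q) h y) (filter (\<lambda>q. q \<in> - S) qs) g"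
  have sum: "(\<lambda>x. \<Sum>S \<in> UNIV. ?C S (g S) x) \<in> Lp M p"
    "cls (\<lambda>x. \<Sum>S \<in> UNIV. ?C S (g S) x) = (\<Sum>S \<in> UNIV. foldr (cob S) qs (cls (g S)))"
    if "\<And>S. g S \<in> Lp M p" for g
    using foldr_cob_cls[OF that] Lp_sum[OF p, of UNIV "\<lambda>S. ?C S (g S)"] cls_sum[of UNIV "\<lambda>S. ?C S (g S)"]
    by simp_all
  {
    assume "mart_cobound_decomp M T F qs p f"
    then obtain g where g: "\<And>S. g S \<in> Lp M p"
      "\<And>S q. q \<in> S \<Longrightarrow> g S \<in> Lp_diff M p (marginal M F q 0) (marginal M F q (- 1))"
      and f_eq: "AE x in M. f x = (\<Sum>S \<in> UNIV. ?C S (g S) x)"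
      unfolding mart_cobound_decomp_def by blast
    have "cls f = (\<Sum>S \<in> UNIV. foldr (cob S) qs (cls (g S)))"
      using cls_cong[OF f_eq f sum(1)[of g, OF g(1)]] sum(2)[of g, OF g(1)] by simp
    moreover have "\<forall>S. cls (g S) \<in> LpV \<and> (\<forall>q \<in> S. mart q (cls (g S)))"
      using g by (simp add: mart_cls_iff)
    ultimately show "decomp qs (cls f)" unfolding decomp_def by (intro exI[of _ "\<lambda>S. cls (g S)"]) blast
  next
    assume "decomp qs (cls f)"
    then obtain \<gamma> where \<gamma>: "\<And>S. \<gamma> S \<in> LpV" "\<And>S q. q \<in> S \<Longrightarrow> mart q (\<gamma> S)"
      and f_eq: "cls f = (\<Sum>S \<in> UNIV. foldr (cob S) qs (\<gamma> S))" unfolding decomp_def by blast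
    define g where "g S = rep (\<gamma> S)" for S
    have g: "g S \<in> Lp M p" "cls (g S) = \<gamma> S" for S by (simp_all add: g_def rep_Lp cls_rep \<gamma>)
    have "AE x in M. f x = (\<Sum>S \<in> UNIV. ?C S (g S) x)"
      using cls_eq_iff[OF f sum(1)[of g, OF g(1)]] sum(2)[of g, OF g(1)] f_eq by (simp add: g(2))
    moreover have "\<forall>S. g S \<in> Lp M p \<and> (\<forall>q \<in> S. g S \<in> Lp_diff M p (marginal M F q 0) (marginal M F q (- 1)))"
      using g \<gamma> by (simp flip: mart_cls_iff)
    ultimately show "mart_cobound_decomp M T F qs p f"
      unfolding mart_cobound_decomp_def by (intro exI[of _ g]) blast
  }
qed

lemma reg_cls:
  assumes f: "f \<in> Lp M p" and r: "regular M F f" shows "reg q (cls f)"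
proof -
  have "AE x in M. real_cond_exp M (gen UNIV) f x = f x"
    using r ae_measurable_iff[OF subalgebra_gen int_Lp[OF f]] by (simp add: regular_def filtration_sup_gen)
  then have "Top_op q (cls f) = cls f" unfolding Top_op_cls[OF f] by (rule cls_cong) (simp_all add: f)
  moreover have "AE x in M. real_cond_exp M (marginal_tail M F q) f x = 0" using r by (simp add: regular_def)
  then have "Tail_op q (cls f) = cls (\<lambda>x. 0)"
    unfolding Tail_op_cls[OF f]
    by (rule cls_cong) (simp_all add: Lp_zero contraction_Lp[OF contraction_cond_exp[OF subalgebra_marginal_tail] f])
  ultimately show ?thesis using f by (simp add: reg_def cls_zero)
qed

lemma foldr_koop_pow:
  "distinct L \<Longrightarrow> x \<in> space M \<Longrightarrow>
    foldr (\<lambda>q. koop_pow T q (i q)) L f x = koop T (\<lambda>r. if r \<in> set L then i r else 0) f x"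
proof (induction L arbitrary: x)
  case (Cons q L)
  let ?e = "\<lambda>r. i q * unit_idx q r"
  have "foldr (\<lambda>q. koop_pow T q (i q)) (q # L) f x = foldr (\<lambda>q. koop_pow T q (i q)) L f (T ?e x)"
    by (simp add: koop_pow_def koop_def)
  also have "\<dots> = f (T (\<lambda>r. if r \<in> set L then i r else 0) (T ?e x))"
    using Cons T_space by (simp add: koop_def)
  also have "\<dots> = f (T (\<lambda>r. (if r \<in> set L then i r else 0) + ?e r) x)"
    using T_add[OF Cons.prems(2), of "\<lambda>r. if r \<in> set L then i r else 0" ?e] by simp
  also have "(\<lambda>r. (if r \<in> set L then i r else 0) + ?e r) = (\<lambda>r. if r \<in> set (q # L) then i r else 0)"
    using Cons.prems(1) by (auto simp: fun_eq_iff unit_idx_def)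
  finally show ?case by (simp add: koop_def)
qed (simp add: koop_zero)

text \<open>The box theorem intersects the half-spaces; over all coordinates they leave
  \<open>{..0}\<close>, that is, the algebra \<open>F 0\<close>. The list is nonempty because an
  empty intersection would give \<open>gen UNIV\<close>, whose conditional expectation need not be
  the identity.\<close>

lemma foldr_Qop:
  "L \<noteq> [] \<Longrightarrow> f \<in> Lp M p \<Longrightarrow>
    foldr (\<lambda>q. Qop q 0) L (cls f) = cls (real_cond_exp M (gen (\<Inter>q \<in> set L. coord q 0)) f)"
proof (induction L rule: list_nonempty_induct)
  case (single q)
  then show ?case by (simp add: Qop_cls Q_op_gen)
next
  case (cons q L)
  have box: "box (\<Inter>q \<in> set L. coord q 0)" if "L \<noteq> []" for L :: "'n list"
    using that by (induction L rule: list_nonempty_induct) (auto intro: box_coord box_Int)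
  have "foldr (\<lambda>q. Qop q 0) (q # L) (cls f)
      = cls (real_cond_exp M (gen (coord q 0)) (real_cond_exp M (gen (\<Inter>q \<in> set L. coord q 0)) f))"
    using cons by (simp add: Qop_cls Q_op_gen)
  also have "\<dots> = cls (real_cond_exp M (gen (coord q 0 \<inter> (\<Inter>q \<in> set L. coord q 0))) f)"
    using cons by (intro cls_cong cond_exp_gen_gen box_coord box int_Lp) simp_all
  finally show ?case by simp
qed

lemma sets_gen_atMost: "sets (gen {..j}) = sets (F j)"
proof
  show "sets (F j) \<subseteq> sets (gen {..j})" by (rule F_le_gen) simp
  have "(\<Union>i \<in> {..j}. sets (F i)) \<subseteq> sets (F j)" using F_mono by auto
  then show "sets (gen {..j}) \<subseteq> sets (F j)"
    using sets.sigma_sets_subset[of "\<Union>i \<in> {..j}. sets (F i)" "F j"] subalgebra_F[of j]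
    by (simp add: sets_gen subalgebra_def)
qed

text \<open>Both operators factor through the coordinates, \<open>koop T i\<close> into powers along
  the axes and the conditioning on \<open>F 0\<close> into half-spaces; merging the factors gives
  the \<open>Adapt\<close> summands.\<close>

lemma cond_exp_koop_cls:
  assumes f: "f \<in> Lp M p" and qs: "distinct qs" "set qs = UNIV"
  shows "real_cond_exp M (F (\<lambda>_. 0)) (koop T i f) \<in> Lp M p"
    and "cls (real_cond_exp M (F (\<lambda>_. 0)) (koop T i f)) = foldr (\<lambda>q. summand_op q Adapt (i q)) qs (cls f)"
proof -
  show "real_cond_exp M (F (\<lambda>_. 0)) (koop T i f) \<in> Lp M p"
    by (rule contraction_Lp[OF contraction_cond_exp[OF subalgebra_F]]) (simp add: f)
  have ne: "qs \<noteq> []" using qs(2) by auto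
  have U: "foldr (\<lambda>q. koop_pow T q (i q)) qs f \<in> Lp M p \<and>
      cls (foldr (\<lambda>q. koop_pow T q (i q)) qs f) = foldr (\<lambda>q. Uop q (i q)) qs (cls f)"
    by (rule cls_foldr[OF _ f]) (simp add: Uop_cls)
  have "cls (koop T i f) = cls (foldr (\<lambda>q. koop_pow T q (i q)) qs f)"
    using U f qs by (intro cls_cong) (auto simp: foldr_koop_pow)
  then have koop: "cls (koop T i f) = foldr (\<lambda>q. Uop q (i q)) qs (cls f)" using U by simp
  have "(\<Inter>q \<in> set qs. coord q 0) = {..(\<lambda>_. 0)}" using qs by (auto simp: coord_def le_fun_def)
  then have "cls (real_cond_exp M (F (\<lambda>_. 0)) (koop T i f)) = foldr (\<lambda>q. Qop q 0) qs (cls (koop T i f))"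
    using foldr_Qop[OF ne koop_Lp[OF f], of i] subalgebra_F[of "\<lambda>_. 0"]
      real_cond_exp_sets_cong[OF sets_gen_atMost[of "\<lambda>_. 0"]]
    by (simp add: subalgebra_def)
  also have "\<dots> = foldr (\<lambda>q w. Qop q 0 (Uop q (i q) w)) qs (cls f)"
    unfolding koop using f qs by (intro foldr_foldr) (simp_all add: coord_ops_def op_Q op_U)
  finally show "cls (real_cond_exp M (F (\<lambda>_. 0)) (koop T i f)) = foldr (\<lambda>q. summand_op q Adapt (i q)) qs (cls f)"
    by simp
qed

lemma Qop_adapted:
  assumes f: "f \<in> Lp M p" and a: "adapted M F f" shows "Qop q 0 (cls f) = cls f"
proof -
  obtain h where h: "h \<in> borel_measurable (F (\<lambda>_. 0))" "AE x in M. f x = h x"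
    using a by (auto simp: adapted_def ae_measurable_def)
  have "h \<in> borel_measurable (gen (coord q 0))" by (rule measurable_gen_if_F[OF _ h(1)]) (simp add: coord_def)
  then have "ae_measurable M (gen (coord q 0)) f" using h(2) unfolding ae_measurable_def by blast
  then have "AE x in M. real_cond_exp M (gen (coord q 0)) f x = f x"
    using ae_measurable_iff[OF subalgebra_gen int_Lp[OF f]] by blast
  then show ?thesis unfolding Qop_cls[OF f] Q_op_gen by (rule cls_cong) (simp_all add: f)
qed

end

theorem theorem4:
  fixes M :: "'a measure"
    and T :: "('n::finite \<Rightarrow> int) \<Rightarrow> 'a \<Rightarrow> 'a"
    and F :: "('n \<Rightarrow> int) \<Rightarrow> 'a measure"
    and qs :: "'n list"
    and p :: real
    and f :: "'a \<Rightarrow> real"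
  assumes "prob_space M"
    and "measure_preserving_action M T"
    and "completely_commuting_filtration M T F"
    and "distinct qs" and "set qs = UNIV"
    and "1 \<le> p"
    and "f \<in> Lp M p"
    and "regular M F f"
  shows "(mart_cobound_decomp M T F qs p f \<longleftrightarrow>
            (\<forall>S S'. S' \<subseteq> - S \<longrightarrow> series_converges M T F qs p S S' f)) \<and>
         (adapted M F f \<longrightarrow>
            (mart_cobound_decomp M T F qs p f \<longleftrightarrow>
             iterated_Lp_summable M p (\<lambda>_. From 0) qs
               (\<lambda>i. real_cond_exp M (F (\<lambda>_. 0)) (koop T i f))))"
proof -
  interpret Lp_filtration M T F p
    using assms(1-3,6)
    by (simp add: Lp_filtration_def Lp_filtration_axioms_def action_filtration_def action_filtration_axioms_def)
  note qs = assms(4,5) and f = assms(7)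
  have reg: "reg q (cls f)" for q by (rule reg_cls[OF f assms(8)])
  show ?thesis
  proof (intro conjI impI iffI allI)
    fix S S' :: "'n set" assume "mart_cobound_decomp M T F qs p f" and S': "S' \<subseteq> - S"
    then have d: "decomp qs (cls f)" by (simp add: mart_cobound_decomp_iff f)
    \<comment> \<open>Coordinates in neither set are \<open>Future\<close>; \<open>Adapt\<close>
      occurs only in the adapted series.\<close>
    define t where "t q = (if q \<in> S then Mart else if q \<in> S' then Past else Future)" for q
    have t: "t q \<noteq> Adapt" for q by (simp add: t_def)
    have S: "S = {q. t q = Mart}" "S' = {q. t q = Past}" using S' by (auto simp: t_def)
    show "series_converges M T F qs p S S' f"
      unfolding series_converges_iff[OF f qs(1) t S] Let_def
    proof (rule iterated_gsums_if_decomp[OF qs _ _ reg d])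
      have "t q = Mart \<or> t q = Past \<or> t q = Future" for q by (simp add: t_def)
      then show "set (filter (\<lambda>q. t q = Mart) qs @ filter (\<lambda>q. t q = Past) qs @ filter (\<lambda>q. t q = Future) qs) = UNIV"
        using qs by auto
    qed (use qs in auto)
  next
    assume conv: "\<forall>S S'. S' \<subseteq> - S \<longrightarrow> series_converges M T F qs p S S' f"
    have "decomp qs (cls f)"
    proof (rule decomp_if_iterated_gsums[OF qs reg])
      fix t :: "'n \<Rightarrow> summand" assume t: "\<forall>q. t q \<noteq> Adapt"
      \<comment> \<open>The two sets are disjoint because each coordinate has a single type.\<close>
      have "series_converges M T F qs p {q. t q = Mart} {q. t q = Past} f" using conv by (metis (mono_tags, lifting) ComplI mem_Collect_eq subsetI summand.distinct(1))
      then show "let L = filter (\<lambda>q. t q = Mart) qs @ filter (\<lambda>q. t q = Past) qs @ filter (\<lambda>q. t q = Future) qs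
        in \<exists>s. iterated_gsums (\<lambda>q. summand_range (t q)) L
          (\<lambda>i. foldr (\<lambda>q. summand_op q (t q) (i q)) L (cls f)) (\<lambda>_. 0) s"
        using series_converges_iff[OF f qs(1) _ refl refl, of t] t by blast
    qed
    then show "mart_cobound_decomp M T F qs p f" by (simp add: mart_cobound_decomp_iff f)
  next
    assume "mart_cobound_decomp M T F qs p f"
    then have "decomp qs (cls f)" by (simp add: mart_cobound_decomp_iff f)
    \<comment> \<open>Another instance of the convergence theorem, with the type
      \<open>Adapt\<close> in every coordinate.\<close>
    then show "iterated_Lp_summable M p (\<lambda>_. From 0) qs (\<lambda>i. real_cond_exp M (F (\<lambda>_. 0)) (koop T i f))"
      using iterated_gsums_if_decomp[OF qs qs reg, of "\<lambda>_. Adapt" "\<lambda>_. 0"]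
      by (simp add: iterated_Lp_summable_iff cond_exp_koop_cls[OF f qs])
  next
    assume a: "adapted M F f"
      and "iterated_Lp_summable M p (\<lambda>_. From 0) qs (\<lambda>i. real_cond_exp M (F (\<lambda>_. 0)) (koop T i f))"
    then obtain v where "iterated_gsums (\<lambda>_. From 0) qs (\<lambda>i. foldr (\<lambda>q. summand_op q Adapt (i q)) qs (cls f)) (\<lambda>_. 0) v"
      by (auto simp: iterated_Lp_summable_iff cond_exp_koop_cls[OF f qs])
    then have "decomp qs (cls f)"
      by (rule decomp_if_iterated_gsums_adapted[OF qs reg Qop_adapted[OF f a]])
    then show "mart_cobound_decomp M T F qs p f" by (simp add: mart_cobound_decomp_iff f)
  qed
qed

end
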